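(* Let $p>q>1$ be real numbers. Then neither $\ell_{p^*}\otimes_\varepsilon\ell_q$ nor $\ell_p\otimes_\pi\ell_{q^*}$ has a Besselian Schauder frame (and hence neither has an unconditional Schauder frame).
   Context: For $r\in\,]1,\infty[$, $r^*=r/(r-1)$ is the conjugate exponent. For Banach spaces $E,F$, $E\otimes_\pi F$ and $E\otimes_\varepsilon F$ are the completions of the algebraic tensor product $E\otimes F$ for the projective norm $\pi(u)=\inf\{\sum_{i=1}^n\|x_i\|\|y_i\|:u=\sum_{i=1}^n x_i\otimes y_i\}$ and the injective norm $\varepsilon(\sum_i x_i\otimes y_i)=\sup\{|\sum_i f^*(x_i)g^*(y_i)|:\|f^*\|_{E^*}\le1,\ \|g^*\|_{F^*}\le1\}$ respectively. A Schauder frame for a Banach space $E$ is a sequence $((a_n,b_n^* ))_{n\ge1}$ in $E\times E^*$ such that for every $x\in E$ the series $\sum_n b_n^*(x)a_n$ converges in norm to $x$; it is an unconditional Schauder frame if all these series converge unconditionally, and a Besselian Schauder frame if there is $B>0$ with $\sum_{n=1}^\infty|b_n^*(x)||y^*(a_n)|\le B\|x\|_E\|y^*\|_{E^*}$ for all $x\in E$, $y^*\in E^*$. *)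

theory Defs
  imports "HOL-Analysis.Analysis"
begin

text \<open>
  The exponent of \<open>\<ell>\<^sub>p\<close> is a term, so normed spaces are given by explicit carriers and operations.
  The scalar type is \<open>'k::{real_normed_field, euclidean_space}\<close>: a finite-dimensional commutative
  real division algebra with multiplicative norm, that is, up to isomorphism exactly the real or
  the complex numbers.
\<close>

record ('k, 'v) nspace =
  carrier :: "'v set"
  vzero :: 'v
  vadd :: "'v \<Rightarrow> 'v \<Rightarrow> 'v"
  vscale :: "'k \<Rightarrow> 'v \<Rightarrow> 'v"
  vnorm :: "'v \<Rightarrow> real"

definition vdiff :: "('k::{real_normed_field, euclidean_space}, 'v) nspace \<Rightarrow> 'v \<Rightarrow> 'v \<Rightarrow> 'v" where
  "vdiff E x y = vadd E x (vscale E (- 1) y)"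

primrec vsum :: "('k, 'v) nspace \<Rightarrow> (nat \<Rightarrow> 'v) \<Rightarrow> nat \<Rightarrow> 'v" where
  "vsum E s 0 = vzero E"
| "vsum E s (Suc n) = vadd E (vsum E s n) (s n)"

definition vsums ::
  "('k::{real_normed_field, euclidean_space}, 'v) nspace \<Rightarrow> (nat \<Rightarrow> 'v) \<Rightarrow> 'v \<Rightarrow> bool" where
  "vsums E s l \<longleftrightarrow> l \<in> carrier E \<and> (\<lambda>N. vnorm E (vdiff E (vsum E s N) l)) \<longlonglongrightarrow> 0"

definition uncond_summable ::
  "('k::{real_normed_field, euclidean_space}, 'v) nspace \<Rightarrow> (nat \<Rightarrow> 'v) \<Rightarrow> bool" where
  "uncond_summable E s \<longleftrightarrow> (\<forall>\<sigma>. bij \<sigma> \<longrightarrow> (\<exists>l. vsums E (\<lambda>n. s (\<sigma> n)) l))"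


subsection \<open>Linear and bilinear forms\<close>

definition linear_form ::
  "('k::{real_normed_field, euclidean_space}, 'v) nspace \<Rightarrow> ('v \<Rightarrow> 'k) \<Rightarrow> bool" where
  "linear_form E f \<longleftrightarrow>
     (\<forall>x\<in>carrier E. \<forall>y\<in>carrier E. f (vadd E x y) = f x + f y) \<and>
     (\<forall>c. \<forall>x\<in>carrier E. f (vscale E c x) = c * f x)"

definition bilinear_form ::
  "('k::{real_normed_field, euclidean_space}, 'v) nspace \<Rightarrow> ('k, 'w) nspace \<Rightarrow>
   ('v \<Rightarrow> 'w \<Rightarrow> 'k) \<Rightarrow> bool" where
  "bilinear_form E F \<beta> \<longleftrightarrow>
     (\<forall>x\<in>carrier E. linear_form F (\<beta> x)) \<and>
     (\<forall>y\<in>carrier F. linear_form E (\<lambda>x. \<beta> x y))"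

text \<open>Functionals are only relevant on the carrier; their values elsewhere are arbitrary.\<close>

definition dual ::
  "('k::{real_normed_field, euclidean_space}, 'v) nspace \<Rightarrow> ('v \<Rightarrow> 'k) set" where
  "dual E = {f. linear_form E f \<and> (\<exists>C. \<forall>x\<in>carrier E. norm (f x) \<le> C * vnorm E x)}"

definition dual_norm ::
  "('k::{real_normed_field, euclidean_space}, 'v) nspace \<Rightarrow> ('v \<Rightarrow> 'k) \<Rightarrow> real" where
  "dual_norm E f = (SUP x\<in>{x \<in> carrier E. vnorm E x \<le> 1}. norm (f x))"


subsection \<open>Schauder frames\<close>

definition schauder_frame ::
  "('k::{real_normed_field, euclidean_space}, 'v) nspace \<Rightarrow> (nat \<Rightarrow> 'v) \<Rightarrow> (nat \<Rightarrow> 'v \<Rightarrow> 'k) \<Rightarrow> bool" where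
  "schauder_frame E a b \<longleftrightarrow>
     (\<forall>n. a n \<in> carrier E \<and> b n \<in> dual E) \<and>
     (\<forall>x\<in>carrier E. vsums E (\<lambda>n. vscale E (b n x) (a n)) x)"

definition unconditional_schauder_frame ::
  "('k::{real_normed_field, euclidean_space}, 'v) nspace \<Rightarrow> (nat \<Rightarrow> 'v) \<Rightarrow> (nat \<Rightarrow> 'v \<Rightarrow> 'k) \<Rightarrow> bool" where
  "unconditional_schauder_frame E a b \<longleftrightarrow>
     schauder_frame E a b \<and>
     (\<forall>x\<in>carrier E. uncond_summable E (\<lambda>n. vscale E (b n x) (a n)))"

definition besselian_schauder_frame ::
  "('k::{real_normed_field, euclidean_space}, 'v) nspace \<Rightarrow> (nat \<Rightarrow> 'v) \<Rightarrow> (nat \<Rightarrow> 'v \<Rightarrow> 'k) \<Rightarrow> bool" where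
  "besselian_schauder_frame E a b \<longleftrightarrow>
     schauder_frame E a b \<and>
     (\<exists>B>0. \<forall>x\<in>carrier E. \<forall>y\<in>dual E.
        summable (\<lambda>n. norm (b n x) * norm (y (a n))) \<and>
        (\<Sum>n. norm (b n x) * norm (y (a n))) \<le> B * vnorm E x * dual_norm E y)"


subsection \<open>Algebraic tensor product\<close>

text \<open>
  A list \<open>[(x\<^sub>1, y\<^sub>1), \<dots>, (x\<^sub>n, y\<^sub>n)]\<close> represents \<open>x\<^sub>1 \<otimes> y\<^sub>1 + \<dots> + x\<^sub>n \<otimes> y\<^sub>n\<close>. As usual, the algebraic tensor
  product is realised inside the linear functionals on the space of all (not necessarily bounded)
  bilinear forms, \<open>x \<otimes> y\<close> being the evaluation \<open>\<beta> \<mapsto> \<beta> x y\<close>; thus two lists represent the same tensor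
  iff no bilinear form separates them. The value 0 at other arguments \<open>\<beta>\<close> makes this equality of
  HOL functions.
\<close>

definition tensor ::
  "('k::{real_normed_field, euclidean_space}, 'v) nspace \<Rightarrow> ('k, 'w) nspace \<Rightarrow>
   ('v \<times> 'w) list \<Rightarrow> ('v \<Rightarrow> 'w \<Rightarrow> 'k) \<Rightarrow> 'k" where
  "tensor E F xs = (\<lambda>\<beta>. if bilinear_form E F \<beta> then \<Sum>(x, y)\<leftarrow>xs. \<beta> x y else 0)"

definition tensor_space ::
  "('k::{real_normed_field, euclidean_space}, 'v) nspace \<Rightarrow> ('k, 'w) nspace \<Rightarrow>
   ((('v \<Rightarrow> 'w \<Rightarrow> 'k) \<Rightarrow> 'k) \<Rightarrow> real) \<Rightarrow> ('k, ('v \<Rightarrow> 'w \<Rightarrow> 'k) \<Rightarrow> 'k) nspace" where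
  "tensor_space E F N =
     \<lparr> carrier = {tensor E F xs |xs. set xs \<subseteq> carrier E \<times> carrier F},
       vzero = (\<lambda>\<beta>. 0),
       vadd = (\<lambda>u v \<beta>. u \<beta> + v \<beta>),
       vscale = (\<lambda>c u \<beta>. c * u \<beta>),
       vnorm = N \<rparr>"

definition proj_norm ::
  "('k::{real_normed_field, euclidean_space}, 'v) nspace \<Rightarrow> ('k, 'w) nspace \<Rightarrow>
   (('v \<Rightarrow> 'w \<Rightarrow> 'k) \<Rightarrow> 'k) \<Rightarrow> real" where
  "proj_norm E F u =
     Inf {\<Sum>(x, y)\<leftarrow>xs. vnorm E x * vnorm F y |xs.
            set xs \<subseteq> carrier E \<times> carrier F \<and> u = tensor E F xs}"

text \<open>
  For \<open>u\<close> represented by \<open>[(x\<^sub>1, y\<^sub>1), \<dots>, (x\<^sub>n, y\<^sub>n)]\<close>, the value of \<open>u\<close> at the bilinear form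
  \<open>\<lambda>x y. f x * g y\<close> is \<open>f x\<^sub>1 * g y\<^sub>1 + \<dots> + f x\<^sub>n * g y\<^sub>n\<close>.
\<close>

definition inj_norm ::
  "('k::{real_normed_field, euclidean_space}, 'v) nspace \<Rightarrow> ('k, 'w) nspace \<Rightarrow>
   (('v \<Rightarrow> 'w \<Rightarrow> 'k) \<Rightarrow> 'k) \<Rightarrow> real" where
  "inj_norm E F u =
     (SUP (f, g)\<in>{f \<in> dual E. dual_norm E f \<le> 1} \<times> {g \<in> dual F. dual_norm F g \<le> 1}.
        norm (u (\<lambda>x y. f x * g y)))"


subsection \<open>Completion\<close>

definition cauchy_seqs ::
  "('k::{real_normed_field, euclidean_space}, 'v) nspace \<Rightarrow> (nat \<Rightarrow> 'v) set" where
  "cauchy_seqs E = {s. (\<forall>n. s n \<in> carrier E) \<and>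
     (\<forall>e>0. \<exists>M. \<forall>m\<ge>M. \<forall>n\<ge>M. vnorm E (vdiff E (s m) (s n)) < e)}"

definition cauchy_rel ::
  "('k::{real_normed_field, euclidean_space}, 'v) nspace \<Rightarrow> ((nat \<Rightarrow> 'v) \<times> (nat \<Rightarrow> 'v)) set" where
  "cauchy_rel E = {(s, t). s \<in> cauchy_seqs E \<and> t \<in> cauchy_seqs E \<and>
     (\<lambda>n. vnorm E (vdiff E (s n) (t n))) \<longlonglongrightarrow> 0}"

definition completion ::
  "('k::{real_normed_field, euclidean_space}, 'v) nspace \<Rightarrow> ('k, (nat \<Rightarrow> 'v) set) nspace" where
  "completion E =
     \<lparr> carrier = cauchy_seqs E // cauchy_rel E,
       vzero = cauchy_rel E `` {\<lambda>n. vzero E},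
       vadd = (\<lambda>S T. \<Union>s\<in>S. \<Union>t\<in>T. cauchy_rel E `` {\<lambda>n. vadd E (s n) (t n)}),
       vscale = (\<lambda>c S. \<Union>s\<in>S. cauchy_rel E `` {\<lambda>n. vscale E c (s n)}),
       vnorm = (\<lambda>S. the_elem ((\<lambda>s. lim (\<lambda>n. vnorm E (s n))) ` S)) \<rparr>"

definition proj_tensor (infixr \<open>\<otimes>\<^sub>\<pi>\<close> 70) where
  "E \<otimes>\<^sub>\<pi> F = completion (tensor_space E F (proj_norm E F))"

definition inj_tensor (infixr \<open>\<otimes>\<^sub>\<epsilon>\<close> 70) where
  "E \<otimes>\<^sub>\<epsilon> F = completion (tensor_space E F (inj_norm E F))"


subsection \<open>The spaces \<open>\<ell>\<^sub>p\<close>\<close>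

definition lp :: "real \<Rightarrow> ('k::{real_normed_field, euclidean_space}, nat \<Rightarrow> 'k) nspace" where
  "lp p =
     \<lparr> carrier = {x. summable (\<lambda>n. norm (x n) powr p)},
       vzero = (\<lambda>n. 0),
       vadd = (\<lambda>x y n. x n + y n),
       vscale = (\<lambda>c x n. c * x n),
       vnorm = (\<lambda>x. (\<Sum>n. norm (x n) powr p) powr (1 / p)) \<rparr>"

definition conj_exp :: "real \<Rightarrow> real" where
  "conj_exp r = r / (r - 1)"

end

theory Submission
  imports Defs "HOL-Library.Function_Algebras"
begin

text \<open>
  Let \<open>e\<^sub>i \<otimes> e\<^sub>j\<close> be the tensors of unit vectors. For fixed \<open>i\<close> they are weakly null in \<open>j\<close>, and conversely.
  A gliding hump therefore yields subsequences such that the part of \<open>x = \<Sum> c\<^sub>k\<^sub>l e\<^bsub>I k\<^esub> \<otimes> e\<^bsub>J l\<^esub>\<close> with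
  \<open>k \<le> l\<close> is, up to a small error, the sum of the frame expansion of \<open>x\<close> over a finite set of frame indices.
  If the frame is Besselian, or unconditional (by uniform boundedness), such partial sums are
  bounded by a multiple of the norm of \<open>x\<close>, so the triangular truncations would be uniformly bounded.

  The truncation is unbounded because of the antisymmetric \<open>2\<^sup>n \<times> 2\<^sup>n\<close> matrix defined by
  \<open>A\<^bsub>n+1\<^esub> = [[A\<^sub>n, 2\<^bsup>-n\<^esup>E], [-2\<^bsup>-n\<^esup>E, A\<^sub>n]]\<close> with \<open>E\<close> the all-ones matrix. The entries of its upper triangle
  add up to \<open>n 2\<^sup>n / 2\<close>, but as a bilinear form on vectors of entries at most 1 it is \<open>o(n 2\<^sup>n)\<close>: one step of
  the recursion is controlled by the differences between the means over the two halves, and the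
  squares of these differences add up to at most the variance. Since \<open>1/p + 1/q\<^sup>* < 1\<close>, the same holds
  for vectors normalised in \<open>\<ell>\<^sub>p\<close> and \<open>\<ell>\<^bsub>q*\<^esub>\<close>. In the injective case this matrix is the tensor and is
  paired with the all-ones form, in the projective case the roles are exchanged.
\<close>


subsection \<open>A matrix with large triangular truncation\<close>

text \<open>The matrix is a dyadic model of the Hilbert matrix 1/(l - k): off the diagonal its entry
  is, up to sign, 2^(-m), where m is the highest binary digit in which k and l differ. Truncation
  keeps exactly the nonnegative entries, so it destroys a cancellation and gains a factor of order
  n, the logarithm of the size. Triangles appear because the unit tensors are null in i and in j
  separately but not jointly: rows and columns have to be chosen alternately, and the frame indices
  that carry a tensor then record whether its row or its column came later. Two circumstances shape
  the quantifiers. The test form is built from the chosen rows and columns, so these are chosen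
  without knowing it: all estimates are uniform over the forms of norm at most D, with D and the
  size 2^n fixed beforehand. And the functionals of a frame need not be biorthogonal to its vectors,
  so sums over sets of frame indices are no projections; only their norm bound is used.\<close>

primrec tri :: "nat \<Rightarrow> nat \<Rightarrow> nat \<Rightarrow> real" where
  "tri 0 k l = 0"
| "tri (Suc n) k l =
     (if k < 2 ^ n then if l < 2 ^ n then tri n k l else 1 / 2 ^ n
      else if l < 2 ^ n then - (1 / 2 ^ n) else tri n (k - 2 ^ n) (l - 2 ^ n))"

definition tri_form ::
  "nat \<Rightarrow> (nat \<Rightarrow> 'k::real_normed_field) \<Rightarrow> (nat \<Rightarrow> 'k) \<Rightarrow> 'k" where
  "tri_form n x y = (\<Sum>k<2^n. \<Sum>l<2^n. of_real (tri n k l) * (x k * y l))"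

lemma sum_lessThan_add:
  fixes f :: "nat \<Rightarrow> 'a::comm_monoid_add"
  shows "(\<Sum>k<m + n. f k) = (\<Sum>k<m. f k) + (\<Sum>k<n. f (m + k))"
  by (induction n) (simp_all add: add.assoc)

lemma sum_lessThan_double:
  fixes f :: "nat \<Rightarrow> 'a::comm_monoid_add"
  shows "(\<Sum>k<2 ^ Suc n. f k) = (\<Sum>k<2^n. f k) + (\<Sum>k<2^n. f (2^n + k))"
  using sum_lessThan_add[of f "2^n" "2^n"] by (simp add: mult_2)

text \<open>The off-diagonal blocks are constant, so x and y enter the cross term only through their
  half sums; antisymmetry makes it a two-by-two determinant of these sums.\<close>

lemma tri_form_Suc:
  "tri_form (Suc n) x y = tri_form n x y + tri_form n (\<lambda>k. x (2^n + k)) (\<lambda>k. y (2^n + k)) +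
     of_real (1 / 2^n) * ((\<Sum>k<2^n. x k) * (\<Sum>l<2^n. y (2^n + l)) -
                          (\<Sum>k<2^n. x (2^n + k)) * (\<Sum>l<2^n. y l))"
proof -
  have "tri_form (Suc n) x y =
      (\<Sum>k<2^n. (\<Sum>l<2^n. of_real (tri n k l) * (x k * y l)) +
               (\<Sum>l<2^n. of_real (1 / 2^n) * (x k * y (2^n + l)))) +
      (\<Sum>k<2^n. (\<Sum>l<2^n. of_real (- (1 / 2^n)) * (x (2^n + k) * y l)) +
               (\<Sum>l<2^n. of_real (tri n k l) * (x (2^n + k) * y (2^n + l))))"
    unfolding tri_form_def sum_lessThan_double
    by (intro arg_cong2[where f = "(+)"] sum.cong refl) simp_all
  also have "\<dots> = tri_form n x y + tri_form n (\<lambda>k. x (2^n + k)) (\<lambda>k. y (2^n + k)) +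
      ((\<Sum>k<2^n. \<Sum>l<2^n. of_real (1 / 2^n) * (x k * y (2^n + l))) +
       (\<Sum>k<2^n. \<Sum>l<2^n. of_real (- (1 / 2^n)) * (x (2^n + k) * y l)))"
    by (simp add: tri_form_def sum.distrib)
  also have "(\<Sum>k<2^n. \<Sum>l<2^n. of_real (1 / 2^n) * (x k * y (2^n + l))) =
      of_real (1 / 2^n) * ((\<Sum>k<2^n. x k) * (\<Sum>l<2^n. y (2^n + l)))"
    unfolding sum_product by (simp only: sum_distrib_left)
  also have "(\<Sum>k<2^n. \<Sum>l<2^n. of_real (- (1 / 2^n)) * (x (2^n + k) * y l)) =
      of_real (- (1 / 2^n)) * ((\<Sum>k<2^n. x (2^n + k)) * (\<Sum>l<2^n. y l))"
    unfolding sum_product by (simp only: sum_distrib_left)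
  finally show ?thesis
    by (simp add: algebra_simps)
qed

section \<open>Mean-square cancellation in the dyadic form\<close>

definition variation :: "nat \<Rightarrow> (nat \<Rightarrow> 'k::real_inner) \<Rightarrow> real" where
  "variation n x = (\<Sum>k<2^n. (norm (x k))\<^sup>2) - (norm (\<Sum>k<2^n. x k))\<^sup>2 / 2^n"

text \<open>\<open>variation\<close> is 2^n times the variance, and its increment is the squared
  Haar coefficient of the coarsest scale. The parallelogram law for the two half sums gives the
  identity; iterated, it bounds the sum of all these squares, which is what pays for the cross terms
  of \<open>tri_form\<close>.\<close>

lemma variation_Suc:
  "variation (Suc n) x = variation n x + variation n (\<lambda>k. x (2^n + k)) +
     (norm ((\<Sum>k<2^n. x k) - (\<Sum>k<2^n. x (2^n + k))))\<^sup>2 / 2 ^ Suc n"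
proof -
  define s t where "s = (\<Sum>k<2^n. x k)" and "t = (\<Sum>k<2^n. x (2^n + k))"
  have "(norm (s - t))\<^sup>2 + (norm (s + t))\<^sup>2 = 2 * ((norm s)\<^sup>2 + (norm t)\<^sup>2)"
    by (simp add: power2_norm_eq_inner inner_diff inner_add inner_commute)
  then have "(norm (s + t))\<^sup>2 = 2 * (norm s)\<^sup>2 + 2 * (norm t)\<^sup>2 - (norm (s - t))\<^sup>2"
    by simp
  then have "(norm (s + t))\<^sup>2 / 2 ^ Suc n =
      (norm s)\<^sup>2 / 2^n + (norm t)\<^sup>2 / 2^n - (norm (s - t))\<^sup>2 / 2 ^ Suc n"
    by (simp only: diff_divide_distrib add_divide_distrib) simp
  then show ?thesis
    by (simp add: variation_def sum_lessThan_double s_def t_def del: power_Suc)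
qed

lemma variation_le:
  assumes "\<And>k. k < 2^n \<Longrightarrow> norm (x k) \<le> 1"
  shows "variation n x \<le> 2^n"
proof -
  have "(\<Sum>k<2^n. (norm (x k))\<^sup>2) \<le> (\<Sum>k<(2::nat)^n. 1)"
    by (intro sum_mono) (use assms in \<open>auto simp: power_le_one\<close>)
  then show ?thesis
    by (simp add: variation_def) (smt (verit) divide_nonneg_nonneg zero_le_power2 zero_le_power)
qed

text \<open>Arithmetic-geometric mean inequality. For m = 2^n the quadratic term is the increment in
  \<open>variation_Suc\<close> divided by 2 * t, so the variation absorbs it; the linear term is the
  price of one level.\<close>

lemma le_scaled_square:
  fixes d t m :: real
  assumes "t > 0" "m > 0"
  shows "d \<le> t * m + d\<^sup>2 / (2 * t * (2 * m))"
proof -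
  have "t * m + d\<^sup>2 / (2 * t * (2 * m)) - d = (2 * t * m - d)\<^sup>2 / (2 * t * (2 * m))"
    using assms by (simp add: field_simps power2_eq_square)
  moreover have "\<dots> \<ge> 0"
    using assms by simp
  ultimately show ?thesis by linarith
qed

lemma norm_half_sum_le:
  fixes x :: "nat \<Rightarrow> 'k::real_normed_vector"
  assumes "\<And>k. k < 2^n \<Longrightarrow> norm (x k) \<le> 1"
  shows "norm (\<Sum>k<2^n. x k) \<le> 2^n"
  using sum_norm_le[of "{..<2^n}" x "\<lambda>_. 1"] assms by simp

text \<open>The variations act as a potential. The bounds of the two halves and two linear terms t *
  2^n add up to (n + 1) * t * 2^(n + 1), while the quadratic terms turn the variations of the halves
  into those of the whole.\<close>

lemma norm_tri_form_le_variation: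
  fixes x y :: "nat \<Rightarrow> 'k::{real_normed_field, euclidean_space}"
  assumes "t > 0" "\<And>k. k < 2^n \<Longrightarrow> norm (x k) \<le> 1" "\<And>k. k < 2^n \<Longrightarrow> norm (y k) \<le> 1"
  shows "norm (tri_form n x y) \<le> real n * t * 2^n + (variation n x + variation n y) / (2 * t)"
  using assms(2,3)
proof (induction n arbitrary: x y)
  case 0
  then show ?case by (simp add: tri_form_def variation_def)
next
  case (Suc n)
  define x' y' where "x' = (\<lambda>k. x (2^n + k))" and "y' = (\<lambda>k. y (2^n + k))"
  define a a' b b' where "a = (\<Sum>k<2^n. x k)" and "a' = (\<Sum>k<2^n. x' k)"
    and "b = (\<Sum>k<2^n. y k)" and "b' = (\<Sum>k<2^n. y' k)"
  have bx: "norm (x k) \<le> 1" "norm (x' k) \<le> 1" "norm (y k) \<le> 1" "norm (y' k) \<le> 1"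
    if "k < 2^n" for k
    using that Suc.prems by (simp_all add: x'_def y'_def)
  have ab: "norm a \<le> 2^n" "norm a' \<le> 2^n" "norm b \<le> 2^n" "norm b' \<le> 2^n"
    unfolding a_def a'_def b_def b'_def by (intro norm_half_sum_le bx; assumption)+
  \<comment> \<open>The determinant vanishes when both vectors have equal half sums. This form makes
    it linear in the differences a - a' and b - b', with factors bounded by 2 * 2^n.\<close>
  have "2 * (a * b' - a' * b) = (a - a') * (b + b') - (a + a') * (b - b')"
    by (simp add: algebra_simps)
  then have "norm (2 * (a * b' - a' * b)) \<le> norm (a - a') * norm (b + b') + norm (a + a') * norm (b - b')"
    by (metis norm_triangle_ineq4 norm_mult)
  also have "\<dots> \<le> norm (a - a') * (2 * 2^n) + (2 * 2^n) * norm (b - b')"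
    using ab norm_triangle_ineq[of a a'] norm_triangle_ineq[of b b']
    by (intro add_mono mult_left_mono mult_right_mono) auto
  finally have "norm (of_real (1 / 2^n) * (a * b' - a' * b)) \<le> norm (a - a') + norm (b - b')"
    unfolding norm_mult by (simp add: norm_divide norm_power field_simps)
  also have "\<dots> \<le> (t * 2^n + (norm (a - a'))\<^sup>2 / (2 * t * (2 * 2^n))) +
      (t * 2^n + (norm (b - b'))\<^sup>2 / (2 * t * (2 * 2^n)))"
    using assms(1) by (intro add_mono le_scaled_square) auto
  finally have cross: "norm (of_real (1 / 2^n) * (a * b' - a' * b)) \<le>
      (t * 2^n + (norm (a - a'))\<^sup>2 / (2 * t * (2 * 2^n))) +
      (t * 2^n + (norm (b - b'))\<^sup>2 / (2 * t * (2 * 2^n)))" .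
  have vx: "variation (Suc n) x = variation n x + variation n x' + (norm (a - a'))\<^sup>2 / (2 * 2^n)"
    by (simp add: variation_Suc a_def a'_def x'_def)
  have vy: "variation (Suc n) y = variation n y + variation n y' + (norm (b - b'))\<^sup>2 / (2 * 2^n)"
    by (simp add: variation_Suc b_def b'_def y'_def)
  have "norm (tri_form (Suc n) x y) \<le> norm (tri_form n x y) + norm (tri_form n x' y') +
      norm (of_real (1 / 2^n) * (a * b' - a' * b))"
    unfolding tri_form_Suc a_def a'_def b_def b'_def x'_def y'_def
    by (rule order_trans[OF norm_triangle_ineq add_mono[OF norm_triangle_ineq order_refl]])
  also have "\<dots> \<le> (real n * t * 2^n + (variation n x + variation n y) / (2 * t)) +
      (real n * t * 2^n + (variation n x' + variation n y') / (2 * t)) +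
      ((t * 2^n + (norm (a - a'))\<^sup>2 / (2 * t * (2 * 2^n))) +
      (t * 2^n + (norm (b - b'))\<^sup>2 / (2 * t * (2 * 2^n))))"
    by (intro add_mono Suc.IH bx cross)
  also have "\<dots> = real (Suc n) * t * 2 ^ Suc n + (variation (Suc n) x + variation (Suc n) y) / (2 * t)"
    using assms(1) unfolding vx vy by (simp add: field_simps)
  finally show ?case .
qed

text \<open>A small fixed t makes this a small multiple of n * 2^n once n is large, whereas the
  upper triangle alone sums to n * 2^n / 2. With t = 1 / sqrt n the bound would even be 2 * sqrt n *
  2^n.\<close>

lemma norm_tri_form_le:
  fixes x y :: "nat \<Rightarrow> 'k::{real_normed_field, euclidean_space}"
  assumes "t > 0" "\<And>k. k < 2^n \<Longrightarrow> norm (x k) \<le> 1" "\<And>k. k < 2^n \<Longrightarrow> norm (y k) \<le> 1"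
  shows "norm (tri_form n x y) \<le> 2^n * (real n * t + 1 / t)"
proof -
  have "variation n x \<le> 2^n" "variation n y \<le> 2^n"
    by (auto intro!: variation_le assms)
  then have "(variation n x + variation n y) / (2 * t) \<le> (2^n + 2^n) / (2 * t)"
    using assms(1) by (intro divide_right_mono) auto
  also have "\<dots> = 2^n * (1 / t)"
    by simp
  finally show ?thesis
    using norm_tri_form_le_variation[of t n x y] assms by (simp add: algebra_simps)
qed

section \<open>Absolute row and column sums, and the sum of the upper triangle\<close>

lemma tri_row_sum: "k < 2^n \<Longrightarrow> (\<Sum>l<2^n. \<bar>tri n k l\<bar>) = real n"
proof (induction n arbitrary: k)
  case (Suc n)
  show ?case
  proof (cases "k < 2^n")
    case True
    then show ?thesis
      using Suc.IH[of k] by (simp only: sum_lessThan_double) simp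
  next
    case False
    then show ?thesis
      using Suc.IH[of "k - 2^n"] Suc.prems by (simp only: sum_lessThan_double) simp
  qed
qed simp

lemma tri_antisym: "tri n k l = - tri n l k"
proof (induction n arbitrary: k l)
  case (Suc n)
  show ?case
    using Suc.IH[of k l] Suc.IH[of "k - 2^n" "l - 2^n"] by simp
qed simp

lemma abs_tri_commute: "\<bar>tri n k l\<bar> = \<bar>tri n l k\<bar>"
  using tri_antisym[of n k l] by simp

lemma tri_column_sum: "l < 2^n \<Longrightarrow> (\<Sum>k<2^n. \<bar>tri n k l\<bar>) = real n"
  using tri_row_sum[of l n] by (simp add: abs_tri_commute[of n _ l])

text \<open>All entries above the diagonal are positive, so nothing cancels: each level contributes
  a block of 2^n by 2^n entries 1 / 2^n.\<close>

lemma tri_upper_sum: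
  "(\<Sum>k<2^n. \<Sum>l<2^n. if k \<le> l then tri n k l else 0) = real n * 2^n / 2"
proof (induction n)
  case (Suc n)
  define U where "U = (\<Sum>k<2^n. \<Sum>l<2^n. if k \<le> l then tri n k l else 0)"
  have "(\<Sum>k<2 ^ Suc n. \<Sum>l<2 ^ Suc n. if k \<le> l then tri (Suc n) k l else 0) =
      (\<Sum>k<2^n. (\<Sum>l<2^n. if k \<le> l then tri n k l else 0) + (\<Sum>l<(2::nat)^n. 1 / 2^n)) +
      (\<Sum>k<2^n. (\<Sum>l<(2::nat)^n. 0) + (\<Sum>l<2^n. if k \<le> l then tri n k l else 0))"
    unfolding sum_lessThan_double
    by (intro arg_cong2[where f = "(+)"] sum.cong refl) auto
  also have "\<dots> = U + 2^n + U"
    by (simp add: sum.distrib U_def)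
  finally show ?case
    using Suc by (simp add: U_def algebra_simps)
qed simp

text \<open>With m the larger of a^p and b^r, the product is at most m^(1/p + 1/r) = m^(1 -
  \<sigma>), that is, m times a factor that tends to 0 as m grows. Beyond \<open>R\<close> this
  factor is at most \<epsilon>, and \<Lambda> translates the size \<open>R\<close> of m back to a
  and b.\<close>

lemma mult_le_of_large:
  fixes p r :: real
  assumes "p > 0" "r > 0" "1 / p + 1 / r < 1" "\<epsilon> > 0"
  obtains \<Lambda> where "\<Lambda> \<ge> 1"
    "\<And>a b. a \<ge> 0 \<Longrightarrow> b \<ge> 0 \<Longrightarrow> a > \<Lambda> \<or> b > \<Lambda> \<Longrightarrow> a * b \<le> \<epsilon> * (a powr p + b powr r)"
proof -
  define \<sigma> where "\<sigma> = 1 - (1 / p + 1 / r)"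
  have \<sigma>: "\<sigma> > 0" using assms by (simp add: \<sigma>_def)
  define R where "R = max 1 ((1 / \<epsilon>) powr (1 / \<sigma>))"
  have R: "R \<ge> 1" "R powr \<sigma> \<ge> 1 / \<epsilon>"
  proof -
    show "R \<ge> 1" by (simp add: R_def)
    have "((1 / \<epsilon>) powr (1 / \<sigma>)) powr \<sigma> = 1 / \<epsilon>"
      using assms \<sigma> by (simp add: powr_powr)
    then show "R powr \<sigma> \<ge> 1 / \<epsilon>"
      using powr_mono2[of \<sigma> "(1 / \<epsilon>) powr (1 / \<sigma>)" R] \<sigma> by (simp add: R_def)
  qed
  define \<Lambda> where "\<Lambda> = max (R powr (1 / p)) (R powr (1 / r))"
  show thesis
  proof
    show "\<Lambda> \<ge> 1"
      using R assms by (auto simp: \<Lambda>_def le_max_iff_disj ge_one_powr_ge_zero)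
    fix a b :: real
    assume ab: "a \<ge> 0" "b \<ge> 0" "a > \<Lambda> \<or> b > \<Lambda>"
    define m where "m = max (a powr p) (b powr r)"
    have "R \<le> m"
      using ab(3)
    proof
      assume "a > \<Lambda>"
      then have "a \<ge> R powr (1 / p)" by (simp add: \<Lambda>_def)
      then have "a powr p \<ge> (R powr (1 / p)) powr p"
        using assms by (intro powr_mono2) auto
      then show ?thesis using R assms by (simp add: powr_powr m_def)
    next
      assume "b > \<Lambda>"
      then have "b \<ge> R powr (1 / r)" by (simp add: \<Lambda>_def)
      then have "b powr r \<ge> (R powr (1 / r)) powr r"
        using assms by (intro powr_mono2) auto
      then show ?thesis using R assms by (simp add: powr_powr m_def)
    qed
    then have m: "m \<ge> R" "m > 0" using R by auto
    have "a = (a powr p) powr (1 / p)" "b = (b powr r) powr (1 / r)"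
      using ab assms by (auto simp: powr_powr)
    moreover have "(a powr p) powr (1 / p) \<le> m powr (1 / p)" "(b powr r) powr (1 / r) \<le> m powr (1 / r)"
      using assms by (auto intro!: powr_mono2 simp: m_def)
    ultimately have "a * b \<le> m powr (1 / p) * m powr (1 / r)"
      using ab by (intro mult_mono) auto
    also have "\<dots> = m powr (1 - \<sigma>)"
      by (simp add: \<sigma>_def powr_add)
    also have "\<dots> = m / m powr \<sigma>"
      using m by (simp add: powr_diff)
    also have "\<dots> \<le> m * \<epsilon>"
    proof -
      have "1 / \<epsilon> \<le> m powr \<sigma>"
        using R m \<sigma> powr_mono2[of \<sigma> R m] by auto
      then have "1 \<le> \<epsilon> * m powr \<sigma>" using assms by (simp add: field_simps)
      then have "m * 1 \<le> m * (\<epsilon> * m powr \<sigma>)" using m by (intro mult_left_mono) auto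
      then show ?thesis using m by (simp add: field_simps)
    qed
    also have "\<dots> \<le> (a powr p + b powr r) * \<epsilon>"
      using assms by (intro mult_right_mono) (auto simp: m_def)
    finally show "a * b \<le> \<epsilon> * (a powr p + b powr r)"
      by (simp add: mult.commute)
  qed
qed

text \<open>A Schur test: a weight depending on k alone or on l alone meets the matrix only through
  its absolute row or column sums, which all equal n.\<close>

lemma tri_weighted_sum_le:
  assumes "\<And>k. u k \<ge> 0" "\<And>l. v l \<ge> (0::real)"
  shows "(\<Sum>k<2^n. \<Sum>l<2^n. \<bar>tri n k l\<bar> * (u k + v l)) = real n * ((\<Sum>k<2^n. u k) + (\<Sum>l<2^n. v l))"
proof -
  have "(\<Sum>k<2^n. \<Sum>l<2^n. \<bar>tri n k l\<bar> * (u k + v l)) =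
      (\<Sum>k<2^n. (\<Sum>l<2^n. \<bar>tri n k l\<bar>) * u k) + (\<Sum>k<2^n. \<Sum>l<2^n. \<bar>tri n k l\<bar> * v l)"
    by (simp add: distrib_left sum.distrib sum_distrib_right)
  also have "(\<Sum>k<2^n. (\<Sum>l<2^n. \<bar>tri n k l\<bar>) * u k) = real n * (\<Sum>k<2^n. u k)"
    by (simp add: tri_row_sum sum_distrib_left)
  also have "(\<Sum>k<2^n. \<Sum>l<2^n. \<bar>tri n k l\<bar> * v l) = (\<Sum>l<2^n. (\<Sum>k<2^n. \<bar>tri n k l\<bar>) * v l)"
    by (subst sum.swap) (simp add: sum_distrib_right)
  also have "\<dots> = real n * (\<Sum>l<2^n. v l)"
    by (simp add: tri_column_sum sum_distrib_left)
  finally show ?thesis by (simp add: distrib_left)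
qed

text \<open>
  Entries above the threshold \<open>\<Lambda>\<close> are handled by absolute values and contribute \<open>o(n 2\<^sup>n)\<close> because
  \<open>1/p + 1/r < 1\<close>; the bounded rest contributes \<open>o(n 2\<^sup>n)\<close> by the cancellation in \<^const>\<open>tri_form\<close>.
\<close>

lemma tri_form_small:
  fixes p r :: real
  assumes "p > 0" "r > 0" "1 / p + 1 / r < 1" "\<epsilon> > 0"
  obtains n where "n > 0"
    "\<And>x y :: nat \<Rightarrow> 'k::{real_normed_field, euclidean_space}.
       (\<Sum>k<2^n. norm (x k) powr p) \<le> 2^n \<Longrightarrow> (\<Sum>k<2^n. norm (y k) powr r) \<le> 2^n \<Longrightarrow>
       norm (tri_form n x y) \<le> \<epsilon> * real n * 2^n"
proof -
  obtain \<Lambda> where \<Lambda>: "\<Lambda> \<ge> 1"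
    "\<And>a b. a \<ge> 0 \<Longrightarrow> b \<ge> 0 \<Longrightarrow> a > \<Lambda> \<or> b > \<Lambda> \<Longrightarrow> a * b \<le> \<epsilon> / 4 * (a powr p + b powr r)"
    using mult_le_of_large[OF assms(1-3), of "\<epsilon> / 4"] assms(4) by auto
  \<comment> \<open>Undoing the normalisation of the cut vectors costs the square of \<Lambda>. With
    this t the part linear in n becomes \<epsilon>/4 * n, and n is then taken so large that the part
    with 1 / t is at most \<epsilon>/4 * n too.\<close>
  define t where "t = \<epsilon> / (4 * \<Lambda>\<^sup>2)"
  have t: "t > 0" using \<Lambda> assms by (simp add: t_def)
  obtain n where n: "real n > 4 * \<Lambda>\<^sup>2 / (\<epsilon> * t)"
    using reals_Archimedean2 by blast
  have "n > 0"
  proof (rule ccontr)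
    assume "\<not> n > 0"
    then have "4 * \<Lambda>\<^sup>2 / (\<epsilon> * t) < 0" using n by simp
    moreover have "4 * \<Lambda>\<^sup>2 / (\<epsilon> * t) \<ge> 0" using t assms by simp
    ultimately show False by simp
  qed
  have nt: "\<Lambda>\<^sup>2 * (real n * t + 1 / t) \<le> \<epsilon> / 2 * real n"
  proof -
    have "\<Lambda>\<^sup>2 / t \<le> \<epsilon> / 4 * real n"
      using n t assms by (simp add: field_simps)
    moreover have "\<Lambda>\<^sup>2 * (real n * t) = \<epsilon> / 4 * real n"
      using \<Lambda>(1) by (simp add: t_def)
    ultimately show ?thesis
      unfolding distrib_left times_divide_eq_right mult_1_right by linarith
  qed
  show thesis
  proof (rule that[OF \<open>n > 0\<close>])
    fix x y :: "nat \<Rightarrow> 'k"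
    assume sx: "(\<Sum>k<2^n. norm (x k) powr p) \<le> 2^n" and sy: "(\<Sum>k<2^n. norm (y k) powr r) \<le> 2^n"
    define cut where "cut = (\<lambda>(z :: nat \<Rightarrow> 'k) k. if norm (z k) \<le> \<Lambda> then z k /\<^sub>R \<Lambda> else 0)"
    have cut: "norm (cut z k) \<le> 1" for z k
      using \<Lambda>(1) by (auto simp: cut_def field_simps)
    have "norm (tri_form n (cut x) (cut y)) \<le> 2^n * (real n * t + 1 / t)"
      by (intro norm_tri_form_le t cut)
    then have "\<Lambda>\<^sup>2 * norm (tri_form n (cut x) (cut y)) \<le> \<Lambda>\<^sup>2 * (2^n * (real n * t + 1 / t))"
      by (intro mult_left_mono) auto
    also have "\<dots> = (\<Lambda>\<^sup>2 * (real n * t + 1 / t)) * 2^n" by simp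
    also have "\<dots> \<le> (\<epsilon> / 2 * real n) * 2^n"
      by (intro mult_right_mono nt) auto
    finally have small: "\<Lambda>\<^sup>2 * norm (tri_form n (cut x) (cut y)) \<le> \<epsilon> / 2 * real n * 2^n" .
    \<comment> \<open>Either both entries survive the cut and the difference is 0, or one of them
      exceeds \<Lambda>, its cut is 0, and the whole product is charged to the powers by the choice
      of \<Lambda>.\<close>
    have entry: "norm (x k * y l - of_real (\<Lambda>\<^sup>2) * (cut x k * cut y l))
        \<le> \<epsilon> / 4 * (norm (x k) powr p + norm (y l) powr r)" for k l
    proof (cases "norm (x k) > \<Lambda> \<or> norm (y l) > \<Lambda>")
      case True
      then have "cut x k = 0 \<or> cut y l = 0" by (auto simp: cut_def)
      then have "x k * y l - of_real (\<Lambda>\<^sup>2) * (cut x k * cut y l) = x k * y l" by fastforce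
      then show ?thesis
        using \<Lambda>(2)[OF norm_ge_zero norm_ge_zero True] by (metis norm_mult)
    next
      case False
      then have "x k = of_real \<Lambda> * cut x k" "y l = of_real \<Lambda> * cut y l"
        using \<Lambda>(1) by (auto simp: cut_def scaleR_conv_of_real field_simps)
      then have "x k * y l - of_real (\<Lambda>\<^sup>2) * (cut x k * cut y l) = 0"
        by (metis (no_types, lifting) mult.assoc mult.left_commute of_real_mult power2_eq_square right_minus_eq)
      then show ?thesis using assms by (simp only: norm_zero) simp
    qed
    have "of_real (\<Lambda>\<^sup>2) * tri_form n (cut x) (cut y) =
        (\<Sum>k<2^n. \<Sum>l<2^n. of_real (tri n k l) * (of_real (\<Lambda>\<^sup>2) * (cut x k * cut y l)))"
      unfolding tri_form_def sum_distrib_left by (intro sum.cong refl mult.left_commute)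
    then have "norm (tri_form n x y - of_real (\<Lambda>\<^sup>2) * tri_form n (cut x) (cut y)) =
        norm (\<Sum>k<2^n. \<Sum>l<2^n. of_real (tri n k l) * (x k * y l - of_real (\<Lambda>\<^sup>2) * (cut x k * cut y l)))"
      unfolding right_diff_distrib sum_subtractf by (simp only: tri_form_def)
    also have "\<dots> \<le> (\<Sum>k<2^n. \<Sum>l<2^n. \<bar>tri n k l\<bar> *
        (\<epsilon> / 4 * norm (x k) powr p + \<epsilon> / 4 * norm (y l) powr r))"
      unfolding distrib_left[symmetric]
      by (intro sum_norm_le) (simp only: norm_mult norm_of_real, intro mult_left_mono
          entry[unfolded norm_mult] abs_ge_zero)
    also have "\<dots> = real n * (\<epsilon> / 4 * (\<Sum>k<2^n. norm (x k) powr p) + \<epsilon> / 4 * (\<Sum>l<2^n. norm (y l) powr r))"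
      using assms by (subst tri_weighted_sum_le) (auto simp: sum_distrib_left)
    also have "\<dots> \<le> real n * (\<epsilon> / 4 * 2^n + \<epsilon> / 4 * 2^n)"
      using sx sy assms by (intro mult_left_mono add_mono) auto
    also have "\<dots> = \<epsilon> / 2 * real n * 2^n" by (simp add: field_simps)
    finally have diff: "norm (tri_form n x y - of_real (\<Lambda>\<^sup>2) * tri_form n (cut x) (cut y))
        \<le> \<epsilon> / 2 * real n * 2^n" .
    have main: "norm (of_real (\<Lambda>\<^sup>2) * tri_form n (cut x) (cut y)) \<le> \<epsilon> / 2 * real n * 2^n"
      using small unfolding norm_mult norm_of_real by (simp only: abs_power2)
    have "norm (tri_form n x y) \<le> \<epsilon> / 2 * real n * 2^n + \<epsilon> / 2 * real n * 2^n"
      by (rule order_trans[OF norm_triangle_sub add_mono[OF main diff]])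
    then show "norm (tri_form n x y) \<le> \<epsilon> * real n * 2^n"
      by simp
  qed
qed


subsection \<open>Gliding humps along a double sequence\<close>

text \<open>An initial segment of frame indices involves only finitely many null sequences
  \<open>\<beta> n\<close>, and \<open>A n\<close> bounds \<open>\<gamma> y n\<close> for all y at
  once. Hence j can be selected before y is known.\<close>

lemma finite_eventually_uniform:
  fixes \<beta> :: "nat \<Rightarrow> nat \<Rightarrow> 'k::real_normed_field" and \<gamma> :: "'y \<Rightarrow> nat \<Rightarrow> 'k"
  assumes "\<And>n. (\<lambda>j. \<beta> n j) \<longlonglongrightarrow> 0"
    and "\<forall>y\<in>F. \<forall>n. norm (\<gamma> y n) \<le> A n"
    and "\<eta> > 0"
  shows "eventually (\<lambda>j. \<forall>y\<in>F. \<forall>m\<le>M. norm (\<Sum>n<m. \<beta> n j * \<gamma> y n) \<le> \<eta>) sequentially"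
proof -
  have "(\<lambda>j. \<Sum>n<M. norm (\<beta> n j) * \<bar>A n\<bar>) \<longlonglongrightarrow> (\<Sum>n<M. norm (0 :: 'k) * \<bar>A n\<bar>)"
    by (intro tendsto_intros assms)
  then have "eventually (\<lambda>j. (\<Sum>n<M. norm (\<beta> n j) * \<bar>A n\<bar>) < \<eta>) sequentially"
    using \<open>\<eta> > 0\<close> by (intro order_tendstoD) auto
  then show ?thesis
  proof (rule eventually_mono, intro ballI allI impI)
    fix j y m
    assume j: "(\<Sum>n<M. norm (\<beta> n j) * \<bar>A n\<bar>) < \<eta>" and "y \<in> F" "m \<le> M"
    have "norm (\<Sum>n<m. \<beta> n j * \<gamma> y n) \<le> (\<Sum>n<m. norm (\<beta> n j) * \<bar>A n\<bar>)"
      using assms(2) \<open>y \<in> F\<close>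
      by (intro sum_norm_le) (auto simp: norm_mult intro!: mult_left_mono order_trans[OF _ abs_ge_self])
    also have "\<dots> \<le> (\<Sum>n<M. norm (\<beta> n j) * \<bar>A n\<bar>)"
      using \<open>m \<le> M\<close> by (intro sum_mono2) auto
    finally show "norm (\<Sum>n<m. \<beta> n j * \<gamma> y n) \<le> \<eta>" using j by simp
  qed
qed

lemma finite_uniform_threshold:
  fixes Q :: "nat \<Rightarrow> nat \<Rightarrow> bool"
  assumes "\<And>k. \<exists>M0. \<forall>M\<ge>M0. Q k M"
  obtains M where "M \<ge> B" "\<And>k m. k < (K::nat) \<Longrightarrow> m \<ge> M \<Longrightarrow> Q k m"
proof -
  obtain f where "\<And>k M. M \<ge> f k \<Longrightarrow> Q k M" using assms by metis
  moreover have "f k \<le> (\<Sum>k<K. f k)" if "k < K" for k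
    using that by (intro member_le_sum) auto
  ultimately show thesis
    by (intro that[of "B + (\<Sum>k<K. f k)"]) (simp, meson add_leD2 order_trans)
qed

text \<open>With \<open>\<beta> n i j\<close> the n-th coordinate of the (i, j) unit tensor and
  \<open>\<gamma> y n\<close> the value of y at the n-th frame vector, this is y at the m-th partial
  sum of the expansion of that tensor.\<close>

definition partial_pairing ::
  "(nat \<Rightarrow> nat \<Rightarrow> nat \<Rightarrow> 'k::real_normed_field) \<Rightarrow> ('y \<Rightarrow> nat \<Rightarrow> 'k) \<Rightarrow> nat \<Rightarrow> 'y \<Rightarrow> nat \<Rightarrow> nat \<Rightarrow> 'k" where
  "partial_pairing \<beta> \<gamma> m y i j = (\<Sum>n<m. \<beta> n i j * \<gamma> y n)"

text \<open>
  The tensor \<open>e\<^bsub>I k\<^esub> \<otimes> e\<^bsub>J l\<^esub>\<close> is essentially supported by the frame indices in \<open>[M k, N k)\<close> if \<open>l < k\<close>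
  and by those in \<open>[N l, M (l + 1))\<close> if \<open>k \<le> l\<close>.
\<close>

definition hump_blocks ::
  "'y set \<Rightarrow> (nat \<Rightarrow> 'y \<Rightarrow> nat \<Rightarrow> nat \<Rightarrow> 'k::real_normed_field) \<Rightarrow> ('y \<Rightarrow> nat \<Rightarrow> nat \<Rightarrow> 'k) \<Rightarrow> real \<Rightarrow> nat \<Rightarrow>
    (nat \<Rightarrow> nat) \<Rightarrow> (nat \<Rightarrow> nat) \<Rightarrow> (nat \<Rightarrow> nat) \<Rightarrow> (nat \<Rightarrow> nat) \<Rightarrow> bool" where
  "hump_blocks F P w \<eta> K I J M N \<longleftrightarrow>
    (\<forall>l<K. \<forall>k<l. I k < I l \<and> J k < J l) \<and>
    (\<forall>k<K. M k \<le> N k \<and> N k \<le> M (Suc k)) \<and>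
    (\<forall>k<K. \<forall>l<k. \<forall>y\<in>F. (\<forall>m\<le>M k. norm (P m y (I k) (J l)) \<le> \<eta>) \<and>
       (\<forall>m\<ge>N k. norm (P m y (I k) (J l) - w y (I k) (J l)) \<le> \<eta>)) \<and>
    (\<forall>l<K. \<forall>k\<le>l. \<forall>y\<in>F. (\<forall>m\<le>N l. norm (P m y (I k) (J l)) \<le> \<eta>) \<and>
       (\<forall>m\<ge>M (Suc l). norm (P m y (I k) (J l) - w y (I k) (J l)) \<le> \<eta>))"

text \<open>Each induction step adds a row and then a column. The row is negligible against the old
  columns up to \<open>M K\<close>, and \<open>N'\<close> waits until these expansions have
  converged; the column is negligible against all rows up to \<open>N'\<close>, and
  \<open>M'\<close> waits for it. Every choice uses a limit in one index with the other one fixed,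
  the only smallness available.\<close>

lemma gliding_hump_blocks:
  fixes \<beta> :: "nat \<Rightarrow> nat \<Rightarrow> nat \<Rightarrow> 'k::real_normed_field" and \<gamma> :: "'y \<Rightarrow> nat \<Rightarrow> 'k"
    and w :: "'y \<Rightarrow> nat \<Rightarrow> nat \<Rightarrow> 'k"
  defines "P \<equiv> partial_pairing \<beta> \<gamma>"
  assumes col: "\<And>n i. (\<lambda>j. \<beta> n i j) \<longlonglongrightarrow> 0" and row: "\<And>n j. (\<lambda>i. \<beta> n i j) \<longlonglongrightarrow> 0"
    and bound: "\<forall>y\<in>F. \<forall>n. norm (\<gamma> y n) \<le> A n"
    and conv: "\<forall>\<eta>>0. \<forall>i j. \<exists>M0. \<forall>M\<ge>M0. \<forall>y\<in>F. norm (P M y i j - w y i j) \<le> \<eta>"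
    and \<eta>: "\<eta> > 0"
  shows "\<exists>I J M N. hump_blocks F P w \<eta> K I J M N"
proof (induction K)
  case (Suc K)
  then obtain I J M N where "hump_blocks F P w \<eta> K I J M N"
    by blast
  note IH = this[unfolded hump_blocks_def, THEN conjunct1]
    this[unfolded hump_blocks_def, THEN conjunct2, THEN conjunct1]
    this[unfolded hump_blocks_def, THEN conjunct2, THEN conjunct2, THEN conjunct1]
    this[unfolded hump_blocks_def, THEN conjunct2, THEN conjunct2, THEN conjunct2]
  have "\<forall>l\<in>{..<K}. eventually (\<lambda>i. \<forall>y\<in>F. \<forall>m\<le>M K. norm (P m y i (J l)) \<le> \<eta>) sequentially"
    unfolding P_def partial_pairing_def by (intro ballI finite_eventually_uniform[OF row bound \<eta>])
  then have "eventually (\<lambda>i. (\<forall>k\<in>{..<K}. I k < i) \<and>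
      (\<forall>l\<in>{..<K}. \<forall>y\<in>F. \<forall>m\<le>M K. norm (P m y i (J l)) \<le> \<eta>)) sequentially"
    by (intro eventually_conj eventually_ball_finite[OF finite_lessThan]) (auto intro: eventually_gt_at_top)
  from eventually_happens'[OF sequentially_bot this]
  obtain i where i0: "(\<forall>k\<in>{..<K}. I k < i) \<and> (\<forall>l\<in>{..<K}. \<forall>y\<in>F. \<forall>m\<le>M K. norm (P m y i (J l)) \<le> \<eta>)"
    by (elim exE)
  have i: "I k < i" if "k < K" for k using i0 that by simp
  have i': "norm (P m y i (J l)) \<le> \<eta>" if "l < K" "y \<in> F" "m \<le> M K" for l y m using i0 that by simp
  obtain N' where N': "N' \<ge> M K"
    "\<And>l m. l < K \<Longrightarrow> m \<ge> N' \<Longrightarrow> \<forall>y\<in>F. norm (P m y i (J l) - w y i (J l)) \<le> \<eta>"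
    using finite_uniform_threshold[of "\<lambda>l m. \<forall>y\<in>F. norm (P m y i (J l) - w y i (J l)) \<le> \<eta>" "M K" K]
      conv \<eta> by blast
  define I' where "I' = I(K := i)"
  \<comment> \<open>The range includes the row just added, so the diagonal pair belongs to the
    blocks with k \<le> l.\<close>
  have "\<forall>k\<in>{..K}. eventually (\<lambda>j. \<forall>y\<in>F. \<forall>m\<le>N'. norm (P m y (I' k) j) \<le> \<eta>) sequentially"
    unfolding P_def partial_pairing_def by (intro ballI finite_eventually_uniform[OF col bound \<eta>])
  then have "eventually (\<lambda>j. (\<forall>k\<in>{..<K}. J k < j) \<and>
      (\<forall>k\<in>{..K}. \<forall>y\<in>F. \<forall>m\<le>N'. norm (P m y (I' k) j) \<le> \<eta>)) sequentially"
    by (intro eventually_conj eventually_ball_finite[OF finite_lessThan]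
        eventually_ball_finite[OF finite_atMost]) (auto intro: eventually_gt_at_top)
  from eventually_happens'[OF sequentially_bot this]
  obtain j where j0: "(\<forall>k\<in>{..<K}. J k < j) \<and> (\<forall>k\<in>{..K}. \<forall>y\<in>F. \<forall>m\<le>N'. norm (P m y (I' k) j) \<le> \<eta>)"
    by (elim exE)
  have j: "J k < j" if "k < K" for k using j0 that by simp
  have j': "norm (P m y (I' k) j) \<le> \<eta>" if "k \<le> K" "y \<in> F" "m \<le> N'" for k y m using j0 that by simp
  obtain M' where M': "M' \<ge> N'"
    "\<And>k m. k < Suc K \<Longrightarrow> m \<ge> M' \<Longrightarrow> \<forall>y\<in>F. norm (P m y (I' k) j - w y (I' k) j) \<le> \<eta>"
    using finite_uniform_threshold[of "\<lambda>k m. \<forall>y\<in>F. norm (P m y (I' k) j - w y (I' k) j) \<le> \<eta>" N' "Suc K"]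
      conv \<eta> by blast
  have "hump_blocks F P w \<eta> (Suc K) I' (J(K := j)) (M(Suc K := M')) (N(K := N'))"
    unfolding hump_blocks_def
  proof (intro conjI)
    show "\<forall>l<Suc K. \<forall>k<l. I' k < I' l \<and> (J(K := j)) k < (J(K := j)) l"
      using IH(1) i j by (auto simp: I'_def less_Suc_eq)
    show "\<forall>k<Suc K. (M(Suc K := M')) k \<le> (N(K := N')) k \<and> (N(K := N')) k \<le> (M(Suc K := M')) (Suc k)"
      using IH(2) N'(1) M'(1) by (auto simp: less_Suc_eq)
    show "\<forall>k<Suc K. \<forall>l<k. \<forall>y\<in>F.
       (\<forall>m\<le>(M(Suc K := M')) k. norm (P m y (I' k) ((J(K := j)) l)) \<le> \<eta>) \<and>
       (\<forall>m\<ge>(N(K := N')) k. norm (P m y (I' k) ((J(K := j)) l) - w y (I' k) ((J(K := j)) l)) \<le> \<eta>)"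
      using IH(3) i' N'(2) by (auto simp: less_Suc_eq I'_def)
    show "\<forall>l<Suc K. \<forall>k\<le>l. \<forall>y\<in>F.
       (\<forall>m\<le>(N(K := N')) l. norm (P m y (I' k) ((J(K := j)) l)) \<le> \<eta>) \<and>
       (\<forall>m\<ge>(M(Suc K := M')) (Suc l). norm (P m y (I' k) ((J(K := j)) l) - w y (I' k) ((J(K := j)) l)) \<le> \<eta>)"
    proof (intro allI impI)
      fix l k assume lk: "l < Suc K" "k \<le> l"
      show "\<forall>y\<in>F. (\<forall>m\<le>(N(K := N')) l. norm (P m y (I' k) ((J(K := j)) l)) \<le> \<eta>) \<and>
         (\<forall>m\<ge>(M(Suc K := M')) (Suc l). norm (P m y (I' k) ((J(K := j)) l) - w y (I' k) ((J(K := j)) l)) \<le> \<eta>)"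
      proof (cases "l = K")
        case True
        then show ?thesis using j'[of k] M'(2)[of k] lk by simp
      next
        case False
        then show ?thesis using IH(4) lk by (simp add: I'_def)
      qed
    qed
  qed
  then show ?case by blast
qed (simp add: hump_blocks_def)

lemma interval_chain_mono:
  assumes "\<And>k. k < K \<Longrightarrow> M k \<le> N k \<and> N k \<le> (M (Suc k) :: nat)"
  shows "a \<le> b \<Longrightarrow> b \<le> K \<Longrightarrow> M a \<le> M b"
proof (induction rule: dec_induct)
  case (step b)
  then show ?case using assms[of b] by auto
qed simp

text \<open>\<open>S\<close> collects the blocks [N s, M (s + 1)) that follow the choice of a
  column. The sum over such a block is a difference of two partial pairings: up to a small error it
  is the full value w when k \<le> l and s = l, and otherwise 0, as both ends lie on the same side
  of the indices that carry the tensor.\<close>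

lemma triangle_selection:
  fixes \<beta> :: "nat \<Rightarrow> nat \<Rightarrow> nat \<Rightarrow> 'k::real_normed_field" and \<gamma> :: "'y \<Rightarrow> nat \<Rightarrow> 'k"
    and w :: "'y \<Rightarrow> nat \<Rightarrow> nat \<Rightarrow> 'k" and c :: "nat \<Rightarrow> nat \<Rightarrow> 'k"
  assumes col: "\<And>n i. (\<lambda>j. \<beta> n i j) \<longlonglongrightarrow> 0" and row: "\<And>n j. (\<lambda>i. \<beta> n i j) \<longlonglongrightarrow> 0"
    and bound: "\<forall>y\<in>F. \<forall>n. norm (\<gamma> y n) \<le> A n"
    and conv: "\<forall>\<eta>>0. \<forall>i j. \<exists>M0. \<forall>M\<ge>M0. \<forall>y\<in>F. norm ((\<Sum>n<M. \<beta> n i j * \<gamma> y n) - w y i j) \<le> \<eta>"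
    and "\<eta> > 0"
  obtains I J S where "inj_on I {..<K}" "inj_on J {..<K}" "finite S"
    "\<forall>y\<in>F. norm ((\<Sum>n\<in>S. (\<Sum>k<K. \<Sum>l<K. c k l * \<beta> n (I k) (J l)) * \<gamma> y n) -
        (\<Sum>k<K. \<Sum>l<K. if k \<le> l then c k l * w y (I k) (J l) else 0)) \<le> \<eta>"
proof -
  define C where "C = (\<Sum>k<K. \<Sum>l<K. norm (c k l))"
  \<comment> \<open>An error 2 * \<delta> arises for every block and every pair (k, l), weighted by
    norm (c k l), so the total is 2 * \<delta> * K * C; the added 1 keeps the divisor of \<delta>
    positive.\<close>
  define E where "E = real K * C + 1"
  define \<delta> where "\<delta> = \<eta> / (2 * E)"
  have "C \<ge> 0" by (auto simp: C_def intro!: sum_nonneg)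
  then have E: "E > 0" unfolding E_def by (smt (verit) mult_nonneg_nonneg of_nat_0_le_iff)
  then have \<delta>: "\<delta> > 0" using \<open>\<eta> > 0\<close> by (simp add: \<delta>_def)
  define P where "P = partial_pairing \<beta> \<gamma>"
  obtain I J M N where "hump_blocks F P w \<delta> K I J M N"
    using gliding_hump_blocks[where \<beta> = \<beta> and \<gamma> = \<gamma> and w = w and K = K, OF col row bound _ \<delta>]
      conv unfolding P_def partial_pairing_def by blast
  note blocks = this[unfolded hump_blocks_def]
  note mono = blocks[THEN conjunct1] and chain = blocks[THEN conjunct2, THEN conjunct1]
    and lower = blocks[THEN conjunct2, THEN conjunct2, THEN conjunct1]
    and upper = blocks[THEN conjunct2, THEN conjunct2, THEN conjunct2]
  have M_mono: "M a \<le> M b" if "a \<le> b" "b \<le> K" for a b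
    using interval_chain_mono[of K M N a b] chain that by blast
  have MN: "M a \<le> N a" "N a \<le> M (Suc a)" if "a < K" for a
    using chain that by auto
  define S where "S = (\<Union>s<K. {N s..<M (Suc s)})"
  show thesis
  proof (rule that[of I J S]; (rule ballI)?)
    show "inj_on I {..<K}" "inj_on J {..<K}"
      unfolding inj_on_def using mono by (metis lessThan_iff less_irrefl nat_neq_iff)+
    show "finite S" by (simp add: S_def)
    fix y assume y: "y \<in> F"
    define D where "D = (\<lambda>s k l. P (M (Suc s)) y (I k) (J l) - P (N s) y (I k) (J l))"
    define W where "W = (\<lambda>s k l. if k \<le> l \<and> s = l then w y (I k) (J l) else 0)"
    have near: "norm (D s k l - W s k l) \<le> 2 * \<delta>" if skl: "s < K" "k < K" "l < K" for s k l
    proof -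
      have two: "norm (a - b) \<le> 2 * \<delta>" if "norm (a - v) \<le> \<delta>" "norm (b - v) \<le> \<delta>" for a b v :: 'k
        using norm_triangle_ineq4[of "a - v" "b - v"] that by simp
      have two': "norm (a - b - v) \<le> 2 * \<delta>" if "norm (a - v) \<le> \<delta>" "norm b \<le> \<delta>" for a b v :: 'k
        using norm_triangle_ineq4[of "a - v" b] that by (simp add: algebra_simps)
      have up: "norm (P m y (I k) (J l)) \<le> \<delta>" if "k \<le> l" "m \<le> N l" for m
        using upper skl y that by blast
      have up': "norm (P m y (I k) (J l) - w y (I k) (J l)) \<le> \<delta>" if "k \<le> l" "M (Suc l) \<le> m" for m
        using upper skl y that by blast
      have lo: "norm (P m y (I k) (J l)) \<le> \<delta>" if "l < k" "m \<le> M k" for m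
        using lower skl y that by blast
      have lo': "norm (P m y (I k) (J l) - w y (I k) (J l)) \<le> \<delta>" if "l < k" "N k \<le> m" for m
        using lower skl y that by blast
      \<comment> \<open>The cases compare block s with the indices that carry (k, l): before them
        both ends are small, on them only the right end has converged, after them both have. For l <
        k these indices end at N k, where block k starts, so s = k already counts as after.\<close>
      consider "k \<le> l" "s < l" | "k \<le> l" "s = l" | "k \<le> l" "s > l" | "l < k" "s < k" | "l < k" "k \<le> s"
        by linarith
      then show ?thesis
      proof cases
        case 1
        then have "M (Suc s) \<le> N l" "N s \<le> N l"
          using M_mono[of "Suc s" l] MN[of s] MN[of l] skl by auto
        then have "norm (D s k l) \<le> 2 * \<delta>"
          unfolding D_def using 1 up by (intro two[of _ 0]) auto
        then show ?thesis using 1 by (simp add: W_def)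
      next
        case 2
        then have "norm (D s k l - w y (I k) (J l)) \<le> 2 * \<delta>"
          unfolding D_def using up up' by (intro two') auto
        then show ?thesis using 2 by (simp add: W_def)
      next
        case 3
        then have "M (Suc l) \<le> M (Suc s)" "M (Suc l) \<le> N s"
          using M_mono[of "Suc l" s] MN[of s] MN[of l] skl by auto
        then have "norm (D s k l) \<le> 2 * \<delta>"
          unfolding D_def using 3 up' by (intro two[of _ "w y (I k) (J l)"]) auto
        then show ?thesis using 3 by (simp add: W_def)
      next
        case 4
        then have "M (Suc s) \<le> M k" "N s \<le> M k"
          using M_mono[of "Suc s" k] MN[of s] skl by auto
        then have "norm (D s k l) \<le> 2 * \<delta>"
          unfolding D_def using 4 lo by (intro two[of _ 0]) auto
        then show ?thesis using 4 by (simp add: W_def)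
      next
        case 5
        have "N k \<le> N s"
        proof (cases "k = s")
          case False
          then show ?thesis using 5 M_mono[of "Suc k" s] MN[of s] MN[of k] skl by auto
        qed simp
        then have "N k \<le> N s" "N k \<le> M (Suc s)"
          using MN[of s] skl by auto
        then have "norm (D s k l) \<le> 2 * \<delta>"
          unfolding D_def using 5 lo' by (intro two[of _ "w y (I k) (J l)"]) auto
        then show ?thesis using 5 by (simp add: W_def)
      qed
    qed
    define b where "b = (\<lambda>n. (\<Sum>k<K. \<Sum>l<K. c k l * \<beta> n (I k) (J l)) * \<gamma> y n)"
    have block: "(\<Sum>n\<in>{N s..<M (Suc s)}. b n) = (\<Sum>k<K. \<Sum>l<K. c k l * D s k l)" if "s < K" for s
    proof -
      have PD: "D s k l = (\<Sum>n\<in>{N s..<M (Suc s)}. \<beta> n (I k) (J l) * \<gamma> y n)" for k l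
        using MN(2)[OF that] sum_diff_nat_ivl[of 0 "N s" "M (Suc s)" "\<lambda>n. \<beta> n (I k) (J l) * \<gamma> y n"]
        by (simp add: D_def P_def partial_pairing_def atLeast0LessThan)
      have "(\<Sum>n\<in>{N s..<M (Suc s)}. b n) =
          (\<Sum>n\<in>{N s..<M (Suc s)}. \<Sum>k<K. \<Sum>l<K. c k l * (\<beta> n (I k) (J l) * \<gamma> y n))"
        by (simp add: b_def sum_distrib_right mult.assoc)
      also have "\<dots> = (\<Sum>k<K. \<Sum>n\<in>{N s..<M (Suc s)}. \<Sum>l<K. c k l * (\<beta> n (I k) (J l) * \<gamma> y n))"
        by (rule sum.swap)
      also have "\<dots> = (\<Sum>k<K. \<Sum>l<K. \<Sum>n\<in>{N s..<M (Suc s)}. c k l * (\<beta> n (I k) (J l) * \<gamma> y n))"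
        by (intro sum.cong refl sum.swap)
      finally show ?thesis
        by (simp add: PD sum_distrib_left)
    qed
    have "(\<Sum>n\<in>S. b n) = (\<Sum>s<K. \<Sum>n\<in>{N s..<M (Suc s)}. b n)"
      unfolding S_def
    proof (rule sum.UNION_disjoint)
      show "\<forall>i\<in>{..<K}. \<forall>j\<in>{..<K}. i \<noteq> j \<longrightarrow> {N i..<M (Suc i)} \<inter> {N j..<M (Suc j)} = {}"
      proof (intro ballI impI)
        fix i j assume "i \<in> {..<K}" "j \<in> {..<K}" "i \<noteq> j"
        then have "M (Suc i) \<le> N j \<or> M (Suc j) \<le> N i"
          using M_mono[of "Suc i" j] M_mono[of "Suc j" i] MN[of i] MN[of j]
          by (cases "i < j") auto
        then show "{N i..<M (Suc i)} \<inter> {N j..<M (Suc j)} = {}" by auto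
      qed
    qed auto
    also have "\<dots> = (\<Sum>s<K. \<Sum>k<K. \<Sum>l<K. c k l * D s k l)"
      by (simp add: block)
    finally have bD: "(\<Sum>n\<in>S. b n) = (\<Sum>s<K. \<Sum>k<K. \<Sum>l<K. c k l * D s k l)" .
    have "(\<Sum>s<K. \<Sum>k<K. \<Sum>l<K. c k l * W s k l) = (\<Sum>k<K. \<Sum>l<K. \<Sum>s<K. c k l * W s k l)"
      by (subst sum.swap) (intro sum.cong refl sum.swap)
    also have "\<dots> = (\<Sum>k<K. \<Sum>l<K. if k \<le> l then c k l * w y (I k) (J l) else 0)"
      by (intro sum.cong refl) (auto simp: W_def if_distrib cong: if_cong)
    finally have cW: "(\<Sum>s<K. \<Sum>k<K. \<Sum>l<K. c k l * W s k l) =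
        (\<Sum>k<K. \<Sum>l<K. if k \<le> l then c k l * w y (I k) (J l) else 0)" .
    have "norm ((\<Sum>n\<in>S. b n) - (\<Sum>k<K. \<Sum>l<K. if k \<le> l then c k l * w y (I k) (J l) else 0)) =
        norm (\<Sum>s<K. \<Sum>k<K. \<Sum>l<K. c k l * (D s k l - W s k l))"
      unfolding bD cW[symmetric] right_diff_distrib sum_subtractf by (rule refl)
    also have "\<dots> \<le> (\<Sum>s<K. \<Sum>k<K. \<Sum>l<K. norm (c k l) * (2 * \<delta>))"
      by (intro sum_norm_le) (auto simp: norm_mult intro!: mult_left_mono near)
    also have "\<dots> = 2 * \<delta> * (real K * C)"
      by (simp add: C_def sum_distrib_left sum_distrib_right mult_ac)
    also have "\<dots> \<le> 2 * \<delta> * E"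
      using \<delta> by (intro mult_left_mono) (auto simp: E_def)
    also have "\<dots> = \<eta>"
      using E by (simp add: \<delta>_def)
    finally show "norm ((\<Sum>n\<in>S. (\<Sum>k<K. \<Sum>l<K. c k l * \<beta> n (I k) (J l)) * \<gamma> y n) -
        (\<Sum>k<K. \<Sum>l<K. if k \<le> l then c k l * w y (I k) (J l) else 0)) \<le> \<eta>"
      unfolding b_def .
  qed
qed


subsection \<open>Seminormed spaces and Cauchy sequences\<close>

text \<open>Only a seminorm is assumed, so that the space of Cauchy sequences, where null sequences
  have seminorm 0, is an instance as well as the sequence spaces and their tensor products. Addition
  is that of the type class, which gives access to \<open>sum\<close>.\<close>

locale seminormed_nspace =
  fixes E :: "('k::{real_normed_field, euclidean_space}, 'v::ab_group_add) nspace"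
  assumes vector_space_scale: "vector_space (vscale E)"
    and vadd_eq: "vadd E = (+)"
    and vzero_eq: "vzero E = 0"
    and zero_closed: "0 \<in> carrier E"
    and add_closed: "x \<in> carrier E \<Longrightarrow> y \<in> carrier E \<Longrightarrow> x + y \<in> carrier E"
    and scale_closed: "x \<in> carrier E \<Longrightarrow> vscale E c x \<in> carrier E"
    and vnorm_triangle: "x \<in> carrier E \<Longrightarrow> y \<in> carrier E \<Longrightarrow> vnorm E (x + y) \<le> vnorm E x + vnorm E y"
    and vnorm_scale: "x \<in> carrier E \<Longrightarrow> vnorm E (vscale E c x) = norm c * vnorm E x"
begin

sublocale vs: vector_space "vscale E"
  by (rule vector_space_scale)

lemma vdiff_eq: "vdiff E x y = x - y"
  by (simp add: vdiff_def vadd_eq vs.scale_minus_left)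

lemma minus_closed: "x \<in> carrier E \<Longrightarrow> - x \<in> carrier E"
  using scale_closed[of x "- 1"] by (simp add: vs.scale_minus_left)

lemma diff_closed: "x \<in> carrier E \<Longrightarrow> y \<in> carrier E \<Longrightarrow> x - y \<in> carrier E"
  using add_closed[of x "- y"] minus_closed[of y] by simp

lemma sum_closed: "(\<And>i. i \<in> A \<Longrightarrow> f i \<in> carrier E) \<Longrightarrow> sum f A \<in> carrier E"
  by (induction A rule: infinite_finite_induct) (auto intro: zero_closed add_closed)

lemma vnorm_zero: "vnorm E 0 = 0"
  using vnorm_scale[OF zero_closed, of 0] by simp

lemma vnorm_minus: "x \<in> carrier E \<Longrightarrow> vnorm E (- x) = vnorm E x"
  using vnorm_scale[of x "- 1"] by (simp add: vs.scale_minus_left)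

lemma vnorm_nonneg: "x \<in> carrier E \<Longrightarrow> vnorm E x \<ge> 0"
  using vnorm_triangle[of x "- x"] minus_closed[of x] by (simp add: vnorm_zero vnorm_minus)

lemma vnorm_minus_commute:
  assumes "x \<in> carrier E" "y \<in> carrier E"
  shows "vnorm E (x - y) = vnorm E (y - x)"
  using vnorm_minus[OF diff_closed[OF assms]] by simp

lemma vnorm_triangle_via:
  assumes "x \<in> carrier E" "y \<in> carrier E" "z \<in> carrier E"
  shows "vnorm E (x - z) \<le> vnorm E (x - y) + vnorm E (y - z)"
  using vnorm_triangle[of "x - y" "y - z"] assms by (simp add: diff_closed)

lemma abs_vnorm_diff:
  assumes "x \<in> carrier E" "y \<in> carrier E"
  shows "\<bar>vnorm E x - vnorm E y\<bar> \<le> vnorm E (x - y)"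
  using vnorm_triangle[of "x - y" y] vnorm_triangle[of "y - x" x] assms
  by (simp add: diff_closed vnorm_minus_commute)

lemma vnorm_sum: "(\<And>i. i \<in> A \<Longrightarrow> f i \<in> carrier E) \<Longrightarrow> vnorm E (sum f A) \<le> (\<Sum>i\<in>A. vnorm E (f i))"
proof (induction A rule: infinite_finite_induct)
  case (insert a A)
  then show ?case
    using vnorm_triangle[of "f a" "sum f A"] by (force intro: sum_closed)
qed (simp_all add: vnorm_zero)

lemma linear_form_iff:
  "linear_form E f \<longleftrightarrow> (\<forall>x\<in>carrier E. \<forall>y\<in>carrier E. f (x + y) = f x + f y) \<and>
     (\<forall>c. \<forall>x\<in>carrier E. f (vscale E c x) = c * f x)"
  by (simp add: linear_form_def vadd_eq)

lemma linear_form_zero: "linear_form E f \<Longrightarrow> f 0 = 0"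
  unfolding linear_form_iff using zero_closed by (metis add_cancel_left_left)

lemma linear_form_diff:
  assumes "linear_form E f" "x \<in> carrier E" "y \<in> carrier E"
  shows "f (x - y) = f x - f y"
proof -
  have "f (x - y + y) = f (x - y) + f y"
    using assms unfolding linear_form_iff by (meson diff_closed)
  then show ?thesis by simp
qed

lemma linear_form_sum:
  assumes "linear_form E f" "\<And>i. i \<in> A \<Longrightarrow> g i \<in> carrier E"
  shows "f (sum g A) = (\<Sum>i\<in>A. f (g i))"
  using assms(2)
proof (induction A rule: infinite_finite_induct)
  case (insert a A)
  then show ?case
    using assms(1) unfolding linear_form_iff by (simp add: sum_closed)
qed (simp_all add: linear_form_zero[OF assms(1)])

lemma linear_form_sum_scale:
  assumes "linear_form E f" "\<And>i. i \<in> A \<Longrightarrow> g i \<in> carrier E"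
  shows "f (\<Sum>i\<in>A. vscale E (c i) (g i)) = (\<Sum>i\<in>A. c i * f (g i))"
  using assms by (subst linear_form_sum) (auto simp: scale_closed linear_form_def)

lemma cauchy_seqs_iff:
  "s \<in> cauchy_seqs E \<longleftrightarrow> (\<forall>n. s n \<in> carrier E) \<and>
     (\<forall>e>0. \<exists>M. \<forall>m\<ge>M. \<forall>n\<ge>M. vnorm E (s m - s n) < e)"
  by (simp add: cauchy_seqs_def vdiff_eq)

lemma cauchy_seqs_closed: "s \<in> cauchy_seqs E \<Longrightarrow> s n \<in> carrier E"
  by (simp add: cauchy_seqs_iff)

lemma cauchy_seqs_const: "x \<in> carrier E \<Longrightarrow> (\<lambda>_. x) \<in> cauchy_seqs E"
  by (auto simp: cauchy_seqs_iff vnorm_zero)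

lemma cauchy_seqs_add:
  assumes s: "s \<in> cauchy_seqs E" and t: "t \<in> cauchy_seqs E"
  shows "s + t \<in> cauchy_seqs E"
  unfolding cauchy_seqs_iff
proof (intro conjI allI impI)
  show "(s + t) n \<in> carrier E" for n
    using s t by (simp add: add_closed cauchy_seqs_closed)
  fix e :: real assume "e > 0"
  then obtain M1 M2 where M: "\<And>m n. m \<ge> M1 \<Longrightarrow> n \<ge> M1 \<Longrightarrow> vnorm E (s m - s n) < e / 2"
    "\<And>m n. m \<ge> M2 \<Longrightarrow> n \<ge> M2 \<Longrightarrow> vnorm E (t m - t n) < e / 2"
    using s t unfolding cauchy_seqs_iff by (meson half_gt_zero)
  have "vnorm E ((s + t) m - (s + t) n) < e" if "m \<ge> max M1 M2" "n \<ge> max M1 M2" for m n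
    using vnorm_triangle[of "s m - s n" "t m - t n"] M(1)[of m n] M(2)[of m n] that s t
    by (simp add: diff_closed cauchy_seqs_closed add_diff_add)
  then show "\<exists>M. \<forall>m\<ge>M. \<forall>n\<ge>M. vnorm E ((s + t) m - (s + t) n) < e" by blast
qed

lemma cauchy_seqs_scale:
  assumes s: "s \<in> cauchy_seqs E"
  shows "(\<lambda>n. vscale E c (s n)) \<in> cauchy_seqs E"
  unfolding cauchy_seqs_iff
proof (intro conjI allI impI)
  show "vscale E c (s n) \<in> carrier E" for n
    using s by (simp add: scale_closed cauchy_seqs_closed)
  fix e :: real assume "e > 0"
  then have "e / (norm c + 1) > 0" by (smt (verit) divide_pos_pos norm_ge_zero)
  then obtain M where M: "\<And>m n. m \<ge> M \<Longrightarrow> n \<ge> M \<Longrightarrow> vnorm E (s m - s n) < e / (norm c + 1)"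
    using s unfolding cauchy_seqs_iff by meson
  have "vnorm E (vscale E c (s m) - vscale E c (s n)) < e" if "m \<ge> M" "n \<ge> M" for m n
  proof -
    have "vnorm E (vscale E c (s m) - vscale E c (s n)) = norm c * vnorm E (s m - s n)"
      using s by (simp add: diff_closed cauchy_seqs_closed vnorm_scale flip: vs.scale_right_diff_distrib)
    also have "\<dots> \<le> (norm c + 1) * vnorm E (s m - s n)"
      using s by (intro mult_right_mono vnorm_nonneg) (auto simp: diff_closed cauchy_seqs_closed)
    also have "\<dots> < e"
      using M[OF that] by (smt (verit) mult.commute norm_ge_zero pos_less_divide_eq)
    finally show ?thesis .
  qed
  then show "\<exists>M. \<forall>m\<ge>M. \<forall>n\<ge>M. vnorm E (vscale E c (s m) - vscale E c (s n)) < e" by blast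
qed

lemma vnorm_tendsto_lim:
  assumes "s \<in> cauchy_seqs E"
  shows "(\<lambda>n. vnorm E (s n)) \<longlonglongrightarrow> lim (\<lambda>n. vnorm E (s n))"
proof -
  have "Cauchy (\<lambda>n. vnorm E (s n))"
  proof (rule metric_CauchyI)
    fix e :: real assume "e > 0"
    then obtain M where "\<And>m n. m \<ge> M \<Longrightarrow> n \<ge> M \<Longrightarrow> vnorm E (s m - s n) < e"
      using assms unfolding cauchy_seqs_iff by meson
    moreover have "dist (vnorm E (s m)) (vnorm E (s n)) \<le> vnorm E (s m - s n)" for m n
      unfolding dist_real_def by (intro abs_vnorm_diff cauchy_seqs_closed assms)
    ultimately show "\<exists>M. \<forall>m\<ge>M. \<forall>n\<ge>M. dist (vnorm E (s m)) (vnorm E (s n)) < e"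
      by (meson order_le_less_trans)
  qed
  then show ?thesis
    by (simp add: Cauchy_convergent_iff convergent_LIMSEQ_iff)
qed

end

text \<open>The completion before division by null sequences. Vectors remain functions, so sums and
  seminorm estimates need no representatives; only the frame has to be transported from the
  classes.\<close>

definition cauchy_space ::
  "('k::{real_normed_field, euclidean_space}, 'v::ab_group_add) nspace \<Rightarrow> ('k, nat \<Rightarrow> 'v) nspace" where
  "cauchy_space E =
     \<lparr> carrier = cauchy_seqs E, vzero = 0, vadd = (+), vscale = (\<lambda>c s n. vscale E c (s n)),
       vnorm = (\<lambda>s. lim (\<lambda>n. vnorm E (s n))) \<rparr>"

definition cauchy_class ::
  "('k::{real_normed_field, euclidean_space}, 'v) nspace \<Rightarrow> (nat \<Rightarrow> 'v) \<Rightarrow> (nat \<Rightarrow> 'v) set" where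
  "cauchy_class E s = cauchy_rel E `` {s}"

text \<open>For \<open>D \<ge> 0\<close> this is the dual ball of radius D, stated by inequalities
  because \<open>dual_norm\<close> is a real supremum, informative only for forms already known to
  be bounded.\<close>

definition bounded_forms ::
  "('k::{real_normed_field, euclidean_space}, 'v) nspace \<Rightarrow> real \<Rightarrow> ('v \<Rightarrow> 'k) set" where
  "bounded_forms E D = {y. linear_form E y \<and> (\<forall>x\<in>carrier E. norm (y x) \<le> D * vnorm E x)}"

context seminormed_nspace
begin

lemma vnorm_cauchy_space: "s \<in> cauchy_seqs E \<Longrightarrow> (\<lambda>n. vnorm E (s n)) \<longlonglongrightarrow> vnorm (cauchy_space E) s"
  using vnorm_tendsto_lim by (simp add: cauchy_space_def)

lemma seminormed_cauchy_space: "seminormed_nspace (cauchy_space E)"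
proof
  fix c d :: 'k and s t :: "nat \<Rightarrow> 'v"
  show "vscale (cauchy_space E) c (s + t) = vscale (cauchy_space E) c s + vscale (cauchy_space E) c t"
    "vscale (cauchy_space E) (c + d) s = vscale (cauchy_space E) c s + vscale (cauchy_space E) d s"
    "vscale (cauchy_space E) c (vscale (cauchy_space E) d s) = vscale (cauchy_space E) (c * d) s"
    "vscale (cauchy_space E) 1 s = s"
    by (simp_all add: cauchy_space_def fun_eq_iff vs.scale_right_distrib vs.scale_left_distrib)
  show "vadd (cauchy_space E) = (+)" "vzero (cauchy_space E) = 0"
    by (simp_all add: cauchy_space_def)
  show "0 \<in> carrier (cauchy_space E)"
    using cauchy_seqs_const[OF zero_closed] by (simp add: cauchy_space_def zero_fun_def)
next
  fix c :: 'k and s t :: "nat \<Rightarrow> 'v"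
  assume s: "s \<in> carrier (cauchy_space E)"
  then have s': "s \<in> cauchy_seqs E" by (simp add: cauchy_space_def)
  show "vscale (cauchy_space E) c s \<in> carrier (cauchy_space E)"
    using cauchy_seqs_scale[OF s'] by (simp add: cauchy_space_def)
  have "(\<lambda>n. norm c * vnorm E (s n)) \<longlonglongrightarrow> norm c * vnorm (cauchy_space E) s"
    by (intro tendsto_intros vnorm_cauchy_space s')
  moreover have "(\<lambda>n. norm c * vnorm E (s n)) \<longlonglongrightarrow> vnorm (cauchy_space E) (vscale (cauchy_space E) c s)"
    using vnorm_cauchy_space[OF cauchy_seqs_scale[OF s', of c]] s'
    by (simp add: cauchy_space_def vnorm_scale cauchy_seqs_closed)
  ultimately show "vnorm (cauchy_space E) (vscale (cauchy_space E) c s) = norm c * vnorm (cauchy_space E) s"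
    using LIMSEQ_unique by blast
  assume t: "t \<in> carrier (cauchy_space E)"
  then have t': "t \<in> cauchy_seqs E" by (simp add: cauchy_space_def)
  show "s + t \<in> carrier (cauchy_space E)"
    using cauchy_seqs_add[OF s' t'] by (simp add: cauchy_space_def)
  show "vnorm (cauchy_space E) (s + t) \<le> vnorm (cauchy_space E) s + vnorm (cauchy_space E) t"
    using s' t'
    by (intro LIMSEQ_le[OF vnorm_cauchy_space[OF cauchy_seqs_add[OF s' t']]
          tendsto_add[OF vnorm_cauchy_space[OF s'] vnorm_cauchy_space[OF t']]])
      (auto simp: vnorm_triangle cauchy_seqs_closed)
qed

end

text \<open>A copy of the locale: interpreting the Cauchy space inside
  \<open>seminormed_nspace\<close> itself would call for Cauchy sequences of Cauchy sequences, and
  so on without end.\<close>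

locale completed_nspace = seminormed_nspace E
  for E :: "('k::{real_normed_field, euclidean_space}, 'v::ab_group_add) nspace"

sublocale completed_nspace \<subseteq> W: seminormed_nspace "cauchy_space E"
  by (rule seminormed_cauchy_space)


subsection \<open>Frames of the completion\<close>

context completed_nspace
begin

lemma W_simps [simp]:
  "carrier (cauchy_space E) = cauchy_seqs E"
  "vscale (cauchy_space E) c s = (\<lambda>n. vscale E c (s n))"
  by (simp_all add: cauchy_space_def)

lemma cauchy_rel_iff:
  "(s, t) \<in> cauchy_rel E \<longleftrightarrow>
     s \<in> cauchy_seqs E \<and> t \<in> cauchy_seqs E \<and> vnorm (cauchy_space E) (s - t) = 0"
proof -
  have "(\<lambda>n. vnorm E (s n - t n)) \<longlonglongrightarrow> 0 \<longleftrightarrow> vnorm (cauchy_space E) (s - t) = 0"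
    if "s \<in> cauchy_seqs E" "t \<in> cauchy_seqs E"
  proof -
    have "(\<lambda>n. vnorm E (s n - t n)) \<longlonglongrightarrow> vnorm (cauchy_space E) (s - t)"
      using vnorm_cauchy_space[of "s - t"] W.diff_closed[of s t] that by simp
    then show ?thesis
      using LIMSEQ_unique by auto
  qed
  then show ?thesis
    by (auto simp: cauchy_rel_def vdiff_eq)
qed

lemma equiv_cauchy_rel: "equiv (cauchy_seqs E) (cauchy_rel E)"
proof (rule equivI)
  show "cauchy_rel E \<subseteq> cauchy_seqs E \<times> cauchy_seqs E"
    by (auto simp: cauchy_rel_iff)
  show "refl_on (cauchy_seqs E) (cauchy_rel E)"
    by (auto simp: refl_on_def cauchy_rel_iff W.vnorm_zero)
  show "sym (cauchy_rel E)"
    by (auto simp: sym_def cauchy_rel_iff W.vnorm_minus_commute)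
  show "trans (cauchy_rel E)"
  proof (rule transI)
    fix s t u assume "(s, t) \<in> cauchy_rel E" "(t, u) \<in> cauchy_rel E"
    then show "(s, u) \<in> cauchy_rel E"
      using W.vnorm_triangle_via[of s t u] W.vnorm_nonneg[OF W.diff_closed[of s u]]
      by (simp add: cauchy_rel_iff)
  qed
qed

lemma cauchy_class_eq_iff:
  assumes "s \<in> cauchy_seqs E" "t \<in> cauchy_seqs E"
  shows "cauchy_class E s = cauchy_class E t \<longleftrightarrow> vnorm (cauchy_space E) (s - t) = 0"
  unfolding cauchy_class_def using eq_equiv_class_iff[OF equiv_cauchy_rel assms] assms
  by (simp add: cauchy_rel_iff)

lemma mem_cauchy_class: "s \<in> cauchy_seqs E \<Longrightarrow> s \<in> cauchy_class E s"
  unfolding cauchy_class_def by (rule equiv_class_self[OF equiv_cauchy_rel])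

lemma carrier_completion: "carrier (completion E) = cauchy_class E ` cauchy_seqs E"
  by (auto simp: completion_def quotient_def cauchy_class_def)

lemma vzero_completion: "vzero (completion E) = cauchy_class E 0"
  by (simp add: completion_def cauchy_class_def vzero_eq zero_fun_def)

lemma vadd_completion:
  assumes "s \<in> cauchy_seqs E" "t \<in> cauchy_seqs E"
  shows "vadd (completion E) (cauchy_class E s) (cauchy_class E t) = cauchy_class E (s + t)"
proof -
  have *: "congruent2 (cauchy_rel E) (cauchy_rel E) (\<lambda>s t. cauchy_class E (\<lambda>n. vadd E (s n) (t n)))"
  proof (rule congruent2I[OF equiv_cauchy_rel equiv_cauchy_rel])
    have "cauchy_class E (s + t) = cauchy_class E (s' + t')"
      if "(s, s') \<in> cauchy_rel E" "(t, t') \<in> cauchy_rel E" for s s' t t'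
    proof -
      have "vnorm (cauchy_space E) ((s + t) - (s' + t')) \<le> vnorm (cauchy_space E) (s - s') + vnorm (cauchy_space E) (t - t')"
        using W.vnorm_triangle[of "s - s'" "t - t'"] that W.diff_closed
        by (simp add: cauchy_rel_iff add_diff_add)
      then show ?thesis
        using that W.vnorm_nonneg[of "(s + t) - (s' + t')"] W.add_closed W.diff_closed
        by (simp add: cauchy_class_eq_iff cauchy_rel_iff)
    qed
    then show "(y, z) \<in> cauchy_rel E \<Longrightarrow> w \<in> cauchy_seqs E \<Longrightarrow>
        cauchy_class E (\<lambda>n. vadd E (y n) (w n)) = cauchy_class E (\<lambda>n. vadd E (z n) (w n))"
      "(y, z) \<in> cauchy_rel E \<Longrightarrow> w \<in> cauchy_seqs E \<Longrightarrow>
        cauchy_class E (\<lambda>n. vadd E (w n) (y n)) = cauchy_class E (\<lambda>n. vadd E (w n) (z n))" for y z w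
      by (simp_all add: vadd_eq plus_fun_def cauchy_rel_iff W.vnorm_zero)
  qed
  show ?thesis
    using UN_equiv_class2[OF equiv_cauchy_rel equiv_cauchy_rel * assms]
    by (simp add: completion_def cauchy_class_def vadd_eq plus_fun_def)
qed

lemma vscale_completion:
  assumes "s \<in> cauchy_seqs E"
  shows "vscale (completion E) c (cauchy_class E s) = cauchy_class E (\<lambda>n. vscale E c (s n))"
proof -
  have *: "congruent (cauchy_rel E) (\<lambda>s. cauchy_class E (\<lambda>n. vscale E c (s n)))"
  proof (rule congruentI)
    fix s t assume "(s, t) \<in> cauchy_rel E"
    then show "cauchy_class E (\<lambda>n. vscale E c (s n)) = cauchy_class E (\<lambda>n. vscale E c (t n))"
      using W.vnorm_scale[of "s - t" c] W.diff_closed[of s t]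
      by (simp add: cauchy_class_eq_iff cauchy_rel_iff cauchy_seqs_scale fun_diff_def
          flip: vs.scale_right_diff_distrib)
  qed
  show ?thesis
    using UN_equiv_class[OF equiv_cauchy_rel * assms] by (simp add: completion_def cauchy_class_def)
qed

lemma vnorm_completion:
  assumes "s \<in> cauchy_seqs E"
  shows "vnorm (completion E) (cauchy_class E s) = vnorm (cauchy_space E) s"
proof -
  have eq: "vnorm (cauchy_space E) t = vnorm (cauchy_space E) s" if "t \<in> cauchy_class E s" for t
    using that W.abs_vnorm_diff[of s t] by (simp add: cauchy_class_def cauchy_rel_iff)
  have "the_elem (vnorm (cauchy_space E) ` cauchy_class E s) = vnorm (cauchy_space E) s"
  proof (rule the_elem_image_unique)
    show "cauchy_class E s \<noteq> {}" using mem_cauchy_class[OF assms] by blast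
  qed (rule eq)
  then show ?thesis
    by (simp add: completion_def cauchy_space_def)
qed

lemma vdiff_completion:
  assumes "s \<in> cauchy_seqs E" "t \<in> cauchy_seqs E"
  shows "vdiff (completion E) (cauchy_class E s) (cauchy_class E t) = cauchy_class E (s - t)"
proof -
  have "s + (\<lambda>n. vscale E (- 1) (t n)) = s - t"
    by (simp add: fun_eq_iff vs.scale_minus_left)
  then show ?thesis
    unfolding vdiff_def vscale_completion[OF assms(2)]
      vadd_completion[OF assms(1) cauchy_seqs_scale[OF assms(2)]] by simp
qed

lemma vsum_completion:
  assumes "\<And>n. s n \<in> cauchy_seqs E"
  shows "vsum (completion E) (\<lambda>n. cauchy_class E (s n)) N = cauchy_class E (\<Sum>n<N. s n)"
  using assms W.sum_closed[of _ s]
  by (induction N) (simp_all add: vzero_completion vadd_completion)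

lemma vsums_completion:
  assumes "\<And>n. s n \<in> cauchy_seqs E" "l \<in> cauchy_seqs E"
  shows "vsums (completion E) (\<lambda>n. cauchy_class E (s n)) (cauchy_class E l) \<longleftrightarrow>
     (\<lambda>N. vnorm (cauchy_space E) ((\<Sum>n<N. s n) - l)) \<longlonglongrightarrow> 0"
  using assms W.sum_closed[of _ s] W.diff_closed[of _ l]
  by (simp add: vsums_def carrier_completion vsum_completion vdiff_completion vnorm_completion)

lemma linear_form_completion_iff:
  "linear_form (completion E) f \<longleftrightarrow> linear_form (cauchy_space E) (\<lambda>s. f (cauchy_class E s))"
  by (auto simp: linear_form_def W.vadd_eq carrier_completion vadd_completion vscale_completion)

text \<open>Extension by continuity: for a bounded form the limit exists along every Cauchy
  sequence, and on E, embedded by constant sequences, it is the form itself.\<close>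

definition lim_form :: "('v \<Rightarrow> 'k) \<Rightarrow> (nat \<Rightarrow> 'v) \<Rightarrow> 'k" where
  "lim_form y s = lim (\<lambda>n. y (s n))"

lemma lim_form_tendsto:
  assumes y: "y \<in> bounded_forms E D" and s: "s \<in> cauchy_seqs E"
  shows "(\<lambda>n. y (s n)) \<longlonglongrightarrow> lim_form y s"
proof -
  have dist_le: "dist (y (s m)) (y (s n)) \<le> (\<bar>D\<bar> + 1) * vnorm E (s m - s n)" for m n
  proof -
    have "dist (y (s m)) (y (s n)) = norm (y (s m - s n))"
      using y s by (simp add: bounded_forms_def linear_form_diff cauchy_seqs_closed dist_norm)
    also have "\<dots> \<le> D * vnorm E (s m - s n)"
      using y s by (simp add: bounded_forms_def diff_closed cauchy_seqs_closed)
    also have "\<dots> \<le> (\<bar>D\<bar> + 1) * vnorm E (s m - s n)"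
      using s by (intro mult_right_mono vnorm_nonneg diff_closed cauchy_seqs_closed) auto
    finally show ?thesis .
  qed
  have "Cauchy (\<lambda>n. y (s n))"
  proof (rule metric_CauchyI)
    fix e :: real assume "e > 0"
    then have "e / (\<bar>D\<bar> + 1) > 0" by simp
    then obtain M where M: "\<And>m n. m \<ge> M \<Longrightarrow> n \<ge> M \<Longrightarrow> vnorm E (s m - s n) < e / (\<bar>D\<bar> + 1)"
      using s unfolding cauchy_seqs_iff by meson
    have "dist (y (s m)) (y (s n)) < e" if "m \<ge> M" "n \<ge> M" for m n
    proof -
      have "(\<bar>D\<bar> + 1) * vnorm E (s m - s n) < e"
        using M[OF that] by (simp add: field_simps)
      with dist_le[of m n] show ?thesis by linarith
    qed
    then show "\<exists>M. \<forall>m\<ge>M. \<forall>n\<ge>M. dist (y (s m)) (y (s n)) < e" by blast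
  qed
  then show ?thesis
    by (simp add: lim_form_def Cauchy_convergent_iff convergent_LIMSEQ_iff)
qed

lemma lim_form_const: "lim_form y (\<lambda>_. x) = y x"
  by (simp add: lim_form_def)

lemma lim_form_bounded:
  assumes y: "y \<in> bounded_forms E D"
  shows "lim_form y \<in> bounded_forms (cauchy_space E) D"
  unfolding bounded_forms_def W.linear_form_iff
proof (intro CollectI conjI ballI allI)
  fix s assume "s \<in> carrier (cauchy_space E)"
  then have s: "s \<in> cauchy_seqs E" by simp
  show "norm (lim_form y s) \<le> D * vnorm (cauchy_space E) s"
    using y s
    by (intro LIMSEQ_le[OF tendsto_norm[OF lim_form_tendsto[OF y s]]
          tendsto_mult[OF tendsto_const vnorm_cauchy_space[OF s]]])
      (auto simp: bounded_forms_def cauchy_seqs_closed)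
  have "(\<lambda>n. c * y (s n)) \<longlonglongrightarrow> lim_form y (vscale (cauchy_space E) c s)" for c
    using lim_form_tendsto[OF y cauchy_seqs_scale[OF s, of c]] y s
    by (simp add: bounded_forms_def linear_form_iff cauchy_seqs_closed)
  then show "lim_form y (vscale (cauchy_space E) c s) = c * lim_form y s" for c
    using tendsto_mult[OF tendsto_const lim_form_tendsto[OF y s]] LIMSEQ_unique by blast
  fix t assume "t \<in> carrier (cauchy_space E)"
  then have t: "t \<in> cauchy_seqs E" by simp
  have "(\<lambda>n. y (s n) + y (t n)) \<longlonglongrightarrow> lim_form y (s + t)"
    using lim_form_tendsto[OF y cauchy_seqs_add[OF s t]] y s t
    by (simp add: bounded_forms_def linear_form_iff cauchy_seqs_closed)
  then show "lim_form y (s + t) = lim_form y s + lim_form y t"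
    using tendsto_add[OF lim_form_tendsto[OF y s] lim_form_tendsto[OF y t]] LIMSEQ_unique by blast
qed

end

text \<open>
  All that is needed of a frame of the completion of \<open>E\<close>: the coordinate functionals \<open>b n\<close> restricted
  to \<open>E\<close>, and the values \<open>\<gamma> y n\<close> of the extensions of bounded forms \<open>y\<close> on \<open>E\<close> at the frame vectors.
\<close>

definition frame_system ::
  "('k::{real_normed_field, euclidean_space}, 'v) nspace \<Rightarrow> (nat \<Rightarrow> 'v \<Rightarrow> 'k) \<Rightarrow>
   (('v \<Rightarrow> 'k) \<Rightarrow> nat \<Rightarrow> 'k) \<Rightarrow> real \<Rightarrow> bool" where
  "frame_system E b \<gamma> B \<longleftrightarrow>
     (\<forall>n. b n \<in> dual E) \<and>
     (\<forall>D\<ge>0. \<forall>n. \<exists>C. \<forall>y\<in>bounded_forms E D. norm (\<gamma> y n) \<le> C) \<and>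
     (\<forall>D\<ge>0. \<forall>x\<in>carrier E. \<forall>\<eta>>0. \<exists>M0. \<forall>M\<ge>M0. \<forall>y\<in>bounded_forms E D.
        norm ((\<Sum>n<M. b n x * \<gamma> y n) - y x) \<le> \<eta>) \<and>
     (\<forall>D\<ge>0. \<forall>S. finite S \<longrightarrow> (\<forall>x\<in>carrier E. \<forall>y\<in>bounded_forms E D.
        norm (\<Sum>n\<in>S. b n x * \<gamma> y n) \<le> B * vnorm E x * D))"

section \<open>Frame systems from Besselian frames\<close>

context completed_nspace
begin

text \<open>Each frame vector is a class. Fixing a representing Cauchy sequence
  \<open>\<alpha> n\<close> moves the expansions to \<open>cauchy_space E\<close>, where they are
  finite sums converging in a seminorm.\<close>

lemma schauder_frame_completion:
  assumes "schauder_frame (completion E) a b"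
  obtains \<alpha> where "\<And>n. \<alpha> n \<in> cauchy_seqs E" "\<And>n. a n = cauchy_class E (\<alpha> n)"
    "\<And>s. s \<in> cauchy_seqs E \<Longrightarrow>
       (\<lambda>N. vnorm (cauchy_space E) ((\<Sum>n<N. vscale (cauchy_space E) (b n (cauchy_class E s)) (\<alpha> n)) - s)) \<longlonglongrightarrow> 0"
proof -
  have "\<forall>n. \<exists>s. s \<in> cauchy_seqs E \<and> a n = cauchy_class E s"
    using assms unfolding schauder_frame_def carrier_completion by blast
  then obtain \<alpha> where \<alpha>: "\<And>n. \<alpha> n \<in> cauchy_seqs E" "\<And>n. a n = cauchy_class E (\<alpha> n)"
    by metis
  show thesis
  proof (rule that[OF \<alpha>])
    fix s assume s: "s \<in> cauchy_seqs E"
    then have "vsums (completion E) (\<lambda>n. vscale (completion E) (b n (cauchy_class E s)) (a n)) (cauchy_class E s)"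
      using assms by (simp add: schauder_frame_def carrier_completion)
    then show "(\<lambda>N. vnorm (cauchy_space E)
        ((\<Sum>n<N. vscale (cauchy_space E) (b n (cauchy_class E s)) (\<alpha> n)) - s)) \<longlonglongrightarrow> 0"
      using \<alpha> s by (simp add: vscale_completion vsums_completion cauchy_seqs_scale)
  qed
qed

lemma dual_restrict:
  assumes "f \<in> dual (completion E)"
  shows "(\<lambda>x. f (cauchy_class E (\<lambda>_. x))) \<in> dual E"
proof -
  have norm_const: "vnorm (cauchy_space E) (\<lambda>_. x) = vnorm E x" for x
    by (simp add: cauchy_space_def)
  have lin: "linear_form (cauchy_space E) (\<lambda>s. f (cauchy_class E s))"
    using assms by (simp add: dual_def linear_form_completion_iff)
  have "linear_form E (\<lambda>x. f (cauchy_class E (\<lambda>_. x)))"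
    unfolding linear_form_iff
  proof (intro conjI ballI allI)
    fix x y c assume x: "x \<in> carrier E"
    show "f (cauchy_class E (\<lambda>_. vscale E c x)) = c * f (cauchy_class E (\<lambda>_. x))"
      using lin cauchy_seqs_const[OF x] by (simp add: linear_form_def)
    assume y: "y \<in> carrier E"
    show "f (cauchy_class E (\<lambda>_. x + y)) = f (cauchy_class E (\<lambda>_. x)) + f (cauchy_class E (\<lambda>_. y))"
      using lin cauchy_seqs_const[OF x] cauchy_seqs_const[OF y]
      by (simp add: W.linear_form_iff plus_fun_def)
  qed
  moreover obtain C where "\<forall>x\<in>carrier (completion E). norm (f x) \<le> C * vnorm (completion E) x"
    using assms by (auto simp: dual_def)
  then have "\<forall>x\<in>carrier E. norm (f (cauchy_class E (\<lambda>_. x))) \<le> C * vnorm E x"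
    using cauchy_seqs_const
    by (simp add: carrier_completion vnorm_completion) (metis norm_const)
  ultimately show ?thesis by (auto simp: dual_def)
qed

text \<open>The two kinds of frames differ only in the reason why finite sums are bounded, so that
  bound is a hypothesis here. Uniformity in y comes for free: y at the remainder of the expansion is
  at most D times its seminorm, and the remainder does not depend on y.\<close>

lemma frame_system_of_bound:
  assumes frame: "schauder_frame (completion E) a b"
    and \<alpha>: "\<And>n. \<alpha> n \<in> cauchy_seqs E" "\<And>n. a n = cauchy_class E (\<alpha> n)"
    and conv: "\<And>s. s \<in> cauchy_seqs E \<Longrightarrow>
       (\<lambda>N. vnorm (cauchy_space E) ((\<Sum>n<N. vscale (cauchy_space E) (b n (cauchy_class E s)) (\<alpha> n)) - s)) \<longlonglongrightarrow> 0"
    and bound: "\<And>D S x y. D \<ge> 0 \<Longrightarrow> finite S \<Longrightarrow> x \<in> carrier E \<Longrightarrow> y \<in> bounded_forms E D \<Longrightarrow>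
       norm (\<Sum>n\<in>S. b n (cauchy_class E (\<lambda>_. x)) * lim_form y (\<alpha> n)) \<le> B * vnorm E x * D"
  shows "frame_system E (\<lambda>n x. b n (cauchy_class E (\<lambda>_. x))) (\<lambda>y n. lim_form y (\<alpha> n)) B"
  unfolding frame_system_def
proof (intro conjI allI impI ballI bound; assumption?)
  show "(\<lambda>x. b n (cauchy_class E (\<lambda>_. x))) \<in> dual E" for n
    using frame by (intro dual_restrict) (simp add: schauder_frame_def)
next
  fix D :: real and n assume "D \<ge> 0"
  then show "\<exists>C. \<forall>y\<in>bounded_forms E D. norm (lim_form y (\<alpha> n)) \<le> C"
    using lim_form_bounded[of _ D] \<alpha>(1)[of n]
    by (intro exI[of _ "D * vnorm (cauchy_space E) (\<alpha> n)"]) (simp add: bounded_forms_def)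
next
  fix D \<eta> :: real and x assume D: "D \<ge> 0" and x: "x \<in> carrier E" and \<eta>: "\<eta> > 0"
  define r where "r = (\<lambda>N. (\<Sum>n<N. vscale (cauchy_space E) (b n (cauchy_class E (\<lambda>_. x))) (\<alpha> n)) - (\<lambda>_. x))"
  have W: "\<alpha> n \<in> carrier (cauchy_space E)" "(\<lambda>_. x) \<in> carrier (cauchy_space E)" for n
    using \<alpha> x by (auto intro: cauchy_seqs_const)
  have r: "r N \<in> carrier (cauchy_space E)" for N
    unfolding r_def by (intro W.diff_closed W.sum_closed W.scale_closed W)
  have "(\<lambda>N. D * vnorm (cauchy_space E) (r N)) \<longlonglongrightarrow> D * 0"
    unfolding r_def by (intro tendsto_intros conv cauchy_seqs_const x)
  then have "eventually (\<lambda>N. D * vnorm (cauchy_space E) (r N) < \<eta>) sequentially"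
    using \<eta> by (intro order_tendstoD) auto
  then obtain M0 where M0: "\<And>M. M \<ge> M0 \<Longrightarrow> D * vnorm (cauchy_space E) (r M) < \<eta>"
    by (auto simp: eventually_sequentially)
  have "norm ((\<Sum>n<M. b n (cauchy_class E (\<lambda>_. x)) * lim_form y (\<alpha> n)) - y x) \<le> \<eta>"
    if "M \<ge> M0" and y: "y \<in> bounded_forms E D" for M y
  proof -
    have lin: "linear_form (cauchy_space E) (lim_form y)"
      and bd: "norm (lim_form y (r M)) \<le> D * vnorm (cauchy_space E) (r M)"
      using lim_form_bounded[OF y] r[of M] by (auto simp: bounded_forms_def)
    have "lim_form y (r M) = (\<Sum>n<M. b n (cauchy_class E (\<lambda>_. x)) * lim_form y (\<alpha> n)) - y x"
      unfolding r_def
      by (subst W.linear_form_diff[OF lin W.sum_closed[OF W.scale_closed[OF W(1)]] W(2)])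
        (simp only: W.linear_form_sum_scale[OF lin W(1)] lim_form_const)
    then show ?thesis
      using bd M0[OF \<open>M \<ge> M0\<close>] by simp
  qed
  then show "\<exists>M0. \<forall>M\<ge>M0. \<forall>y\<in>bounded_forms E D.
      norm ((\<Sum>n<M. b n (cauchy_class E (\<lambda>_. x)) * lim_form y (\<alpha> n)) - y x) \<le> \<eta>"
    by blast
qed

lemma dual_norm_le:
  assumes "D \<ge> 0" "f \<in> bounded_forms (completion E) D"
  shows "f \<in> dual (completion E)" "dual_norm (completion E) f \<le> D"
proof -
  show "f \<in> dual (completion E)"
    using assms by (auto simp: bounded_forms_def dual_def)
  have "cauchy_class E 0 \<in> {x \<in> carrier (completion E). vnorm (completion E) x \<le> 1}"
    using W.zero_closed by (simp add: carrier_completion vnorm_completion W.vnorm_zero)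
  then show "dual_norm (completion E) f \<le> D"
    unfolding dual_norm_def
  proof (intro cSUP_least)
    fix x assume x: "x \<in> {x \<in> carrier (completion E). vnorm (completion E) x \<le> 1}"
    then have "norm (f x) \<le> D * vnorm (completion E) x"
      using assms by (simp add: bounded_forms_def)
    also have "\<dots> \<le> D"
      using x assms by (simp add: mult_left_le)
    finally show "norm (f x) \<le> D" .
  qed auto
qed

text \<open>A finite sum is dominated by the Besselian series of the extension of y to the
  completion, whose dual norm is at most D.\<close>

lemma besselian_frame_system:
  assumes "besselian_schauder_frame (completion E) a b"
  obtains b' \<gamma> B where "frame_system E b' \<gamma> B"
proof -
  have frame: "schauder_frame (completion E) a b"
    using assms by (simp add: besselian_schauder_frame_def)
  obtain B where B0: "B > 0" and B1: "\<forall>x\<in>carrier (completion E). \<forall>y\<in>dual (completion E).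
        summable (\<lambda>n. norm (b n x) * norm (y (a n))) \<and>
        (\<Sum>n. norm (b n x) * norm (y (a n))) \<le> B * vnorm (completion E) x * dual_norm (completion E) y"
    using assms unfolding besselian_schauder_frame_def by (elim conjE exE) (rule that)
  note B = B0 B1[rule_format]
  obtain \<alpha> where \<alpha>: "\<And>n. \<alpha> n \<in> cauchy_seqs E" "\<And>n. a n = cauchy_class E (\<alpha> n)"
    and conv: "\<And>s. s \<in> cauchy_seqs E \<Longrightarrow>
       (\<lambda>N. vnorm (cauchy_space E) ((\<Sum>n<N. vscale (cauchy_space E) (b n (cauchy_class E s)) (\<alpha> n)) - s)) \<longlonglongrightarrow> 0"
    using schauder_frame_completion[OF frame] by blast
  have "frame_system E (\<lambda>n x. b n (cauchy_class E (\<lambda>_. x))) (\<lambda>y n. lim_form y (\<alpha> n)) B"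
  proof (rule frame_system_of_bound[OF frame \<alpha> conv])
    fix D :: real and S :: "nat set" and x y
    assume D: "D \<ge> 0" and S: "finite S" and x: "x \<in> carrier E" and y: "y \<in> bounded_forms E D"
    \<comment> \<open>The extension as a form on classes, read off an arbitrary representative; this
      is well defined because \<open>lim_form y\<close> vanishes on sequences of seminorm 0.\<close>
    define Y where "Y = (\<lambda>T. lim_form y (SOME s. s \<in> T))"
    have lin: "linear_form (cauchy_space E) (lim_form y)"
      and bd: "\<And>s. s \<in> cauchy_seqs E \<Longrightarrow> norm (lim_form y s) \<le> D * vnorm (cauchy_space E) s"
      using lim_form_bounded[OF y] by (auto simp: bounded_forms_def)
    have Y: "Y (cauchy_class E s) = lim_form y s" if s: "s \<in> cauchy_seqs E" for s
    proof -
      define t where "t = (SOME t. t \<in> cauchy_class E s)"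
      have "t \<in> cauchy_class E s"
        unfolding t_def by (rule someI[of "\<lambda>t. t \<in> cauchy_class E s", OF mem_cauchy_class[OF s]])
      then have t: "t \<in> cauchy_seqs E" "vnorm (cauchy_space E) (s - t) = 0"
        by (auto simp: cauchy_class_def cauchy_rel_iff)
      then have "norm (lim_form y (s - t)) \<le> 0"
        using bd[of "s - t"] W.diff_closed[of s t] s by simp
      then show ?thesis
        using W.linear_form_diff[OF lin, of s t] s t by (simp add: Y_def t_def)
    qed
    have "Y \<in> bounded_forms (completion E) D"
    proof -
      have "linear_form (cauchy_space E) (\<lambda>s. Y (cauchy_class E s))"
        using lin W.add_closed W.scale_closed by (simp add: W.linear_form_iff Y)
      then show ?thesis
        using bd by (auto simp: bounded_forms_def linear_form_completion_iff carrier_completion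
            vnorm_completion Y)
    qed
    note Y' = dual_norm_le[OF D this]
    define X where "X = cauchy_class E (\<lambda>_. x)"
    have X: "X \<in> carrier (completion E)" "vnorm (completion E) X = vnorm E x"
      using cauchy_seqs_const[OF x]
      by (simp_all add: X_def carrier_completion vnorm_completion) (simp add: cauchy_space_def)
    have "norm (\<Sum>n\<in>S. b n X * lim_form y (\<alpha> n)) \<le> (\<Sum>n\<in>S. norm (b n X) * norm (Y (a n)))"
      by (intro sum_norm_le) (simp add: norm_mult \<alpha> Y)
    also have "\<dots> \<le> (\<Sum>n. norm (b n X) * norm (Y (a n)))"
      using B(2)[OF X(1) Y'(1)] S by (intro sum_le_suminf) auto
    also have "\<dots> \<le> B * vnorm (completion E) X * dual_norm (completion E) Y"
      using B(2)[OF X(1) Y'(1)] by blast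
    also have "\<dots> \<le> B * vnorm E x * D"
      using Y'(2) B(1) vnorm_nonneg[OF x] by (simp add: X mult_left_mono)
    finally show "norm (\<Sum>n\<in>S. b n (cauchy_class E (\<lambda>_. x)) * lim_form y (\<alpha> n)) \<le> B * vnorm E x * D"
      by (simp add: X_def)
  qed
  then show thesis by (rule that)
qed

end

section \<open>Unconditional convergence and uniform boundedness\<close>

lemma blockwise_permutation:
  fixes T :: "nat \<Rightarrow> nat"
  assumes T: "T 0 = 0" "strict_mono T" and A: "\<And>k. A k \<subseteq> {T k..<T (Suc k)}"
  shows "\<exists>\<sigma>. bij \<sigma> \<and> (\<forall>k. bij_betw \<sigma> {T k..<T k + card (A k)} (A k))"
proof -
  let ?I = "\<lambda>k. {T k..<T (Suc k)}"
  have "\<exists>f. bij_betw f (?I k) (?I k) \<and> bij_betw f {T k..<T k + card (A k)} (A k)" for k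
  proof -
    have fin: "finite (A k)" using A finite_subset by blast
    have card: "card (A k) \<le> T (Suc k) - T k"
      using card_mono[OF _ A[of k]] by simp
    have T_le: "T k \<le> T (Suc k)" using T(2) by (simp add: strict_mono_less_eq)
    obtain g where g: "bij_betw g {T k..<T k + card (A k)} (A k)"
      using finite_same_card_bij[of "{T k..<T k + card (A k)}" "A k"] fin by auto
    have "card {T k + card (A k)..<T (Suc k)} = card (?I k - A k)"
      using A[of k] fin by (simp add: card_Diff_subset)
    then obtain h where h: "bij_betw h {T k + card (A k)..<T (Suc k)} (?I k - A k)"
      using finite_same_card_bij[of "{T k + card (A k)..<T (Suc k)}" "?I k - A k"] by auto
    define f where "f = (\<lambda>n. if n < T k + card (A k) then g n else h n)"
    have f1: "bij_betw f {T k..<T k + card (A k)} (A k)"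
      using g by (subst bij_betw_cong[of _ _ g]) (auto simp: f_def)
    have f2: "bij_betw f {T k + card (A k)..<T (Suc k)} (?I k - A k)"
      using h by (subst bij_betw_cong[of _ _ h]) (auto simp: f_def)
    have "{T k..<T k + card (A k)} \<union> {T k + card (A k)..<T (Suc k)} = ?I k"
      using card T_le by auto
    moreover have "A k \<union> (?I k - A k) = ?I k"
      using A[of k] by auto
    ultimately have "bij_betw f (?I k) (?I k)"
      using bij_betw_combine[OF f1 f2] by auto
    with f1 show ?thesis by blast
  qed
  then obtain \<pi> where \<pi>: "\<And>k. bij_betw (\<pi> k) (?I k) (?I k)"
    "\<And>k. bij_betw (\<pi> k) {T k..<T k + card (A k)} (A k)"
    by metis
  have disj: "j = k" if "n \<in> ?I j" "n \<in> ?I k" for j k n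
  proof (rule ccontr)
    assume "j \<noteq> k"
    then have "T (Suc j) \<le> T k \<or> T (Suc k) \<le> T j"
      using T(2) by (auto simp: strict_mono_less_eq Suc_le_eq)
    then show False using that by auto
  qed
  define blk where "blk = (\<lambda>n. THE k. n \<in> ?I k)"
  have blk: "blk n = k" if "n \<in> ?I k" for n k
    unfolding blk_def using that disj by blast
  define \<sigma> where "\<sigma> = (\<lambda>n. \<pi> (blk n) n)"
  have \<sigma>I: "bij_betw \<sigma> (?I k) (?I k)" for k
    using \<pi>(1)[of k] by (subst bij_betw_cong[of _ _ "\<pi> k"]) (auto simp: \<sigma>_def blk)
  have A_le: "T k + card (A k) \<le> T (Suc k)" for k
    using card_mono[OF _ A[of k]] T(2) by (simp add: le_diff_conv2 strict_mono_less_eq add.commute)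
  have \<sigma>A: "bij_betw \<sigma> {T k..<T k + card (A k)} (A k)" for k
    using \<pi>(2)[of k] A_le[of k] by (subst bij_betw_cong[of _ _ "\<pi> k"]) (auto simp: \<sigma>_def blk[of _ k])
  have disj_family: "disjoint_family_on ?I K" for K
    unfolding disjoint_family_on_def using disj by blast
  have union: "(\<Union>j<k. ?I j) = {..<T k}" for k
  proof (induction k)
    case (Suc k)
    then show ?case
      using T(2) by (auto simp: lessThan_Suc strict_mono_less_eq) (meson less_le_trans lessI less_imp_le strict_mono_less_eq)
  qed (simp add: T)
  have "(\<Union>k. ?I k) = UNIV"
  proof -
    have "n \<in> (\<Union>k. ?I k)" for n
    proof -
      have "n \<in> {..<T (Suc n)}"
        using strict_mono_imp_increasing[OF T(2), of "Suc n"] by simp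
      then show ?thesis unfolding union[symmetric] by blast
    qed
    then show ?thesis by blast
  qed
  then have "bij \<sigma>"
    using bij_betw_UNION_disjoint[OF disj_family[of UNIV], of \<sigma> ?I] \<sigma>I by auto
  then show ?thesis using \<sigma>A by blast
qed

context seminormed_nspace
begin

text \<open>If the finite sums were unbounded, discarding the first M terms would still leave a
  finite set with a sum of norm at least 1, so such sets exist in infinitely many disjoint
  intervals. \<open>blockwise_permutation\<close> lists each of them consecutively, and the partial
  sums of the rearranged series are not Cauchy.\<close>

lemma finite_sums_bounded_of_unconditional:
  fixes s :: "nat \<Rightarrow> 'v"
  assumes s: "\<And>n. s n \<in> carrier E"
    and conv: "\<And>\<sigma>. bij \<sigma> \<Longrightarrow> \<exists>l\<in>carrier E. (\<lambda>N. vnorm E ((\<Sum>n<N. s (\<sigma> n)) - l)) \<longlonglongrightarrow> 0"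
  shows "\<exists>C. \<forall>S. finite S \<longrightarrow> vnorm E (\<Sum>n\<in>S. s n) \<le> C"
proof (rule ccontr)
  assume "\<not> ?thesis"
  then have unbounded: "\<exists>S. finite S \<and> vnorm E (\<Sum>n\<in>S. s n) > C" for C
    by (simp add: not_le)
  have "\<exists>S. finite S \<and> S \<subseteq> {M..} \<and> vnorm E (\<Sum>n\<in>S. s n) \<ge> 1" for M :: nat
  proof -
    obtain S where S: "finite S" "vnorm E (\<Sum>n\<in>S. s n) > 1 + (\<Sum>n<M. vnorm E (s n))"
      using unbounded by blast
    have split: "(\<Sum>n\<in>S. s n) = (\<Sum>n\<in>S \<inter> {..<M}. s n) + (\<Sum>n\<in>S \<inter> {M..}. s n)"
      using S(1) by (subst sum.union_disjoint[symmetric]) (auto intro!: sum.cong)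
    have "vnorm E (\<Sum>n\<in>S. s n) \<le> vnorm E (\<Sum>n\<in>S \<inter> {..<M}. s n) + vnorm E (\<Sum>n\<in>S \<inter> {M..}. s n)"
      unfolding split by (intro vnorm_triangle sum_closed s)
    also have "vnorm E (\<Sum>n\<in>S \<inter> {..<M}. s n) \<le> (\<Sum>n\<in>S \<inter> {..<M}. vnorm E (s n))"
      by (intro vnorm_sum s)
    also have "\<dots> \<le> (\<Sum>n<M. vnorm E (s n))"
      by (intro sum_mono2) (auto intro: vnorm_nonneg s)
    finally show ?thesis
      using S by (intro exI[of _ "S \<inter> {M..}"]) auto
  qed
  then obtain f where f: "\<And>M. finite (f M)" "\<And>M. f M \<subseteq> {M..}" "\<And>M. vnorm E (\<Sum>n\<in>f M. s n) \<ge> 1"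
    by metis
  \<comment> \<open>The next interval starts beyond the previous start and beyond the set found
    after it.\<close>
  define T where "T = rec_nat 0 (\<lambda>_ t. Suc (Max (insert t (f t))))"
  have T: "T 0 = 0" "\<And>k. T (Suc k) = Suc (Max (insert (T k) (f (T k))))"
    by (simp_all add: T_def)
  have "T k < T (Suc k)" for k
    unfolding T(2) less_Suc_eq_le using f(1) by (intro Max_ge) auto
  then have mono: "strict_mono T" by (simp add: strict_mono_Suc_iff)
  have sub: "f (T k) \<subseteq> {T k..<T (Suc k)}" for k
  proof
    fix n assume n: "n \<in> f (T k)"
    then have "n \<le> Max (insert (T k) (f (T k)))"
      using f(1) by (intro Max_ge) auto
    then show "n \<in> {T k..<T (Suc k)}"
      using f(2)[of "T k"] n by (auto simp: T(2))
  qed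
  obtain \<sigma> where \<sigma>: "bij \<sigma> \<and> (\<forall>k. bij_betw \<sigma> {T k..<T k + card (f (T k))} (f (T k)))"
    using blockwise_permutation[of T "\<lambda>k. f (T k)", OF T(1) mono sub] by (elim exE)
  obtain l where l: "l \<in> carrier E" and lim: "(\<lambda>N. vnorm E ((\<Sum>n<N. s (\<sigma> n)) - l)) \<longlonglongrightarrow> 0"
    using conv[OF conjunct1[OF \<sigma>]] by (elim bexE)
  define p where "p = (\<lambda>N. \<Sum>n<N. s (\<sigma> n))"
  have p: "p N \<in> carrier E" for N
    unfolding p_def by (intro sum_closed s)
  have "eventually (\<lambda>N. vnorm E (p N - l) < 1 / 2) sequentially"
    using lim unfolding p_def by (intro order_tendstoD) auto
  then obtain N where N: "\<And>n. n \<ge> N \<Longrightarrow> vnorm E (p n - l) < 1 / 2"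
    by (auto simp: eventually_sequentially)
  define c where "c = card (f (T N))"
  have TN: "T N \<ge> N" using strict_mono_imp_increasing[OF mono] .
  have "p (T N + c) - p (T N) = (\<Sum>n\<in>{T N..<T N + c}. s (\<sigma> n))"
    unfolding p_def lessThan_atLeast0 by (rule sum_diff_nat_ivl) auto
  also have "\<dots> = (\<Sum>n\<in>f (T N). s n)"
    unfolding c_def by (rule sum.reindex_bij_betw[OF conjunct2[OF \<sigma>, rule_format]])
  finally have "1 \<le> vnorm E (p (T N + c) - p (T N))"
    using f(3) by simp
  also have "\<dots> \<le> vnorm E (p (T N + c) - l) + vnorm E (l - p (T N))"
    by (intro vnorm_triangle_via p l)
  also have "\<dots> < 1 / 2 + 1 / 2"
    using N[of "T N + c"] N[of "T N"] TN vnorm_minus_commute[OF l p]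
    by (intro add_strict_mono) auto
  finally show False by simp
qed

end

context completed_nspace
begin

text \<open>
  Gliding hump: \<open>y\<close> is replaced by \<open>y'\<close> such that some seminorm is large at \<open>y'\<close>, and all later
  changes, being of norm at most \<open>\<delta>'\<close>, change that seminorm by at most 1.
\<close>

lemma uniform_boundedness:
  fixes \<tau> :: "'i \<Rightarrow> (nat \<Rightarrow> 'v) \<Rightarrow> real"
  assumes triangle: "\<And>i s t. i \<in> I \<Longrightarrow> s \<in> cauchy_seqs E \<Longrightarrow> t \<in> cauchy_seqs E \<Longrightarrow> \<tau> i (s + t) \<le> \<tau> i s + \<tau> i t"
    and scale: "\<And>i s c. i \<in> I \<Longrightarrow> s \<in> cauchy_seqs E \<Longrightarrow> \<tau> i (\<lambda>n. vscale E c (s n)) = norm c * \<tau> i s"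
    and bounded: "\<And>i. i \<in> I \<Longrightarrow> \<exists>K. \<forall>s\<in>cauchy_seqs E. \<tau> i s \<le> K * vnorm (cauchy_space E) s"
    and pointwise: "\<And>s. s \<in> cauchy_seqs E \<Longrightarrow> \<exists>C. \<forall>i\<in>I. \<tau> i s \<le> C"
  shows "\<exists>B\<ge>0. \<forall>i\<in>I. \<forall>x\<in>carrier E. \<tau> i (\<lambda>_. x) \<le> B * vnorm E x"
proof (rule ccontr)
  assume "\<not> ?thesis"
  then have unbounded: "\<exists>i\<in>I. \<exists>x\<in>carrier E. \<tau> i (\<lambda>_. x) > B * vnorm E x" if "B \<ge> 0" for B
    using that by (meson not_le)
  have norm_const: "vnorm (cauchy_space E) (\<lambda>_. x) = vnorm E x" for x
    by (simp add: cauchy_space_def)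
  have minus: "\<tau> i (- s) = \<tau> i s" if "i \<in> I" "s \<in> cauchy_seqs E" for i s
    using scale[OF that, of "- 1"] by (simp add: vs.scale_minus_left fun_Compl_def)
  have step: "\<exists>y' \<delta>'. (y' \<in> carrier E \<and> \<delta>' > 0) \<and> vnorm E (y' - y) \<le> \<delta> / 2 \<and> \<delta>' \<le> \<delta> / 2 \<and>
      (\<exists>i\<in>I. \<tau> i (\<lambda>_. y') \<ge> real n \<and> (\<forall>s\<in>cauchy_seqs E. vnorm (cauchy_space E) s \<le> \<delta>' \<longrightarrow> \<tau> i s \<le> 1))"
    if y: "y \<in> carrier E" and \<delta>: "\<delta> > 0" for y \<delta> n
  proof -
    \<comment> \<open>Scaled to norm \<delta>/2, a vector that violates the bound with this constant
      has \<tau> i at least n.\<close>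
    define B where "B = 2 * real n / \<delta>"
    have "B \<ge> 0" using \<delta> by (simp add: B_def)
    then obtain i x where i: "i \<in> I" and x: "x \<in> carrier E" and big: "\<tau> i (\<lambda>_. x) > B * vnorm E x"
      using unbounded by blast
    obtain K where K: "\<And>s. s \<in> cauchy_seqs E \<Longrightarrow> \<tau> i s \<le> K * vnorm (cauchy_space E) s"
      using bounded[OF i] by blast
    have "\<tau> i (\<lambda>_. x) \<le> K * vnorm E x"
      using K[OF cauchy_seqs_const[OF x]] by (simp add: norm_const)
    then have x0: "vnorm E x > 0"
      using big vnorm_nonneg[OF x] by (cases "vnorm E x = 0") auto
    define r where "r = \<delta> / (2 * vnorm E x)"
    have r: "r > 0" using x0 \<delta> by (simp add: r_def)
    define z where "z = vscale E (of_real r) x"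
    have z: "z \<in> carrier E" using x by (simp add: z_def scale_closed)
    have z_norm: "vnorm E z = \<delta> / 2"
      using x x0 r by (simp add: z_def vnorm_scale) (simp add: r_def)
    have "\<tau> i (\<lambda>_. z) = r * \<tau> i (\<lambda>_. x)"
      using scale[OF i cauchy_seqs_const[OF x], of "of_real r"] r by (simp add: z_def)
    also have "\<dots> \<ge> r * (B * vnorm E x)"
      using big r by (intro mult_left_mono) auto
    also have "r * (B * vnorm E x) = real n"
      using x0 \<delta> by (simp add: r_def B_def)
    finally have z_big: "\<tau> i (\<lambda>_. z) \<ge> real n" .
    have yz: "(\<lambda>_. y + z) \<in> cauchy_seqs E" "(\<lambda>_. y - z) \<in> cauchy_seqs E"
      using y z by (auto intro!: cauchy_seqs_const add_closed diff_closed)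
    \<comment> \<open>Since 2 z = (y + z) - (y - z), one of the two neighbours of y inherits the
      large seminorm. This replaces a category argument.\<close>
    have "\<tau> i ((\<lambda>_. y + z) + - (\<lambda>_. y - z)) \<le> \<tau> i (\<lambda>_. y + z) + \<tau> i (\<lambda>_. y - z)"
      using triangle[OF i yz(1) W.minus_closed[simplified, OF yz(2)]] minus[OF i yz(2)] by simp
    moreover have "(\<lambda>_::nat. y + z) + - (\<lambda>_. y - z) = (\<lambda>n. vscale E 2 ((\<lambda>_. z) n))"
      using vs.scale_left_distrib[of 1 1 z] by (simp add: fun_eq_iff)
    ultimately have "2 * \<tau> i (\<lambda>_. z) \<le> \<tau> i (\<lambda>_. y + z) + \<tau> i (\<lambda>_. y - z)"
      using scale[OF i cauchy_seqs_const[OF z], of 2] by simp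
    then have "\<tau> i (\<lambda>_. y + z) \<ge> real n \<or> \<tau> i (\<lambda>_. y - z) \<ge> real n"
      using z_big by linarith
    then obtain y' where y': "y' \<in> carrier E" "vnorm E (y' - y) \<le> \<delta> / 2" "\<tau> i (\<lambda>_. y') \<ge> real n"
    proof
      assume "\<tau> i (\<lambda>_. y + z) \<ge> real n"
      then show thesis using y z z_norm by (intro that[of "y + z"]) (auto simp: add_closed)
    next
      assume "\<tau> i (\<lambda>_. y - z) \<ge> real n"
      then show thesis using y z z_norm by (intro that[of "y - z"]) (auto simp: diff_closed vnorm_minus)
    qed
    define \<delta>' where "\<delta>' = min (\<delta> / 2) (1 / (\<bar>K\<bar> + 1))"
    have \<delta>': "\<delta>' > 0" "\<delta>' \<le> \<delta> / 2" "\<delta>' \<le> 1 / (\<bar>K\<bar> + 1)" using \<delta> by (simp_all add: \<delta>'_def)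
    have "\<tau> i s \<le> 1" if s: "s \<in> cauchy_seqs E" "vnorm (cauchy_space E) s \<le> \<delta>'" for s
    proof -
      have "\<tau> i s \<le> K * vnorm (cauchy_space E) s" by (rule K[OF s(1)])
      also have "\<dots> \<le> (\<bar>K\<bar> + 1) * vnorm (cauchy_space E) s"
        using W.vnorm_nonneg[of s] s(1) by (intro mult_right_mono) auto
      also have "\<dots> \<le> (\<bar>K\<bar> + 1) * (1 / (\<bar>K\<bar> + 1))"
        using s(2) \<delta>'(3) by (intro mult_left_mono) auto
      also have "\<dots> = 1" by simp
      finally show ?thesis .
    qed
    then show ?thesis
      using y' \<delta>' i by blast
  qed
  define Q where "Q = (\<lambda>n (g :: 'v \<times> real) g'. vnorm E (fst g' - fst g) \<le> snd g / 2 \<and> snd g' \<le> snd g / 2 \<and>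
      (\<exists>i\<in>I. \<tau> i (\<lambda>_. fst g') \<ge> real n \<and>
        (\<forall>s\<in>cauchy_seqs E. vnorm (cauchy_space E) s \<le> snd g' \<longrightarrow> \<tau> i s \<le> 1)))"
  have "\<exists>g. \<forall>n. (fst (g n) \<in> carrier E \<and> snd (g n) > 0) \<and> Q n (g n) (g (Suc n))"
  proof (rule dependent_nat_choice)
    show "\<exists>x. fst x \<in> carrier E \<and> snd x > (0::real)"
      using zero_closed by (intro exI[of _ "(0, 1)"]) auto
  next
    fix g :: "'v \<times> real" and n :: nat
    assume g: "fst g \<in> carrier E \<and> snd g > 0"
    obtain y' \<delta>' where "y' \<in> carrier E \<and> \<delta>' > 0" "Q n g (y', \<delta>')"
      using step[of "fst g" "snd g" n] g unfolding Q_def by auto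
    then show "\<exists>g'. (fst g' \<in> carrier E \<and> snd g' > 0) \<and> Q n g g'"
      by (intro exI[of _ "(y', \<delta>')"]) auto
  qed
  then obtain g where g: "\<And>n. (fst (g n) \<in> carrier E \<and> snd (g n) > 0) \<and> Q n (g n) (g (Suc n))"
    by blast
  define y \<delta> where "y = (\<lambda>n. fst (g n))" and "\<delta> = (\<lambda>n. snd (g n))"
  have y: "y n \<in> carrier E" and \<delta>: "\<delta> n > 0"
    and near: "vnorm E (y (Suc n) - y n) \<le> \<delta> n / 2" and half: "\<delta> (Suc n) \<le> \<delta> n / 2"
    and hump: "\<exists>i\<in>I. \<tau> i (\<lambda>_. y (Suc n)) \<ge> real n \<and>
      (\<forall>s\<in>cauchy_seqs E. vnorm (cauchy_space E) s \<le> \<delta> (Suc n) \<longrightarrow> \<tau> i s \<le> 1)" for n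
    using g[of n] by (simp_all add: y_def \<delta>_def Q_def)
  have tail: "vnorm E (y m - y k) \<le> \<delta> k - \<delta> m" if "k \<le> m" for k m
    using that
  proof (induction rule: dec_induct)
    case (step m)
    then show ?case
      using vnorm_triangle_via[OF y y y, of "Suc m" k m] near[of m] half[of m] by linarith
  qed (simp add: vnorm_zero)
  have \<delta>_le: "\<delta> n \<le> \<delta> 0 * (1 / 2) ^ n" for n
  proof (induction n)
    case (Suc n)
    then show ?case using half[of n] by simp
  qed simp
  have "(\<lambda>n. \<delta> 0 * (1 / 2) ^ n) \<longlonglongrightarrow> \<delta> 0 * 0"
    by (intro tendsto_intros LIMSEQ_power_zero) auto
  then have \<delta>_lim: "\<delta> \<longlonglongrightarrow> 0"
    using \<delta> \<delta>_le
    by (intro real_tendsto_sandwich[of "\<lambda>_. 0" \<delta> sequentially "\<lambda>n. \<delta> 0 * (1 / 2) ^ n"])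
      (simp_all add: less_imp_le)
  \<comment> \<open>The constructed sequence is itself the limit point: as an element of
    \<open>cauchy_space E\<close> it is approached by the constant sequences of its terms.\<close>
  have y_cauchy: "y \<in> cauchy_seqs E"
    unfolding cauchy_seqs_iff
  proof (intro conjI allI impI y)
    fix e :: real assume "e > 0"
    then have "eventually (\<lambda>n. \<delta> n < e / 2) sequentially"
      using \<delta>_lim by (intro order_tendstoD) auto
    then obtain M where M: "\<delta> M < e / 2" by (auto simp: eventually_sequentially)
    have "vnorm E (y m - y n) < e" if "m \<ge> M" "n \<ge> M" for m n
    proof -
      have "vnorm E (y m - y n) \<le> vnorm E (y m - y M) + vnorm E (y M - y n)"
        by (intro vnorm_triangle_via y)
      also have "\<dots> < e / 2 + e / 2"
        using tail[OF that(1)] tail[OF that(2)] \<delta>[of m] \<delta>[of n] M vnorm_minus_commute[OF y y, of M n]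
        by linarith
      finally show ?thesis by simp
    qed
    then show "\<exists>M. \<forall>m\<ge>M. \<forall>n\<ge>M. vnorm E (y m - y n) < e" by blast
  qed
  have const: "(\<lambda>_. y k) \<in> cauchy_seqs E" for k
    by (intro cauchy_seqs_const y)
  have close: "vnorm (cauchy_space E) ((\<lambda>_. y k) - y) \<le> \<delta> k" for k
  proof (rule LIMSEQ_le_const2)
    have "(\<lambda>_. y k) - y \<in> cauchy_seqs E"
      using W.diff_closed[of "\<lambda>_. y k" y] const y_cauchy by simp
    from vnorm_cauchy_space[OF this]
    show "(\<lambda>n. vnorm E (y k - y n)) \<longlonglongrightarrow> vnorm (cauchy_space E) ((\<lambda>_. y k) - y)" by simp
    have "vnorm E (y k - y n) \<le> \<delta> k" if "n \<ge> k" for n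
      using tail[OF that] \<delta>[of n] vnorm_minus_commute[OF y y, of k n] by linarith
    then show "\<exists>N. \<forall>n\<ge>N. vnorm E (y k - y n) \<le> \<delta> k" by blast
  qed
  obtain C where C: "\<And>i. i \<in> I \<Longrightarrow> \<tau> i y \<le> C"
    using pointwise[OF y_cauchy] by blast
  obtain n where n: "real n > C + 1"
    using reals_Archimedean2 by blast
  obtain i where i: "i \<in> I" "\<tau> i (\<lambda>_. y (Suc n)) \<ge> real n"
    "\<forall>s\<in>cauchy_seqs E. vnorm (cauchy_space E) s \<le> \<delta> (Suc n) \<longrightarrow> \<tau> i s \<le> 1"
    using hump[of n] by blast
  have d: "(\<lambda>_. y (Suc n)) - y \<in> cauchy_seqs E"
    using W.diff_closed[of "\<lambda>_. y (Suc n)" y] const y_cauchy by simp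
  have "\<tau> i (y + ((\<lambda>_. y (Suc n)) - y)) \<le> \<tau> i y + \<tau> i ((\<lambda>_. y (Suc n)) - y)"
    by (intro triangle i y_cauchy d)
  moreover have "y + ((\<lambda>_. y (Suc n)) - y) = (\<lambda>_. y (Suc n))"
    by (simp add: fun_eq_iff)
  ultimately have "real n \<le> C + 1"
    using i C[OF i(1)] d close[of "Suc n"] by fastforce
  then show False using n by simp
qed

text \<open>For each finite S the norm of the partial expansion over S is a seminorm of the expanded
  vector. Unconditional convergence bounds these seminorms at every point of the completion, and
  uniform boundedness yields one constant for all S on E.\<close>

lemma unconditional_frame_system:
  assumes "unconditional_schauder_frame (completion E) a b"
  obtains b' \<gamma> B where "frame_system E b' \<gamma> B"
proof -
  have frame: "schauder_frame (completion E) a b"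
    and uncond: "\<And>x. x \<in> carrier (completion E) \<Longrightarrow>
      uncond_summable (completion E) (\<lambda>n. vscale (completion E) (b n x) (a n))"
    using assms by (simp_all add: unconditional_schauder_frame_def)
  obtain \<alpha> where \<alpha>: "\<And>n. \<alpha> n \<in> cauchy_seqs E" "\<And>n. a n = cauchy_class E (\<alpha> n)"
    and conv: "\<And>s. s \<in> cauchy_seqs E \<Longrightarrow>
       (\<lambda>N. vnorm (cauchy_space E) ((\<Sum>n<N. vscale (cauchy_space E) (b n (cauchy_class E s)) (\<alpha> n)) - s)) \<longlonglongrightarrow> 0"
    using schauder_frame_completion[OF frame] by blast
  define summand where "summand = (\<lambda>s n. vscale (cauchy_space E) (b n (cauchy_class E s)) (\<alpha> n))"
  define \<tau> where "\<tau> = (\<lambda>S s. vnorm (cauchy_space E) (\<Sum>n\<in>S. summand s n))"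
  have summand: "summand s n \<in> carrier (cauchy_space E)" for s n
    unfolding summand_def using \<alpha>(1) by (intro W.scale_closed) simp
  have b: "linear_form (cauchy_space E) (\<lambda>s. b n (cauchy_class E s))"
    and b_bound: "\<exists>C. \<forall>s\<in>cauchy_seqs E. norm (b n (cauchy_class E s)) \<le> C * vnorm (cauchy_space E) s" for n
    using frame
    by (auto simp: schauder_frame_def dual_def linear_form_completion_iff carrier_completion vnorm_completion)
  have "\<exists>B\<ge>0. \<forall>S\<in>{S. finite S}. \<forall>x\<in>carrier E. \<tau> S (\<lambda>_. x) \<le> B * vnorm E x"
  proof (rule uniform_boundedness)
    fix S :: "nat set" and s t assume S: "S \<in> {S. finite S}" and s: "s \<in> cauchy_seqs E"
    have "summand (vscale (cauchy_space E) c s) n = vscale (cauchy_space E) c (summand s n)" for c n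
      using b[of n] s unfolding linear_form_def summand_def W.vs.scale_scale[symmetric]
      by (metis W_simps(1) W.vs.scale_scale)
    then have "(\<Sum>n\<in>S. summand (vscale (cauchy_space E) c s) n) = vscale (cauchy_space E) c (\<Sum>n\<in>S. summand s n)" for c
      by (simp only: W.vs.scale_sum_right)
    then have "\<tau> S (vscale (cauchy_space E) c s) = norm c * \<tau> S s" for c
      unfolding \<tau>_def by (simp only: W.vnorm_scale[OF W.sum_closed[OF summand]])
    then show "\<tau> S (\<lambda>n. vscale E c (s n)) = norm c * \<tau> S s" for c by simp
    assume t: "t \<in> cauchy_seqs E"
    have "summand (s + t) n = summand s n + summand t n" for n
      using b[of n] s t unfolding W.linear_form_iff summand_def
      by (simp only: W_simps(1) W.vs.scale_left_distrib)
    then have "summand (s + t) = (\<lambda>n. summand s n + summand t n)" by (rule ext)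
    then have "\<tau> S (s + t) = vnorm (cauchy_space E) ((\<Sum>n\<in>S. summand s n) + (\<Sum>n\<in>S. summand t n))"
      by (simp only: \<tau>_def sum.distrib)
    also have "\<dots> \<le> \<tau> S s + \<tau> S t"
      unfolding \<tau>_def by (intro W.vnorm_triangle W.sum_closed summand)
    finally show "\<tau> S (s + t) \<le> \<tau> S s + \<tau> S t" .
  next
    fix S :: "nat set" assume S: "S \<in> {S. finite S}"
    have "\<forall>n. \<exists>C. \<forall>s\<in>cauchy_seqs E. norm (b n (cauchy_class E s)) \<le> C * vnorm (cauchy_space E) s"
      using b_bound by blast
    then obtain C where C: "\<And>n s. s \<in> cauchy_seqs E \<Longrightarrow> norm (b n (cauchy_class E s)) \<le> C n * vnorm (cauchy_space E) s"
      by metis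
    have "\<tau> S s \<le> (\<Sum>n\<in>S. C n * vnorm (cauchy_space E) (\<alpha> n)) * vnorm (cauchy_space E) s"
      if s: "s \<in> cauchy_seqs E" for s
    proof -
      have "\<tau> S s \<le> (\<Sum>n\<in>S. vnorm (cauchy_space E) (summand s n))"
        unfolding \<tau>_def by (intro W.vnorm_sum summand)
      also have "\<dots> = (\<Sum>n\<in>S. norm (b n (cauchy_class E s)) * vnorm (cauchy_space E) (\<alpha> n))"
        unfolding summand_def using \<alpha>(1) by (intro sum.cong refl W.vnorm_scale) simp
      also have "\<dots> \<le> (\<Sum>n\<in>S. (C n * vnorm (cauchy_space E) s) * vnorm (cauchy_space E) (\<alpha> n))"
        using C[OF s] \<alpha>(1) by (intro sum_mono mult_right_mono W.vnorm_nonneg) auto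
      finally show ?thesis unfolding sum_distrib_right by (simp only: mult_ac)
    qed
    then show "\<exists>K. \<forall>s\<in>cauchy_seqs E. \<tau> S s \<le> K * vnorm (cauchy_space E) s" by blast
  next
    fix s assume s: "s \<in> cauchy_seqs E"
    have "\<exists>C. \<forall>S. finite S \<longrightarrow> vnorm (cauchy_space E) (\<Sum>n\<in>S. summand s n) \<le> C"
    proof (rule W.finite_sums_bounded_of_unconditional[OF summand])
      fix \<sigma> :: "nat \<Rightarrow> nat" assume "bij \<sigma>"
      then obtain L where L: "vsums (completion E) (\<lambda>n. cauchy_class E (summand s (\<sigma> n))) L"
        using uncond[of "cauchy_class E s"] s
        by (auto simp: uncond_summable_def carrier_completion summand_def \<alpha> vscale_completion)
      then obtain l where l: "l \<in> cauchy_seqs E" "L = cauchy_class E l"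
        by (auto simp: vsums_def carrier_completion)
      then show "\<exists>l\<in>carrier (cauchy_space E).
          (\<lambda>N. vnorm (cauchy_space E) ((\<Sum>n<N. summand s (\<sigma> n)) - l)) \<longlonglongrightarrow> 0"
        using L summand vsums_completion[of "\<lambda>n. summand s (\<sigma> n)" l] by auto
    qed
    then show "\<exists>C. \<forall>S\<in>{S. finite S}. \<tau> S s \<le> C"
      by (auto simp: \<tau>_def)
  qed
  then obtain B where B: "\<And>S x. finite S \<Longrightarrow> x \<in> carrier E \<Longrightarrow> \<tau> S (\<lambda>_. x) \<le> B * vnorm E x"
    by blast
  have "frame_system E (\<lambda>n x. b n (cauchy_class E (\<lambda>_. x))) (\<lambda>y n. lim_form y (\<alpha> n)) B"
  proof (rule frame_system_of_bound[OF frame \<alpha> conv])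
    fix D :: real and S :: "nat set" and x y
    assume D: "D \<ge> 0" and S: "finite S" and x: "x \<in> carrier E" and y: "y \<in> bounded_forms E D"
    have lin: "linear_form (cauchy_space E) (lim_form y)"
      and bd: "\<And>s. s \<in> cauchy_seqs E \<Longrightarrow> norm (lim_form y s) \<le> D * vnorm (cauchy_space E) s"
      using lim_form_bounded[OF y] by (auto simp: bounded_forms_def)
    have "(\<Sum>n\<in>S. b n (cauchy_class E (\<lambda>_. x)) * lim_form y (\<alpha> n)) = lim_form y (\<Sum>n\<in>S. summand (\<lambda>_. x) n)"
      unfolding summand_def using \<alpha>(1) by (subst W.linear_form_sum_scale[OF lin]) simp_all
    also have "norm \<dots> \<le> D * \<tau> S (\<lambda>_. x)"
      unfolding \<tau>_def using W.sum_closed[OF summand] by (intro bd) simp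
    also have "\<dots> \<le> D * (B * vnorm E x)"
      using B[OF S x] D by (intro mult_left_mono)
    finally show "norm (\<Sum>n\<in>S. b n (cauchy_class E (\<lambda>_. x)) * lim_form y (\<alpha> n)) \<le> B * vnorm E x * D"
      by (simp add: mult_ac)
  qed
  then show thesis by (rule that)
qed

end


subsection \<open>The spaces \<open>\<ell>\<^sub>p\<close>\<close>

text \<open>\<open>I\<close> and \<open>J\<close> precede y: the form tested later is made from
  them, so the bound has to hold on a whole ball of forms. The partial expansion of x over a finite
  set is bounded by the frame constant and differs from the truncated sum by at most \<eta>.\<close>

lemma (in seminormed_nspace) frame_system_triangle:
  fixes e :: "nat \<Rightarrow> nat \<Rightarrow> 'v" and c :: "nat \<Rightarrow> nat \<Rightarrow> 'k"
  assumes frame: "frame_system E b \<gamma> B" and closed: "\<forall>i j. e i j \<in> carrier E"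
    and col: "\<forall>f\<in>dual E. \<forall>i. (\<lambda>j. f (e i j)) \<longlonglongrightarrow> 0"
    and row: "\<forall>f\<in>dual E. \<forall>j. (\<lambda>i. f (e i j)) \<longlonglongrightarrow> 0"
    and "D \<ge> 0" "\<eta> > 0"
  obtains I J where "inj_on I {..<K}" "inj_on J {..<K}"
    "\<forall>y\<in>bounded_forms E D.
       norm (\<Sum>k<K. \<Sum>l<K. if k \<le> l then c k l * y (e (I k) (J l)) else 0)
         \<le> B * vnorm E (\<Sum>k<K. \<Sum>l<K. vscale E (c k l) (e (I k) (J l))) * D + \<eta>"
proof -
  note e = closed[rule_format]
  note system = frame[unfolded frame_system_def]
  have dual: "b n \<in> dual E" for n
    using system by (elim conjE) (rule spec)
  have pt_bound: "\<forall>n. \<exists>C. \<forall>y\<in>bounded_forms E D. norm (\<gamma> y n) \<le> C"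
    by (rule system[THEN conjunct2, THEN conjunct1, THEN spec, THEN mp, OF \<open>D \<ge> 0\<close>])
  have conv: "\<forall>x\<in>carrier E. \<forall>\<eta>>0. \<exists>M0. \<forall>M\<ge>M0. \<forall>y\<in>bounded_forms E D.
      norm ((\<Sum>n<M. b n x * \<gamma> y n) - y x) \<le> \<eta>"
    by (rule system[THEN conjunct2, THEN conjunct2, THEN conjunct1, THEN spec, THEN mp, OF \<open>D \<ge> 0\<close>])
  have bound: "norm (\<Sum>n\<in>S. b n x * \<gamma> y n) \<le> B * vnorm E x * D"
    if "finite S" "x \<in> carrier E" "y \<in> bounded_forms E D" for S x y
    using system[THEN conjunct2, THEN conjunct2, THEN conjunct2] \<open>D \<ge> 0\<close> that by simp
  obtain A where A: "\<forall>y\<in>bounded_forms E D. \<forall>n. norm (\<gamma> y n) \<le> A n"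
    using pt_bound by metis
  have conv': "\<forall>\<eta>>0. \<forall>i j. \<exists>M0. \<forall>M\<ge>M0. \<forall>y\<in>bounded_forms E D.
      norm ((\<Sum>n<M. b n (e i j) * \<gamma> y n) - y (e i j)) \<le> \<eta>"
    using conv e by simp
  obtain I J S where IJ: "inj_on I {..<K}" "inj_on J {..<K}" and S: "finite S"
    and near: "\<forall>y\<in>bounded_forms E D.
      norm ((\<Sum>n\<in>S. (\<Sum>k<K. \<Sum>l<K. c k l * b n (e (I k) (J l))) * \<gamma> y n) -
        (\<Sum>k<K. \<Sum>l<K. if k \<le> l then c k l * y (e (I k) (J l)) else 0)) \<le> \<eta>"
    by (rule triangle_selection[where \<beta> = "\<lambda>n i j. b n (e i j)" and \<gamma> = \<gamma> and w = "\<lambda>y i j. y (e i j)"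
          and c = c and K = K, OF bspec[OF col dual, THEN spec] bspec[OF row dual, THEN spec] A conv' \<open>\<eta> > 0\<close>])
      (rule that)
  define x where "x = (\<Sum>k<K. \<Sum>l<K. vscale E (c k l) (e (I k) (J l)))"
  have inner: "(\<Sum>l<K. vscale E (c k l) (e (I k) (J l))) \<in> carrier E" for k
    by (intro sum_closed scale_closed e)
  have x: "x \<in> carrier E"
    unfolding x_def by (rule sum_closed) (rule inner)
  have "b n x = (\<Sum>k<K. \<Sum>l<K. c k l * b n (e (I k) (J l)))" for n
  proof -
    have lin: "linear_form E (b n)" using dual by (simp add: dual_def)
    show ?thesis
      unfolding x_def using inner e
      by (simp add: linear_form_sum[OF lin] linear_form_sum_scale[OF lin])
  qed
  then have "norm (\<Sum>k<K. \<Sum>l<K. if k \<le> l then c k l * y (e (I k) (J l)) else 0) \<le> B * vnorm E x * D + \<eta>"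
    if "y \<in> bounded_forms E D" for y
    using bspec[OF near that] bound[OF S x that]
      norm_triangle_ineq4[of "\<Sum>n\<in>S. b n x * \<gamma> y n"
        "(\<Sum>n\<in>S. b n x * \<gamma> y n) - (\<Sum>k<K. \<Sum>l<K. if k \<le> l then c k l * y (e (I k) (J l)) else 0)"]
    by simp
  then show thesis
    using IJ unfolding x_def by (intro that ballI)
qed

section \<open>Minkowski's inequality\<close>

lemma convex_powr_le:
  fixes a b u p :: real
  assumes "p \<ge> 1" "a \<ge> 0" "b \<ge> 0" "0 < u" "u < 1"
  shows "(u * a + (1 - u) * b) powr p \<le> u * a powr p + (1 - u) * b powr p"
proof -
  have shrink: "(v * c) powr p \<le> v * c powr p" if "0 < v" "v < 1" "c \<ge> 0" for v c :: real
  proof -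
    have "v powr p \<le> v powr 1"
      using that assms by (intro powr_mono') auto
    then show ?thesis
      using that by (simp add: powr_mult mult_right_mono)
  qed
  consider "a = 0" | "b = 0" | "a > 0" "b > 0" using assms by linarith
  then show ?thesis
  proof cases
    case 3
    then show ?thesis
      using convex_onD[OF powr_convex[OF assms(1)], of "1 - u" a b] assms by simp
  qed (use shrink assms in auto)
qed

lemma lp_simps [simp]:
  "carrier (lp p :: ('k::{real_normed_field, euclidean_space}, _) nspace) = {x. summable (\<lambda>n. norm (x n) powr p)}"
  "vscale (lp p :: ('k, _) nspace) = (\<lambda>c x n. c * x n)"
  "vnorm (lp p :: ('k, _) nspace) x = (\<Sum>n. norm (x n) powr p) powr (1 / p)"
  by (simp_all add: lp_def)

lemma lp_add_closed:
  fixes x y :: "nat \<Rightarrow> 'k::{real_normed_field, euclidean_space}"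
  assumes "p > 0" "summable (\<lambda>n. norm (x n) powr p)" "summable (\<lambda>n. norm (y n) powr p)"
  shows "summable (\<lambda>n. norm (x n + y n) powr p)"
proof (rule summable_comparison_test', rule summable_mult[OF summable_add[OF assms(2,3)]])
  fix n
  define m where "m = max (norm (x n)) (norm (y n))"
  have "norm (x n + y n) \<le> 2 * m"
    using norm_triangle_ineq[of "x n" "y n"] by (simp add: m_def)
  then have "norm (x n + y n) powr p \<le> (2 * m) powr p"
    using assms(1) by (intro powr_mono2) auto
  also have "\<dots> = 2 powr p * m powr p"
    by (simp add: powr_mult m_def)
  also have "\<dots> \<le> 2 powr p * (norm (x n) powr p + norm (y n) powr p)"
    by (intro mult_left_mono) (auto simp: m_def max_def)
  finally show "norm (norm (x n + y n) powr p) \<le> 2 powr p * (norm (x n) powr p + norm (y n) powr p)"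
    by simp
qed

lemma lp_vnorm_powr:
  fixes x :: "nat \<Rightarrow> 'k::{real_normed_field, euclidean_space}"
  assumes "p > 0" "x \<in> carrier (lp p)"
  shows "vnorm (lp p) x powr p = (\<Sum>n. norm (x n) powr p)"
proof -
  have "(\<Sum>n. norm (x n) powr p) \<ge> 0"
    using assms by (intro suminf_nonneg) auto
  then show ?thesis
    using assms(1) by (simp add: powr_powr)
qed

lemma lp_vnorm_le_iff:
  fixes x :: "nat \<Rightarrow> 'k::{real_normed_field, euclidean_space}"
  assumes "p > 0" "x \<in> carrier (lp p)" "C \<ge> 0"
  shows "vnorm (lp p) x \<le> C \<longleftrightarrow> (\<Sum>n. norm (x n) powr p) \<le> C powr p"
proof -
  have "vnorm (lp p) x \<ge> 0" by simp
  then have "vnorm (lp p) x \<le> C \<longleftrightarrow> vnorm (lp p) x powr p \<le> C powr p"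
    using powr_mono2[of p "vnorm (lp p) x" C] powr_less_mono2[OF assms(1,3), of "vnorm (lp p) x"] assms(1)
    by (meson less_imp_le not_le)
  then show ?thesis by (simp only: lp_vnorm_powr[OF assms(1,2)])
qed

text \<open>Minkowski's inequality from convexity of the p-th power: x / A and y / B are averaged
  with weight A / (A + B). The margin \<epsilon>/2 keeps A and B positive, so zero vectors are no
  exception.\<close>

lemma lp_triangle:
  fixes x y :: "nat \<Rightarrow> 'k::{real_normed_field, euclidean_space}"
  assumes p: "p \<ge> 1" and x: "x \<in> carrier (lp p)" and y: "y \<in> carrier (lp p)"
  shows "vnorm (lp p) (\<lambda>n. x n + y n) \<le> vnorm (lp p) x + vnorm (lp p) y"
proof (rule field_le_epsilon)
  fix \<epsilon> :: real assume "\<epsilon> > 0"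
  define A B where "A = vnorm (lp p) x + \<epsilon> / 2" and "B = vnorm (lp p) y + \<epsilon> / 2"
  have "vnorm (lp p) x \<ge> 0" "vnorm (lp p) y \<ge> 0" by simp_all
  then have AB: "A > 0" "B > 0" "vnorm (lp p) x \<le> A" "vnorm (lp p) y \<le> B"
    using \<open>\<epsilon> > 0\<close> unfolding A_def B_def by linarith+
  have sums: "(\<Sum>n. norm (x n) powr p) \<le> A powr p" "(\<Sum>n. norm (y n) powr p) \<le> B powr p"
    using AB lp_vnorm_le_iff[OF _ x, of A] lp_vnorm_le_iff[OF _ y, of B] p by simp_all
  have summable: "summable (\<lambda>n. norm (x n) powr p)" "summable (\<lambda>n. norm (y n) powr p)"
    using x y by simp_all
  define u where "u = A / (A + B)"
  have u: "0 < u" "u < 1" "1 - u = B / (A + B)" using AB by (auto simp: u_def field_simps)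
  have pointwise: "norm (x n + y n) powr p \<le>
      (A + B) powr p * (u / A powr p * norm (x n) powr p + (1 - u) / B powr p * norm (y n) powr p)" for n
  proof -
    have "norm (x n + y n) \<le> norm (x n) + norm (y n)" by (rule norm_triangle_ineq)
    also have "\<dots> = (A + B) * (u * (norm (x n) / A) + (1 - u) * (norm (y n) / B))"
    proof -
      have "u * (norm (x n) / A) = norm (x n) / (A + B)" "(1 - u) * (norm (y n) / B) = norm (y n) / (A + B)"
        unfolding u(3) using AB by (simp_all add: u_def)
      then show ?thesis
        using AB by (simp only: add_divide_distrib[symmetric]) simp
    qed
    finally have "norm (x n + y n) powr p \<le>
        ((A + B) * (u * (norm (x n) / A) + (1 - u) * (norm (y n) / B))) powr p"
      using p by (intro powr_mono2) auto
    also have "\<dots> = (A + B) powr p * (u * (norm (x n) / A) + (1 - u) * (norm (y n) / B)) powr p"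
      using AB u by (intro powr_mult)
    also have "\<dots> \<le> (A + B) powr p * (u * (norm (x n) / A) powr p + (1 - u) * (norm (y n) / B) powr p)"
      using AB u p by (intro mult_left_mono convex_powr_le) auto
    finally show ?thesis
      using AB by (simp add: powr_divide)
  qed
  have "(\<Sum>n. norm (x n + y n) powr p) \<le>
      (\<Sum>n. (A + B) powr p * (u / A powr p * norm (x n) powr p + (1 - u) / B powr p * norm (y n) powr p))"
    using pointwise lp_add_closed[of p x y] summable p
    by (intro suminf_le summable_mult summable_add) auto
  also have "\<dots> = (A + B) powr p *
      (u / A powr p * (\<Sum>n. norm (x n) powr p) + (1 - u) / B powr p * (\<Sum>n. norm (y n) powr p))"
    using summable
    by (simp only: suminf_mult summable_mult summable_add suminf_add[symmetric])
  also have "\<dots> \<le> (A + B) powr p * (u / A powr p * A powr p + (1 - u) / B powr p * B powr p)"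
    using u sums by (intro mult_left_mono add_mono divide_nonneg_nonneg) simp_all
  also have "\<dots> = (A + B) powr p" using AB by simp
  finally have "vnorm (lp p) (\<lambda>n. x n + y n) \<le> A + B"
    using lp_vnorm_le_iff[of p "\<lambda>n. x n + y n" "A + B"] lp_add_closed[of p x y] summable p AB by simp
  then show "vnorm (lp p) (\<lambda>n. x n + y n) \<le> vnorm (lp p) x + vnorm (lp p) y + \<epsilon>"
    by (simp add: A_def B_def)
qed

lemma seminormed_lp:
  assumes p: "p \<ge> 1"
  shows "seminormed_nspace (lp p :: ('k::{real_normed_field, euclidean_space}, _) nspace)"
proof
  fix c d :: 'k and x y :: "nat \<Rightarrow> 'k"
  let ?E = "lp p :: ('k, _) nspace"
  show "vscale ?E c (x + y) = vscale ?E c x + vscale ?E c y"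
    "vscale ?E (c + d) x = vscale ?E c x + vscale ?E d x"
    "vscale ?E c (vscale ?E d x) = vscale ?E (c * d) x" "vscale ?E 1 x = x"
    by (simp_all add: fun_eq_iff algebra_simps)
  show "vadd ?E = (+)" "vzero ?E = 0"
    by (simp_all add: lp_def fun_eq_iff)
  show "0 \<in> carrier ?E" using p by simp
  assume x: "x \<in> carrier ?E"
  then have sum: "summable (\<lambda>n. norm c powr p * norm (x n) powr p)"
    by (intro summable_mult) simp
  then show "vscale ?E c x \<in> carrier ?E"
    by (simp add: norm_mult powr_mult)
  have "(\<Sum>n. norm (c * x n) powr p) = norm c powr p * (\<Sum>n. norm (x n) powr p)"
    using x by (simp add: norm_mult powr_mult suminf_mult)
  moreover have "(\<Sum>n. norm (x n) powr p) \<ge> 0"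
    using x by (intro suminf_nonneg) auto
  ultimately show "vnorm ?E (vscale ?E c x) = norm c * vnorm ?E x"
    using p by (simp add: powr_mult powr_powr)
  assume y: "y \<in> carrier ?E"
  show "x + y \<in> carrier ?E"
    using lp_add_closed[of p x y] x y p by simp
  show "vnorm ?E (x + y) \<le> vnorm ?E x + vnorm ?E y"
    using lp_triangle[OF p x y] by (simp only: plus_fun_def)
qed

section \<open>Unit vectors and bounded forms on sequence spaces\<close>

definition unit_seq :: "nat \<Rightarrow> nat \<Rightarrow> 'k::real_normed_field" where
  "unit_seq k = (\<lambda>n. if n = k then 1 else 0)"

lemma lp_finite_support:
  fixes x :: "nat \<Rightarrow> 'k::{real_normed_field, euclidean_space}"
  assumes "finite J" "\<And>n. n \<notin> J \<Longrightarrow> x n = 0"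
  shows "x \<in> carrier (lp p)" "vnorm (lp p) x = (\<Sum>n\<in>J. norm (x n) powr p) powr (1 / p)"
proof -
  show "x \<in> carrier (lp p)"
    using assms by (auto intro: summable_finite)
  have "(\<Sum>n. norm (x n) powr p) = (\<Sum>n\<in>J. norm (x n) powr p)"
    using assms by (intro suminf_finite) auto
  then show "vnorm (lp p) x = (\<Sum>n\<in>J. norm (x n) powr p) powr (1 / p)" by simp
qed

lemma unit_seq_closed: "unit_seq k \<in> carrier (lp p :: ('k::{real_normed_field, euclidean_space}, _) nspace)"
  by (rule lp_finite_support(1)[of "{k}"]) (auto simp: unit_seq_def)

lemma sum_unit_seq:
  assumes "finite J"
  shows "(\<Sum>k\<in>J. vscale (lp p) (c k) (unit_seq k)) = (\<lambda>n. if n \<in> J then c n else 0)"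
proof
  fix n
  have "(\<Sum>k\<in>J. vscale (lp p) (c k) (unit_seq k)) n = (\<Sum>k\<in>J. if k = n then c k else 0)"
    by (induction J rule: infinite_finite_induct) (auto simp: unit_seq_def)
  also have "\<dots> = (if n \<in> J then c n else 0)"
    using assms by simp
  finally show "(\<Sum>k\<in>J. vscale (lp p) (c k) (unit_seq k)) n = (if n \<in> J then c n else 0)" .
qed

lemma lp_partial_sum_le:
  fixes x :: "nat \<Rightarrow> 'k::{real_normed_field, euclidean_space}"
  assumes "p > 0" "x \<in> carrier (lp p)" "finite J"
  shows "(\<Sum>n\<in>J. norm (x n) powr p) \<le> vnorm (lp p) x powr p"
  using assms unfolding lp_vnorm_powr[OF assms(1,2)] by (intro sum_le_suminf) auto

text \<open>Testing f on the finitely supported x with coefficients \<open>c k\<close> gives f x =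
  S, while x has norm S^(1/p). Hence S \<le> C * S^(1/p), and division leaves S^(1/r) \<le>
  C.\<close>

lemma lp_form_sum_le:
  fixes f :: "(nat \<Rightarrow> 'k::{real_normed_field, euclidean_space}) \<Rightarrow> 'k"
  assumes p: "p > 1" and C: "C \<ge> 0" and f: "f \<in> bounded_forms (lp p) C" and J: "finite J"
  shows "(\<Sum>k\<in>J. norm (f (unit_seq k)) powr conj_exp p) \<le> C powr conj_exp p"
proof -
  interpret lp: seminormed_nspace "lp p :: ('k, _) nspace"
    using p by (intro seminormed_lp) simp
  define r where "r = conj_exp p"
  have r: "r > 1" "(r - 1) * p = r" "1 - 1 / p = 1 / r"
    using p by (simp_all add: r_def conj_exp_def field_simps)
  have lin: "linear_form (lp p) f" and bd: "\<And>x. x \<in> carrier (lp p) \<Longrightarrow> norm (f x) \<le> C * vnorm (lp p) x"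
    using f unfolding bounded_forms_def by blast+
  define a where "a = (\<lambda>k. f (unit_seq k))"
  define S where "S = (\<Sum>k\<in>J. norm (a k) powr r)"
  have S: "S \<ge> 0" by (auto simp: S_def intro: sum_nonneg)
  \<comment> \<open>Extremal for Hoelder's inequality: c k times a k is the r-th power of norm (a
    k). Where a k = 0 the quotient is 0 by convention, which is the required value.\<close>
  define c where "c = (\<lambda>k. of_real (norm (a k) powr r) / a k)"
  have norm_c: "norm (c k) powr p = norm (a k) powr r" for k
  proof (cases "a k = 0")
    case False
    then have "norm (c k) = norm (a k) powr (r - 1)"
      by (simp add: c_def norm_divide powr_diff)
    then show ?thesis using r by (simp add: powr_powr)
  qed (use p r in \<open>simp add: c_def\<close>)
  define x where "x = (\<Sum>k\<in>J. vscale (lp p) (c k) (unit_seq k :: nat \<Rightarrow> 'k))"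
  have x_eq: "x = (\<lambda>n. if n \<in> J then c n else 0)"
    unfolding x_def by (rule sum_unit_seq[OF J])
  have x: "x \<in> carrier (lp p)"
    unfolding x_def by (intro lp.sum_closed lp.scale_closed unit_seq_closed)
  have "vnorm (lp p) x = S powr (1 / p)"
    by (subst lp_finite_support(2)[OF J]) (auto simp: x_eq S_def norm_c intro!: arg_cong[of _ _ "\<lambda>t. t powr (1 / p)"] sum.cong)
  moreover have "f x = of_real S"
  proof -
    have "f x = (\<Sum>k\<in>J. c k * a k)"
      unfolding x_def a_def by (rule lp.linear_form_sum_scale[OF lin unit_seq_closed])
    also have "\<dots> = (\<Sum>k\<in>J. of_real (norm (a k) powr r))"
      using r by (intro sum.cong) (auto simp: c_def)
    finally show ?thesis by (simp add: S_def)
  qed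
  ultimately have "S \<le> C * S powr (1 / p)"
    using bd[OF x] S by simp
  show ?thesis
  proof (cases "S = 0")
    case False
    then have "S powr (1 / p) > 0" "S > 0" using S by auto
    have "S powr (1 / r) = S / S powr (1 / p)"
      using \<open>S > 0\<close> by (simp add: powr_diff flip: r(3))
    also have "\<dots> \<le> C"
      using \<open>S \<le> C * S powr (1 / p)\<close> \<open>S powr (1 / p) > 0\<close> by (simp add: field_simps)
    finally have "(S powr (1 / r)) powr r \<le> C powr r"
      using r by (intro powr_mono2) auto
    then show ?thesis
      using r S by (simp add: powr_powr S_def a_def r_def)
  qed (simp add: S_def a_def r_def)
qed

text \<open>The values at the unit vectors are summable to the finite power
  \<open>conj_exp p\<close>, hence null. This weak nullity is what the gliding hump feeds
  on.\<close>

lemma lp_form_tendsto_0: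
  fixes f :: "(nat \<Rightarrow> 'k::{real_normed_field, euclidean_space}) \<Rightarrow> 'k"
  assumes p: "p > 1" and f: "f \<in> bounded_forms (lp p) C"
  shows "(\<lambda>k. f (unit_seq k)) \<longlonglongrightarrow> 0"
proof -
  have r: "conj_exp p > 0" using p by (simp add: conj_exp_def)
  have "\<bar>C\<bar> * vnorm (lp p) x \<ge> C * vnorm (lp p) x" for x :: "nat \<Rightarrow> 'k"
    by (intro mult_right_mono) auto
  then have f': "f \<in> bounded_forms (lp p) \<bar>C\<bar>"
    using f unfolding bounded_forms_def by (blast intro: order_trans)
  have "summable (\<lambda>k. norm (f (unit_seq k)) powr conj_exp p)"
    using lp_form_sum_le[OF p _ f'] by (intro bounded_imp_summable[where B = "\<bar>C\<bar> powr conj_exp p"]) auto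
  then have "(\<lambda>k. norm (f (unit_seq k)) powr conj_exp p) \<longlonglongrightarrow> 0"
    by (rule summable_LIMSEQ_zero)
  then have "(\<lambda>k. (norm (f (unit_seq k)) powr conj_exp p) powr (1 / conj_exp p)) \<longlonglongrightarrow> 0 powr (1 / conj_exp p)"
    using r by (intro tendsto_powr2[where b = "1 / conj_exp p"]) auto
  then have "(\<lambda>k. norm (f (unit_seq k))) \<longlonglongrightarrow> 0"
    using r by (simp add: powr_powr)
  then show ?thesis by (rule tendsto_norm_zero_cancel)
qed

text \<open>Hoelder's inequality against an indicator, derived from Young's inequality after
  scaling. It bounds the form that adds up the coordinates in J.\<close>

lemma sum_norm_le_lp:
  fixes x :: "nat \<Rightarrow> 'k::{real_normed_field, euclidean_space}"
  assumes p: "p > 1" and x: "x \<in> carrier (lp p)" and J: "finite J"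
  shows "(\<Sum>k\<in>J. norm (x k)) \<le> real (card J) powr (1 / conj_exp p) * vnorm (lp p) x"
proof -
  define r where "r = conj_exp p"
  have r: "r > 1" "1 / p + 1 / r = 1"
    using p by (simp_all add: r_def conj_exp_def field_simps)
  define V where "V = vnorm (lp p) x"
  define N where "N = real (card J)"
  have partial: "(\<Sum>k\<in>J. norm (x k) powr p) \<le> V powr p"
    unfolding V_def using p by (intro lp_partial_sum_le x J) simp
  have V: "V \<ge> 0" by (simp add: V_def)
  consider "J = {}" | "V = 0" | "V > 0" "N > 0"
  proof -
    have "V = 0 \<or> V > 0" "J = {} \<or> N > 0"
      using V J by (auto simp: N_def card_gt_0_iff)
    then show thesis using that by blast
  qed
  then have "(\<Sum>k\<in>J. norm (x k)) \<le> N powr (1 / r) * V"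
  proof cases
    case 1
    then show ?thesis using V by simp
  next
    case 2
    have "norm (x k) = 0" if "k \<in> J" for k
    proof -
      have "norm (x k) powr p \<le> (\<Sum>k\<in>J. norm (x k) powr p)"
        using that J by (intro member_le_sum) auto
      moreover have "V powr p = 0" using 2 by simp
      ultimately have "norm (x k) powr p \<le> 0" using partial by linarith
      then show ?thesis by (metis powr_gt_zero not_le)
    qed
    then show ?thesis using 2 by simp
  next
    case 3
    \<comment> \<open>The common modulus of the coordinates in the case of equality; at this scale
      the summed Young bound is N / p + N / r = N.\<close>
    define t where "t = V / N powr (1 / p)"
    have t: "t > 0" using 3 by (simp add: t_def)
    have "norm (x k) / t \<le> (norm (x k) / t) powr p / p + 1 / r" for k
      using Youngs_inequality[of p r "norm (x k) / t" 1] p r t by simp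
    then have "(\<Sum>k\<in>J. norm (x k) / t) \<le> (\<Sum>k\<in>J. (norm (x k) / t) powr p / p + 1 / r)"
      by (rule sum_mono)
    also have "\<dots> = (\<Sum>k\<in>J. norm (x k) powr p) / t powr p / p + N / r"
      using t by (simp add: sum.distrib powr_divide sum_divide_distrib N_def)
    also have "\<dots> \<le> V powr p / t powr p / p + N / r"
      using partial p t r by (intro add_mono divide_right_mono) auto
    also have "V powr p / t powr p = N"
      using 3 p by (simp add: t_def powr_divide powr_powr)
    also have "N / p + N / r = N"
      using r(2) by (metis distrib_left mult.right_neutral times_divide_eq_right)
    finally have "(\<Sum>k\<in>J. norm (x k)) \<le> N * t"
      using t by (simp add: sum_divide_distrib[symmetric] field_simps)
    also have "N * t = N powr (1 - 1 / p) * V"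
      using 3 by (simp add: t_def powr_diff)
    also have "1 - 1 / p = 1 / r"
      using r by simp
    finally show ?thesis .
  qed
  then show ?thesis by (simp only: V_def N_def r_def)
qed


subsection \<open>Injective and projective norms\<close>

text \<open>The injective norm is a supremum over dual unit balls; this turns them into inequalities
  for all vectors. Vectors of seminorm 0 cannot be normalised, but there a form of the dual
  vanishes.\<close>

lemma (in seminormed_nspace) bounded_forms_iff_dual_norm:
  "f \<in> dual E \<and> dual_norm E f \<le> 1 \<longleftrightarrow> f \<in> bounded_forms E 1"
proof
  assume f: "f \<in> dual E \<and> dual_norm E f \<le> 1"
  then have lin: "linear_form E f" by (simp add: dual_def)
  obtain C where C: "\<And>x. x \<in> carrier E \<Longrightarrow> norm (f x) \<le> C * vnorm E x"
    using f by (auto simp: dual_def)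
  have bdd: "bdd_above ((\<lambda>x. norm (f x)) ` {x \<in> carrier E. vnorm E x \<le> 1})"
  proof (rule bdd_aboveI2)
    fix x assume x: "x \<in> {x \<in> carrier E. vnorm E x \<le> 1}"
    then have "norm (f x) \<le> C * vnorm E x" using C by simp
    also have "\<dots> \<le> \<bar>C\<bar> * 1"
      using x vnorm_nonneg[of x] by (intro mult_mono) auto
    finally show "norm (f x) \<le> \<bar>C\<bar>" by simp
  qed
  have "norm (f x) \<le> vnorm E x" if x: "x \<in> carrier E" for x
  proof (cases "vnorm E x = 0")
    case True
    then show ?thesis using C[OF x] by simp
  next
    case False
    then have pos: "vnorm E x > 0" using vnorm_nonneg[OF x] by simp
    define z where "z = vscale E (of_real (1 / vnorm E x)) x"
    have z: "z \<in> {x \<in> carrier E. vnorm E x \<le> 1}"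
      using x pos by (simp add: z_def scale_closed vnorm_scale norm_divide)
    have "norm (f z) \<le> dual_norm E f"
      unfolding dual_norm_def by (rule cSUP_upper[OF z bdd])
    then have "norm (f z) \<le> 1" using f by simp
    moreover have "f z = of_real (1 / vnorm E x) * f x"
      using lin x by (simp add: z_def linear_form_def)
    ultimately show ?thesis
      using pos by (simp add: norm_mult norm_divide field_simps)
  qed
  then show "f \<in> bounded_forms E 1"
    using lin by (simp add: bounded_forms_def)
next
  assume f: "f \<in> bounded_forms E 1"
  have "f \<in> dual E"
    using f unfolding bounded_forms_def dual_def by blast
  moreover have "dual_norm E f \<le> 1"
    unfolding dual_norm_def
  proof (rule cSUP_least)
    show "{x \<in> carrier E. vnorm E x \<le> 1} \<noteq> {}"
      using zero_closed vnorm_zero by auto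
    fix x assume "x \<in> {x \<in> carrier E. vnorm E x \<le> 1}"
    then show "norm (f x) \<le> 1"
      using f by (auto simp: bounded_forms_def intro: order_trans)
  qed
  ultimately show "f \<in> dual E \<and> dual_norm E f \<le> 1" by simp
qed

section \<open>Injective and projective seminorms on the algebraic tensor product\<close>

locale seminormed_pair = E: seminormed_nspace E + F: seminormed_nspace F
  for E :: "('k::{real_normed_field, euclidean_space}, 'v::ab_group_add) nspace"
    and F :: "('k, 'w::ab_group_add) nspace"
begin

definition tensors :: "(('v \<Rightarrow> 'w \<Rightarrow> 'k) \<Rightarrow> 'k) set" where
  "tensors = {tensor E F xs |xs. set xs \<subseteq> carrier E \<times> carrier F}"

definition cost :: "('v \<times> 'w) list \<Rightarrow> real" where
  "cost xs = (\<Sum>(x, y)\<leftarrow>xs. vnorm E x * vnorm F y)"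

lemma tensorsE:
  assumes "u \<in> tensors"
  obtains xs where "set xs \<subseteq> carrier E \<times> carrier F" "u = tensor E F xs"
  using assms by (auto simp: tensors_def)

lemma tensorsI: "set xs \<subseteq> carrier E \<times> carrier F \<Longrightarrow> tensor E F xs \<in> tensors"
  by (auto simp: tensors_def)

lemma tensor_append: "tensor E F (xs @ ys) = tensor E F xs + tensor E F ys"
  by (simp add: tensor_def fun_eq_iff)

lemma tensor_Nil: "tensor E F [] = 0"
  by (simp add: tensor_def fun_eq_iff)

lemma bilinear_left:
  assumes "bilinear_form E F \<beta>" "y \<in> carrier F"
  shows "linear_form E (\<lambda>x. \<beta> x y)"
  using assms by (simp add: bilinear_form_def)

lemma bilinear_right:
  assumes "bilinear_form E F \<beta>" "x \<in> carrier E"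
  shows "linear_form F (\<beta> x)"
  using assms by (simp add: bilinear_form_def)

lemma tensor_scale:
  assumes "set xs \<subseteq> carrier E \<times> carrier F"
  shows "tensor E F (map (\<lambda>(x, y). (vscale E c x, y)) xs) = (\<lambda>\<beta>. c * tensor E F xs \<beta>)"
proof
  fix \<beta>
  show "tensor E F (map (\<lambda>(x, y). (vscale E c x, y)) xs) \<beta> = c * tensor E F xs \<beta>"
  proof (cases "bilinear_form E F \<beta>")
    case True
    then have "\<beta> (vscale E c x) y = c * \<beta> x y" if "x \<in> carrier E" "y \<in> carrier F" for x y
      using bilinear_left[OF True that(2)] that by (simp add: linear_form_def)
    then have "(\<Sum>(x, y)\<leftarrow>map (\<lambda>(x, y). (vscale E c x, y)) xs. \<beta> x y) = c * (\<Sum>(x, y)\<leftarrow>xs. \<beta> x y)"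
      using assms by (induction xs) (auto simp: distrib_left)
    then show ?thesis using True by (simp add: tensor_def)
  qed (simp add: tensor_def)
qed

lemma cost_scale:
  assumes "set xs \<subseteq> carrier E \<times> carrier F"
  shows "cost (map (\<lambda>(x, y). (vscale E c x, y)) xs) = norm c * cost xs"
  using assms by (induction xs) (auto simp: cost_def E.vnorm_scale distrib_left)

lemma cost_append: "cost (xs @ ys) = cost xs + cost ys"
  by (simp add: cost_def)

lemma cost_nonneg: "set xs \<subseteq> carrier E \<times> carrier F \<Longrightarrow> cost xs \<ge> 0"
  by (induction xs) (auto simp: cost_def E.vnorm_nonneg F.vnorm_nonneg)

lemma zero_tensors: "0 \<in> tensors"
  using tensorsI[of "[]"] by (simp add: tensor_Nil)

lemma add_tensors: "u \<in> tensors \<Longrightarrow> v \<in> tensors \<Longrightarrow> u + v \<in> tensors"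
  by (elim tensorsE) (auto simp: tensor_append[symmetric] intro!: tensorsI)

lemma scale_tensors: "u \<in> tensors \<Longrightarrow> (\<lambda>\<beta>. c * u \<beta>) \<in> tensors"
  by (elim tensorsE) (force simp: tensor_scale[symmetric] intro!: tensorsI E.scale_closed)

lemma carrier_tensor_space: "carrier (tensor_space E F N) = tensors"
  by (simp add: tensor_space_def tensors_def)

lemma seminormed_tensor_space:
  assumes triangle: "\<And>u v. u \<in> tensors \<Longrightarrow> v \<in> tensors \<Longrightarrow> N (u + v) \<le> N u + N v"
    and scale: "\<And>u c. u \<in> tensors \<Longrightarrow> N (\<lambda>\<beta>. c * u \<beta>) = norm c * N u"
  shows "seminormed_nspace (tensor_space E F N)"
proof
  fix c d :: 'k and u v :: "('v \<Rightarrow> 'w \<Rightarrow> 'k) \<Rightarrow> 'k"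
  let ?T = "tensor_space E F N"
  show "vscale ?T c (u + v) = vscale ?T c u + vscale ?T c v"
    "vscale ?T (c + d) u = vscale ?T c u + vscale ?T d u"
    "vscale ?T c (vscale ?T d u) = vscale ?T (c * d) u" "vscale ?T 1 u = u"
    by (simp_all add: tensor_space_def fun_eq_iff algebra_simps)
  show "vadd ?T = (+)" "vzero ?T = 0"
    by (simp_all add: tensor_space_def fun_eq_iff)
  show "0 \<in> carrier ?T"
    using zero_tensors by (simp add: tensor_space_def tensors_def)
  assume u: "u \<in> carrier ?T"
  then have u': "u \<in> tensors" by (simp add: tensor_space_def tensors_def)
  show "vscale ?T c u \<in> carrier ?T"
    using scale_tensors[OF u'] by (simp add: tensor_space_def tensors_def)
  show "vnorm ?T (vscale ?T c u) = norm c * vnorm ?T u"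
    using scale[OF u'] by (simp add: tensor_space_def)
  assume v: "v \<in> carrier ?T"
  then have v': "v \<in> tensors" by (simp add: tensor_space_def tensors_def)
  show "u + v \<in> carrier ?T"
    using add_tensors[OF u' v'] by (simp add: tensor_space_def tensors_def)
  show "vnorm ?T (u + v) \<le> vnorm ?T u + vnorm ?T v"
    using triangle[OF u' v'] by (simp add: tensor_space_def)
qed

text \<open>A bound on elementary tensors extends to every representing list, with
  \<open>cost\<close> in place of the product of norms. Both tensor norms are controlled through
  this.\<close>

lemma tensor_apply_le:
  assumes "set xs \<subseteq> carrier E \<times> carrier F" "bilinear_form E F \<beta>"
    and "\<And>x y. x \<in> carrier E \<Longrightarrow> y \<in> carrier F \<Longrightarrow> norm (\<beta> x y) \<le> K * vnorm E x * vnorm F y"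
  shows "norm (tensor E F xs \<beta>) \<le> K * cost xs"
proof -
  have "norm (\<Sum>(x, y)\<leftarrow>xs. \<beta> x y) \<le> K * cost xs"
    using assms(1)
  proof (induction xs)
    case (Cons a xs)
    obtain x y where a: "a = (x, y)" by (cases a)
    have "norm (\<beta> x y) \<le> K * vnorm E x * vnorm F y" using Cons.prems a assms(3) by auto
    then show ?case
      using Cons norm_triangle_ineq[of "\<beta> x y" "\<Sum>(x, y)\<leftarrow>xs. \<beta> x y"]
      by (simp add: a cost_def distrib_left)
  qed (simp add: cost_def)
  then show ?thesis using assms(2) by (simp add: tensor_def)
qed

lemma bilinear_form_product:
  assumes "linear_form E f" "linear_form F g"
  shows "bilinear_form E F (\<lambda>x y. f x * g y)"
  using assms by (auto simp: bilinear_form_def linear_form_def algebra_simps)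

lemma inj_norm_eq:
  "inj_norm E F u = (SUP (f, g)\<in>bounded_forms E 1 \<times> bounded_forms F 1. norm (u (\<lambda>x y. f x * g y)))"
  unfolding inj_norm_def E.bounded_forms_iff_dual_norm F.bounded_forms_iff_dual_norm by simp

lemma zero_bounded_forms: "(\<lambda>_. 0) \<in> bounded_forms E 1" "(\<lambda>_. 0) \<in> bounded_forms F 1"
  using E.vnorm_nonneg F.vnorm_nonneg by (simp_all add: bounded_forms_def linear_form_def)

lemma inj_norm_le:
  assumes "\<And>f g. f \<in> bounded_forms E 1 \<Longrightarrow> g \<in> bounded_forms F 1 \<Longrightarrow> norm (u (\<lambda>x y. f x * g y)) \<le> C"
  shows "inj_norm E F u \<le> C"
  unfolding inj_norm_eq using assms zero_bounded_forms by (intro cSUP_least) auto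

lemma product_form_le_cost:
  assumes xs: "set xs \<subseteq> carrier E \<times> carrier F"
    and f: "f \<in> bounded_forms E 1" and g: "g \<in> bounded_forms F 1"
  shows "norm (tensor E F xs (\<lambda>x y. f x * g y)) \<le> cost xs"
proof -
  have "norm (f x * g y) \<le> 1 * vnorm E x * vnorm F y" if "x \<in> carrier E" "y \<in> carrier F" for x y
    using f g that unfolding norm_mult bounded_forms_def by (intro mult_mono) (auto simp: E.vnorm_nonneg)
  then have "norm (tensor E F xs (\<lambda>x y. f x * g y)) \<le> 1 * cost xs"
    using f g by (intro tensor_apply_le xs bilinear_form_product) (auto simp: bounded_forms_def)
  then show ?thesis by simp
qed

text \<open>The supremum is taken over a bounded set: the cost of any representation of u is an
  upper bound.\<close>

lemma inj_norm_ge: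
  assumes u: "u \<in> tensors" and f: "f \<in> bounded_forms E 1" and g: "g \<in> bounded_forms F 1"
  shows "norm (u (\<lambda>x y. f x * g y)) \<le> inj_norm E F u"
proof -
  obtain xs where xs: "set xs \<subseteq> carrier E \<times> carrier F" "u = tensor E F xs"
    using u by (rule tensorsE)
  have "bdd_above ((\<lambda>(f, g). norm (u (\<lambda>x y. f x * g y))) ` (bounded_forms E 1 \<times> bounded_forms F 1))"
    using product_form_le_cost[OF xs(1)] by (intro bdd_aboveI2[where M = "cost xs"]) (auto simp: xs(2))
  then show ?thesis
    unfolding inj_norm_eq
    using cSUP_upper[of "(f, g)" "bounded_forms E 1 \<times> bounded_forms F 1" "\<lambda>(f, g). norm (u (\<lambda>x y. f x * g y))"] f g
    by simp
qed

lemma seminormed_inj: "seminormed_nspace (tensor_space E F (inj_norm E F))"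
proof (rule seminormed_tensor_space)
  fix u v assume u: "u \<in> tensors" and v: "v \<in> tensors"
  show "inj_norm E F (u + v) \<le> inj_norm E F u + inj_norm E F v"
    using inj_norm_ge[OF u] inj_norm_ge[OF v]
    by (intro inj_norm_le) (auto intro!: order_trans[OF norm_triangle_ineq] add_mono)
next
  fix u c assume u: "u \<in> tensors"
  have le: "inj_norm E F (\<lambda>\<beta>. c * u \<beta>) \<le> norm c * inj_norm E F u" if "u \<in> tensors" for c u
    using inj_norm_ge[OF that] by (intro inj_norm_le) (auto simp: norm_mult intro!: mult_left_mono)
  show "inj_norm E F (\<lambda>\<beta>. c * u \<beta>) = norm c * inj_norm E F u"
  proof (rule antisym[OF le[OF u]])
    show "norm c * inj_norm E F u \<le> inj_norm E F (\<lambda>\<beta>. c * u \<beta>)"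
    proof (cases "c = 0")
      case True
      have "0 \<le> inj_norm E F (\<lambda>\<beta>. c * u \<beta>)"
        using order_trans[OF norm_ge_zero inj_norm_ge[OF scale_tensors[OF u] zero_bounded_forms]] .
      then show ?thesis using True by simp
    next
      case False
      then have "u = (\<lambda>\<beta>. inverse c * (c * u \<beta>))"
        by (simp add: fun_eq_iff)
      then have "inj_norm E F u \<le> norm (inverse c) * inj_norm E F (\<lambda>\<beta>. c * u \<beta>)"
        using le[OF scale_tensors[OF u], of "inverse c" c] by simp
      then show ?thesis using False by (simp add: norm_inverse norm_divide field_simps)
    qed
  qed
qed

lemma inj_cross_norm:
  "\<forall>x\<in>carrier E. \<forall>y\<in>carrier F. inj_norm E F (tensor E F [(x, y)]) \<le> vnorm E x * vnorm F y"
proof (intro ballI inj_norm_le)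
  fix x y f g
  assume "x \<in> carrier E" "y \<in> carrier F" "f \<in> bounded_forms E 1" "g \<in> bounded_forms F 1"
  then show "norm (tensor E F [(x, y)] (\<lambda>x y. f x * g y)) \<le> vnorm E x * vnorm F y"
    using product_form_le_cost[of "[(x, y)]" f g] by (simp add: cost_def)
qed

lemma proj_norm_eq:
  "proj_norm E F u = Inf (cost ` {xs. set xs \<subseteq> carrier E \<times> carrier F \<and> u = tensor E F xs})"
  unfolding proj_norm_def cost_def by (rule arg_cong[of _ _ Inf]) auto

lemma proj_norm_le:
  assumes "set xs \<subseteq> carrier E \<times> carrier F"
  shows "proj_norm E F (tensor E F xs) \<le> cost xs"
  unfolding proj_norm_eq using assms cost_nonneg
  by (intro cINF_lower bdd_belowI2[where m = 0]) auto

lemma proj_norm_ge: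
  assumes "u \<in> tensors"
    and "\<And>xs. set xs \<subseteq> carrier E \<times> carrier F \<Longrightarrow> u = tensor E F xs \<Longrightarrow> C \<le> cost xs"
  shows "C \<le> proj_norm E F u"
  unfolding proj_norm_eq using assms by (intro cINF_greatest) (auto elim: tensorsE)

lemma seminormed_proj: "seminormed_nspace (tensor_space E F (proj_norm E F))"
proof (rule seminormed_tensor_space)
  fix u v assume u: "u \<in> tensors" and v: "v \<in> tensors"
  have "proj_norm E F (u + v) - proj_norm E F v \<le> proj_norm E F u"
  proof (rule proj_norm_ge[OF u])
    fix xs assume xs: "set xs \<subseteq> carrier E \<times> carrier F" "u = tensor E F xs"
    have "proj_norm E F (u + v) - cost xs \<le> proj_norm E F v"
    proof (rule proj_norm_ge[OF v])
      fix ys assume ys: "set ys \<subseteq> carrier E \<times> carrier F" "v = tensor E F ys"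
      have "proj_norm E F (u + v) \<le> cost xs + cost ys"
        using proj_norm_le[of "xs @ ys"] xs ys by (simp add: tensor_append cost_append)
      then show "proj_norm E F (u + v) - cost xs \<le> cost ys" by simp
    qed
    then show "proj_norm E F (u + v) - proj_norm E F v \<le> cost xs" by simp
  qed
  then show "proj_norm E F (u + v) \<le> proj_norm E F u + proj_norm E F v" by simp
next
  fix u c assume u: "u \<in> tensors"
  have le: "proj_norm E F (\<lambda>\<beta>. c * u \<beta>) \<le> norm c * cost xs"
    if "set xs \<subseteq> carrier E \<times> carrier F" "u = tensor E F xs" for c u xs
  proof -
    have "set (map (\<lambda>(x, y). (vscale E c x, y)) xs) \<subseteq> carrier E \<times> carrier F"
      using that by (auto simp: E.scale_closed)
    from proj_norm_le[OF this] show ?thesis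
      unfolding tensor_scale[OF that(1)] cost_scale[OF that(1)] that(2) .
  qed
  have nonneg: "0 \<le> proj_norm E F u" if "u \<in> tensors" for u
    by (rule proj_norm_ge[OF that cost_nonneg])
  show "proj_norm E F (\<lambda>\<beta>. c * u \<beta>) = norm c * proj_norm E F u"
  proof (cases "c = 0")
    case True
    obtain xs where xs: "set xs \<subseteq> carrier E \<times> carrier F" "u = tensor E F xs"
      using u by (rule tensorsE)
    show ?thesis
      using le[OF xs, of c] nonneg[OF scale_tensors[OF u, of c]] True by simp
  next
    case False
    have "proj_norm E F (\<lambda>\<beta>. c * u \<beta>) / norm c \<le> proj_norm E F u"
      using le False by (intro proj_norm_ge u) (simp add: field_simps)
    moreover have "norm c * proj_norm E F u \<le> proj_norm E F (\<lambda>\<beta>. c * u \<beta>)"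
    proof (rule proj_norm_ge[OF scale_tensors[OF u]])
      fix xs assume xs: "set xs \<subseteq> carrier E \<times> carrier F" "(\<lambda>\<beta>. c * u \<beta>) = tensor E F xs"
      have "u = (\<lambda>\<beta>. inverse c * tensor E F xs \<beta>)"
        using False by (simp add: fun_eq_iff flip: xs(2))
      then have "proj_norm E F u \<le> norm (inverse c) * cost xs"
        using le[OF xs(1) refl, of "inverse c"] by simp
      then show "norm c * proj_norm E F u \<le> cost xs"
        using False by (simp add: norm_inverse norm_divide field_simps)
    qed
    ultimately show ?thesis using False by (simp add: field_simps)
  qed
qed

lemma proj_cross_norm:
  "\<forall>x\<in>carrier E. \<forall>y\<in>carrier F. proj_norm E F (tensor E F [(x, y)]) \<le> vnorm E x * vnorm F y"
proof (intro ballI)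
  fix x y assume "x \<in> carrier E" "y \<in> carrier F"
  then show "proj_norm E F (tensor E F [(x, y)]) \<le> vnorm E x * vnorm F y"
    using proj_norm_le[of "[(x, y)]"] by (simp add: cost_def)
qed

text \<open>Every representation of u costs at least norm (u \<beta>) / K, so the infimum does too;
  the division is why K = 0 is treated apart.\<close>

lemma proj_bounded_form:
  assumes \<beta>: "bilinear_form E F \<beta>" and "K \<ge> 0"
    and bound: "\<And>x y. x \<in> carrier E \<Longrightarrow> y \<in> carrier F \<Longrightarrow> norm (\<beta> x y) \<le> K * vnorm E x * vnorm F y"
  shows "(\<lambda>u. u \<beta>) \<in> bounded_forms (tensor_space E F (proj_norm E F)) K"
proof -
  have "norm (u \<beta>) \<le> K * proj_norm E F u" if u: "u \<in> tensors" for u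
  proof (cases "K = 0")
    case True
    then show ?thesis
      using u tensor_apply_le[OF _ \<beta> bound] by (auto elim!: tensorsE)
  next
    case False
    then have "norm (u \<beta>) / K \<le> proj_norm E F u"
      using tensor_apply_le[OF _ \<beta> bound] \<open>K \<ge> 0\<close>
      by (intro proj_norm_ge u) (auto simp: field_simps)
    then show ?thesis using False \<open>K \<ge> 0\<close> by (simp add: field_simps)
  qed
  then show ?thesis
    by (auto simp: bounded_forms_def linear_form_def tensor_space_def tensors_def)
qed

lemma inj_bounded_form:
  assumes f: "f \<in> bounded_forms E A" "A > 0" and g: "g \<in> bounded_forms F B" "B > 0"
  shows "(\<lambda>u. u (\<lambda>x y. f x * g y)) \<in> bounded_forms (tensor_space E F (inj_norm E F)) (A * B)"
proof -
  have f': "(\<lambda>x. of_real (1 / A) * f x) \<in> bounded_forms E 1"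
    and g': "(\<lambda>y. of_real (1 / B) * g y) \<in> bounded_forms F 1"
    using f g by (auto simp: bounded_forms_def linear_form_def norm_divide field_simps)
  have "norm (u (\<lambda>x y. f x * g y)) \<le> A * B * inj_norm E F u" if u: "u \<in> tensors" for u
  proof -
    obtain xs where xs: "set xs \<subseteq> carrier E \<times> carrier F" "u = tensor E F xs"
      using u by (rule tensorsE)
    have "u (\<lambda>x y. (of_real (1 / A) * f x) * (of_real (1 / B) * g y)) =
        of_real (1 / (A * B)) * u (\<lambda>x y. f x * g y)"
    proof -
      have "bilinear_form E F (\<lambda>x y. f x * g y)"
        "bilinear_form E F (\<lambda>x y. (of_real (1 / A) * f x) * (of_real (1 / B) * g y))"
        using f g f' g' unfolding bounded_forms_def by (intro bilinear_form_product; blast)+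
      moreover have "(\<Sum>(x, y)\<leftarrow>xs. (of_real (1 / A) * f x) * (of_real (1 / B) * g y)) =
          of_real (1 / (A * B)) * (\<Sum>(x, y)\<leftarrow>xs. f x * g y)"
        by (induction xs) (auto simp: add_divide_distrib)
      ultimately show ?thesis by (simp add: xs(2) tensor_def)
    qed
    moreover have "norm (u (\<lambda>x y. (of_real (1 / A) * f x) * (of_real (1 / B) * g y))) \<le> inj_norm E F u"
      by (rule inj_norm_ge[OF u f' g'])
    ultimately have "norm (of_real (1 / (A * B)) * u (\<lambda>x y. f x * g y)) \<le> inj_norm E F u"
      by (simp only:)
    then show ?thesis
      using f(2) g(2) by (simp only: norm_mult norm_of_real) (simp add: field_simps)
  qed
  then show ?thesis
    by (auto simp: bounded_forms_def linear_form_def tensor_space_def tensors_def)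
qed

text \<open>Freezing one factor leaves a bounded form of the other, which reduces weak nullity of
  the unit tensors to that of the unit vectors. The cross inequality \<open>T\<close> holds for the
  injective and for the projective norm.\<close>

lemma single_tensor_forms:
  assumes T: "\<forall>x\<in>carrier E. \<forall>y\<in>carrier F. N (tensor E F [(x, y)]) \<le> vnorm E x * vnorm F y"
    and h: "h \<in> bounded_forms (tensor_space E F N) C" and "C \<ge> 0"
  shows "x \<in> carrier E \<Longrightarrow> (\<lambda>y. h (tensor E F [(x, y)])) \<in> bounded_forms F (C * vnorm E x)"
    and "y \<in> carrier F \<Longrightarrow> (\<lambda>x. h (tensor E F [(x, y)])) \<in> bounded_forms E (C * vnorm F y)"
proof -
  have add: "h (\<lambda>\<beta>. u \<beta> + v \<beta>) = h u + h v" and scale: "h (\<lambda>\<beta>. c * u \<beta>) = c * h u"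
    and bd: "norm (h u) \<le> C * N u" if "u \<in> tensors" "v \<in> tensors" for u v c
    using h that by (auto simp: bounded_forms_def linear_form_def tensor_space_def tensors_def)
  have single: "tensor E F [(x, y)] \<in> tensors" if "x \<in> carrier E" "y \<in> carrier F" for x y
    using that by (intro tensorsI) auto
  have bound: "norm (h (tensor E F [(x, y)])) \<le> C * (vnorm E x * vnorm F y)"
    if "x \<in> carrier E" "y \<in> carrier F" for x y
    using bd[OF single[OF that] single[OF that]] mult_left_mono[OF T[rule_format, OF that] \<open>C \<ge> 0\<close>] by linarith
  show "(\<lambda>y. h (tensor E F [(x, y)])) \<in> bounded_forms F (C * vnorm E x)" if x: "x \<in> carrier E"
    unfolding bounded_forms_def F.linear_form_iff
  proof (intro CollectI conjI ballI allI)
    fix y c assume y: "y \<in> carrier F"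
    show "norm (h (tensor E F [(x, y)])) \<le> C * vnorm E x * vnorm F y"
      using bound[OF x y] by (simp add: mult.assoc)
    have "tensor E F [(x, vscale F c y)] = (\<lambda>\<beta>. c * tensor E F [(x, y)] \<beta>)"
      using bilinear_right[OF _ x] y by (auto simp: tensor_def fun_eq_iff linear_form_def)
    then show "h (tensor E F [(x, vscale F c y)]) = c * h (tensor E F [(x, y)])"
      using scale[OF single[OF x y] single[OF x y]] by simp
    fix z assume z: "z \<in> carrier F"
    have "tensor E F [(x, y + z)] = (\<lambda>\<beta>. tensor E F [(x, y)] \<beta> + tensor E F [(x, z)] \<beta>)"
      using bilinear_right[OF _ x] y z by (auto simp: tensor_def fun_eq_iff F.linear_form_iff)
    then show "h (tensor E F [(x, y + z)]) = h (tensor E F [(x, y)]) + h (tensor E F [(x, z)])"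
      using add[OF single[OF x y] single[OF x z]] by simp
  qed
  show "(\<lambda>x. h (tensor E F [(x, y)])) \<in> bounded_forms E (C * vnorm F y)" if y: "y \<in> carrier F"
    unfolding bounded_forms_def E.linear_form_iff
  proof (intro CollectI conjI ballI allI)
    fix x c assume x: "x \<in> carrier E"
    show "norm (h (tensor E F [(x, y)])) \<le> C * vnorm F y * vnorm E x"
      using bound[OF x y] by (simp add: mult_ac)
    have "tensor E F [(vscale E c x, y)] = (\<lambda>\<beta>. c * tensor E F [(x, y)] \<beta>)"
      using bilinear_left[OF _ y] x by (auto simp: tensor_def fun_eq_iff linear_form_def)
    then show "h (tensor E F [(vscale E c x, y)]) = c * h (tensor E F [(x, y)])"
      using scale[OF single[OF x y] single[OF x y]] by simp
    fix z assume z: "z \<in> carrier E"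
    have "tensor E F [(x + z, y)] = (\<lambda>\<beta>. tensor E F [(x, y)] \<beta> + tensor E F [(z, y)] \<beta>)"
      using bilinear_left[OF _ y] x z by (auto simp: tensor_def fun_eq_iff E.linear_form_iff)
    then show "h (tensor E F [(x + z, y)]) = h (tensor E F [(x, y)]) + h (tensor E F [(z, y)])"
      using add[OF single[OF x y] single[OF z y]] by simp
  qed
qed

end


subsection \<open>The tensor products of \<open>\<ell>\<^sub>p\<close> spaces\<close>

text \<open>The homogeneous version of \<open>tri_form_small\<close>: the vectors are rescaled so
  that A and B become (2^n)^(1/p) and (2^n)^(1/r), the norms of the all-ones vectors of length 2^n.
  These factors later cancel against the norm of the all-ones form or tensor.\<close>

lemma tri_form_small_scaled:
  fixes p r :: real
  assumes p: "p > 0" and r: "r > 0" and pr: "1 / p + 1 / r < 1" and \<epsilon>: "\<epsilon> > 0"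
  obtains n where "n > 0"
    "\<And>x y :: nat \<Rightarrow> 'k::{real_normed_field, euclidean_space}. \<And>A B. A \<ge> 0 \<Longrightarrow> B \<ge> 0 \<Longrightarrow>
       (\<Sum>k<2^n. norm (x k) powr p) \<le> A powr p \<Longrightarrow> (\<Sum>k<2^n. norm (y k) powr r) \<le> B powr r \<Longrightarrow>
       norm (tri_form n x y) * ((2^n) powr (1 / p) * (2^n) powr (1 / r)) \<le> \<epsilon> * real n * 2^n * A * B"
proof -
  obtain n where n: "n > 0"
    "\<And>x y :: nat \<Rightarrow> 'k. (\<Sum>k<2^n. norm (x k) powr p) \<le> 2^n \<Longrightarrow> (\<Sum>k<2^n. norm (y k) powr r) \<le> 2^n \<Longrightarrow>
       norm (tri_form n x y) \<le> \<epsilon> * real n * 2^n"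
    using tri_form_small[OF p r pr \<epsilon>, where 'k = 'k] by metis
  \<comment> \<open>For A = 0 or B = 0 no rescaling is possible; but 0 powr s is 0, so the vector
    vanishes on the range of summation.\<close>
  have zero: "x k = 0" if "(\<Sum>k<2^n. norm (x k) powr s) \<le> 0 powr s" "k < 2^n" for x :: "nat \<Rightarrow> 'k" and k s
  proof -
    have "norm (x k) powr s \<le> (\<Sum>k<2^n. norm (x k) powr s)"
      using that(2) by (intro member_le_sum) auto
    moreover have "0 powr s = (0 :: real)" by simp
    ultimately have "norm (x k) powr s \<le> 0" using that(1) by linarith
    then show ?thesis by (metis norm_eq_zero not_le powr_gt_zero)
  qed
  have scaled: "(\<Sum>k<2^n. norm (of_real ((2^n) powr (1 / s) / A) * x k) powr s) \<le> 2^n"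
    if "s > 0" "A > 0" "(\<Sum>k<2^n. norm (x k) powr s) \<le> A powr s" for x :: "nat \<Rightarrow> 'k" and s A
  proof -
    have "(\<Sum>k<2^n. norm (of_real ((2^n) powr (1 / s) / A) * x k) powr s) =
        2^n / A powr s * (\<Sum>k<2^n. norm (x k) powr s)"
      using that by (simp add: norm_mult norm_divide powr_mult powr_divide powr_powr sum_distrib_left)
    also have "\<dots> \<le> 2^n / A powr s * A powr s"
      using that by (intro mult_left_mono) auto
    finally show ?thesis using that by simp
  qed
  show thesis
  proof (rule that[OF n(1)])
    fix x y :: "nat \<Rightarrow> 'k" and A B :: real
    assume A: "A \<ge> 0" and B: "B \<ge> 0"
      and x: "(\<Sum>k<2^n. norm (x k) powr p) \<le> A powr p" and y: "(\<Sum>k<2^n. norm (y k) powr r) \<le> B powr r"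
    show "norm (tri_form n x y) * ((2^n) powr (1 / p) * (2^n) powr (1 / r)) \<le> \<epsilon> * real n * 2^n * A * B"
    proof (cases "A = 0 \<or> B = 0")
      case True
      then have "tri_form n x y = 0"
      proof
        assume "A = 0"
        then have "x k = 0" if "k < 2^n" for k using zero[OF _ that] x by simp
        then show ?thesis by (simp add: tri_form_def)
      next
        assume "B = 0"
        then have "y k = 0" if "k < 2^n" for k using zero[OF _ that] y by simp
        then show ?thesis by (simp add: tri_form_def)
      qed
      then show ?thesis using A B \<epsilon> by simp
    next
      case False
      then have AB: "A > 0" "B > 0" using A B by auto
      define a b where "a = (2^n) powr (1 / p) / A" and "b = (2^n) powr (1 / r) / B"
      have ab: "a > 0" "b > 0" using AB by (simp_all add: a_def b_def)
      have "tri_form n (\<lambda>k. of_real a * x k) (\<lambda>k. of_real b * y k) = of_real (a * b) * tri_form n x y"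
        unfolding tri_form_def sum_distrib_left by (intro sum.cong refl) simp
      moreover have "norm (tri_form n (\<lambda>k. of_real a * x k) (\<lambda>k. of_real b * y k)) \<le> \<epsilon> * real n * 2^n"
        unfolding a_def b_def by (intro n(2) scaled p r AB x y)
      ultimately have "(a * b) * norm (tri_form n x y) \<le> \<epsilon> * real n * 2^n"
        using ab by (simp add: norm_mult)
      then show ?thesis
        using AB by (simp add: a_def b_def field_simps)
    qed
  qed
qed

lemma sum_fun_apply: "(\<Sum>k\<in>A. f k) x = (\<Sum>k\<in>A. f k x :: 'a::comm_monoid_add)"
  by (induction A rule: infinite_finite_induct) auto

lemma upper_triangle_norm:
  "norm (\<Sum>k<2^n. \<Sum>l<2^n. if k \<le> l then of_real (tri n k l) else (0 :: 'k::real_normed_field)) = real n * 2^n / 2"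
proof -
  have eq: "(\<Sum>k<2^n. \<Sum>l<2^n. if k \<le> l then of_real (tri n k l) else (0 :: 'k)) =
      of_real (real n * 2^n / 2)"
    unfolding tri_upper_sum[symmetric] of_real_sum by (intro sum.cong refl) simp
  show ?thesis unfolding eq norm_of_real by simp
qed

text \<open>After division by n * 2^n the inequality would read 1/2 \<le> 1/4 + 1/8. The sign of B
  is not known, hence the divisor |B| + 1.\<close>

lemma frame_constant_contradiction:
  fixes B X D :: real
  assumes "real n * 2^n / 2 \<le> B * X * D + real n * 2^n / 8" "n > 0" "X \<ge> 0" "D \<ge> 0"
    "X * D \<le> 1 / (4 * (\<bar>B\<bar> + 1)) * real n * 2^n"
  shows False
proof -
  define M where "M = real n * 2^n"
  have M: "M > 0" using assms(2) by (simp add: M_def)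
  have "B * X * D \<le> (\<bar>B\<bar> + 1) * (X * D)"
    using assms by (simp add: mult.assoc mult_right_mono)
  also have "\<dots> \<le> (\<bar>B\<bar> + 1) * (1 / (4 * (\<bar>B\<bar> + 1)) * M)"
    using assms(5) by (intro mult_left_mono) (auto simp: M_def)
  also have "\<dots> = M / 4"
  proof -
    have cancel: "c * (1 / (4 * c) * M) = M / 4" if "c \<noteq> 0" for c :: real using that by simp
    show ?thesis by (rule cancel) linarith
  qed
  finally show False using assms(1) M unfolding M_def[symmetric] by linarith
qed

section \<open>Absence of frame systems on tensor products of two sequence spaces\<close>

locale lp_pair = seminormed_pair "lp s :: ('k::{real_normed_field, euclidean_space}, nat \<Rightarrow> 'k) nspace"
    "lp t :: ('k, nat \<Rightarrow> 'k) nspace" for s t :: real and scalars :: "'k::{real_normed_field, euclidean_space} itself" +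
  assumes st: "s > 1" "t > 1"
begin

abbreviation unit_tensor :: "nat \<Rightarrow> nat \<Rightarrow> ((nat \<Rightarrow> 'k) \<Rightarrow> (nat \<Rightarrow> 'k) \<Rightarrow> 'k) \<Rightarrow> 'k" where
  "unit_tensor i j \<equiv> tensor (lp s) (lp t) [(unit_seq i, unit_seq j)]"

lemma unit_tensor_weakly_null:
  fixes N :: "(((nat \<Rightarrow> 'k) \<Rightarrow> (nat \<Rightarrow> 'k) \<Rightarrow> 'k) \<Rightarrow> 'k) \<Rightarrow> real"
  assumes T: "seminormed_nspace (tensor_space (lp s) (lp t) N)"
    and cross: "\<forall>x\<in>carrier (lp s). \<forall>y\<in>carrier (lp t).
      N (tensor (lp s) (lp t) [(x, y)]) \<le> vnorm (lp s) x * vnorm (lp t) y"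
  shows "\<forall>h\<in>dual (tensor_space (lp s) (lp t) N). \<forall>i. (\<lambda>j. h (unit_tensor i j)) \<longlonglongrightarrow> 0"
    and "\<forall>h\<in>dual (tensor_space (lp s) (lp t) N). \<forall>j. (\<lambda>i. h (unit_tensor i j)) \<longlonglongrightarrow> 0"
proof -
  interpret T: seminormed_nspace "tensor_space (lp s) (lp t) N" by (rule T)
  let ?T = "tensor_space (lp s) (lp t) N"
  have bounded: "\<exists>C\<ge>0. h \<in> bounded_forms ?T C" if h: "h \<in> dual ?T" for h
  proof -
    obtain C where C: "\<And>u. u \<in> carrier ?T \<Longrightarrow> norm (h u) \<le> C * vnorm ?T u"
      using h by (auto simp: dual_def)
    have "norm (h u) \<le> \<bar>C\<bar> * vnorm ?T u" if "u \<in> carrier ?T" for u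
      using C[OF that] mult_right_mono[OF abs_ge_self T.vnorm_nonneg[OF that]] by (rule order_trans)
    then show ?thesis
      using h by (intro exI[of _ "\<bar>C\<bar>"]) (auto simp: bounded_forms_def dual_def)
  qed
  show "\<forall>h\<in>dual ?T. \<forall>i. (\<lambda>j. h (unit_tensor i j)) \<longlonglongrightarrow> 0"
  proof (intro ballI allI)
    fix h i assume "h \<in> dual ?T"
    then obtain C where C: "C \<ge> 0" "h \<in> bounded_forms ?T C" using bounded by blast
    show "(\<lambda>j. h (unit_tensor i j)) \<longlonglongrightarrow> 0"
      by (rule lp_form_tendsto_0[OF st(2) single_tensor_forms(1)[OF cross C(2,1) unit_seq_closed]])
  qed
  show "\<forall>h\<in>dual ?T. \<forall>j. (\<lambda>i. h (unit_tensor i j)) \<longlonglongrightarrow> 0"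
  proof (intro ballI allI)
    fix h j assume "h \<in> dual ?T"
    then obtain C where C: "C \<ge> 0" "h \<in> bounded_forms ?T C" using bounded by blast
    show "(\<lambda>i. h (unit_tensor i j)) \<longlonglongrightarrow> 0"
      by (rule lp_form_tendsto_0[OF st(1) single_tensor_forms(2)[OF cross C(2,1) unit_seq_closed]])
  qed
qed

lemma unit_tensor_closed: "unit_tensor i j \<in> carrier (tensor_space (lp s) (lp t) N)"
  unfolding carrier_tensor_space
  using unit_seq_closed by (intro tensorsI) (auto simp del: lp_simps)

lemma unit_tensor_apply:
  "bilinear_form (lp s) (lp t) \<beta> \<Longrightarrow> unit_tensor i j \<beta> = \<beta> (unit_seq i) (unit_seq j)"
  by (simp add: tensor_def)

lemma unit_tensor_sum_apply:
  assumes "bilinear_form (lp s) (lp t) \<beta>"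
  shows "(\<Sum>k<K. \<Sum>l<K. vscale (tensor_space (lp s) (lp t) N) (c k l) (unit_tensor (I k) (J l))) \<beta> =
    (\<Sum>k<K. \<Sum>l<K. c k l * \<beta> (unit_seq (I k)) (unit_seq (J l)))"
  by (simp add: sum_fun_apply unit_tensor_apply[OF assms] tensor_space_def)

text \<open>The injective norm sees a tensor through the values of functionals at unit vectors, and
  these values lie in unit balls for the conjugate exponents; hence the form of the
  hypothesis.\<close>

lemma no_inj_frame_system:
  assumes exponents: "1 / conj_exp s + 1 / conj_exp t < 1"
    and frame: "frame_system (tensor_space (lp s :: ('k, _) nspace) (lp t) (inj_norm (lp s) (lp t))) b \<gamma> B"
  shows False
proof -
  let ?E = "lp s :: ('k, _) nspace"
  let ?F = "lp t :: ('k, _) nspace"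
  let ?T = "tensor_space ?E ?F (inj_norm ?E ?F)"
  interpret T: seminormed_nspace ?T by (rule seminormed_inj)
  note null = unit_tensor_weakly_null[OF seminormed_inj inj_cross_norm]
  have conj: "conj_exp s > 0" "conj_exp t > 0" using st by (simp_all add: conj_exp_def)
  define \<epsilon> where "\<epsilon> = 1 / (4 * (\<bar>B\<bar> + 1))"
  have \<epsilon>: "\<epsilon> > 0" by (simp add: \<epsilon>_def)
  obtain n where n: "n > 0" and small:
    "\<And>x y :: nat \<Rightarrow> 'k. \<And>A B. A \<ge> 0 \<Longrightarrow> B \<ge> 0 \<Longrightarrow>
       (\<Sum>k<2^n. norm (x k) powr conj_exp s) \<le> A powr conj_exp s \<Longrightarrow>
       (\<Sum>k<2^n. norm (y k) powr conj_exp t) \<le> B powr conj_exp t \<Longrightarrow>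
       norm (tri_form n x y) * ((2^n) powr (1 / conj_exp s) * (2^n) powr (1 / conj_exp t)) \<le> \<epsilon> * real n * 2^n * A * B"
    using tri_form_small_scaled[OF conj exponents \<epsilon>, where 'k = 'k] by metis
  \<comment> \<open>Norm bounds for the forms that add up the coordinates at \<open>I\<close> and at
    \<open>J\<close>. They depend on n only, so the radius A * C is known before \<open>I\<close>
    and \<open>J\<close> are selected.\<close>
  define A C :: real where "A = (2^n) powr (1 / conj_exp s)" and "C = (2^n) powr (1 / conj_exp t)"
  have AC: "A > 0" "C > 0" by (simp_all add: A_def C_def)
  have D: "A * C \<ge> 0" and \<eta>: "real n * 2^n / 8 > 0" using AC n by simp_all
  obtain I J :: "nat \<Rightarrow> nat" where I: "inj_on I {..<2^n}" and J: "inj_on J {..<2^n}" and large: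
    "\<forall>y\<in>bounded_forms ?T (A * C).
       norm (\<Sum>k<2^n. \<Sum>l<2^n. if k \<le> l then of_real (tri n k l) * y (unit_tensor (I k) (J l)) else 0)
         \<le> B * vnorm ?T (\<Sum>k<2^n. \<Sum>l<2^n. vscale ?T (of_real (tri n k l)) (unit_tensor (I k) (J l))) * (A * C)
           + real n * 2^n / 8"
    by (rule T.frame_system_triangle[where K = "2^n" and c = "\<lambda>k l. of_real (tri n k l)" and e = unit_tensor,
          OF frame _ null D \<eta>]) (blast intro: unit_tensor_closed, rule that)
  define f g where "f = (\<lambda>x :: nat \<Rightarrow> 'k. \<Sum>k<2^n. x (I k))" and "g = (\<lambda>x :: nat \<Rightarrow> 'k. \<Sum>l<2^n. x (J l))"
  have ones: "(\<lambda>x :: nat \<Rightarrow> 'k. \<Sum>k<2^n. x (H k)) \<in> bounded_forms (lp u) ((2^n) powr (1 / conj_exp u))"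
    if "inj_on H {..<2^n}" "u > 1" for H :: "nat \<Rightarrow> nat" and u
  proof -
    have "norm (\<Sum>k<2^n. x (H k)) \<le> (2^n) powr (1 / conj_exp u) * vnorm (lp u) x" if "x \<in> carrier (lp u)"
      for x :: "nat \<Rightarrow> 'k"
    proof -
      have "norm (\<Sum>k<2^n. x (H k)) \<le> (\<Sum>k<2^n. norm (x (H k)))" by (rule norm_sum)
      also have "\<dots> = (\<Sum>i\<in>H ` {..<2^n}. norm (x i))"
        using \<open>inj_on H _\<close> by (simp add: sum.reindex)
      also have "\<dots> \<le> real (card (H ` {..<2^n})) powr (1 / conj_exp u) * vnorm (lp u) x"
        by (rule sum_norm_le_lp[OF \<open>u > 1\<close> that]) simp
      finally show ?thesis using \<open>inj_on H _\<close> by (simp add: card_image)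
    qed
    then show ?thesis
      by (auto simp: bounded_forms_def linear_form_def lp_def sum.distrib sum_distrib_left)
  qed
  have f: "f \<in> bounded_forms ?E A" and g: "g \<in> bounded_forms ?F C"
    unfolding f_def g_def A_def C_def using ones I J st by blast+
  have prod: "bilinear_form ?E ?F (\<lambda>x y. f x * g y)"
    using f g by (intro bilinear_form_product) (auto simp: bounded_forms_def)
  have unit: "(\<Sum>k'<2^n. unit_seq (H k) (H k') :: 'k) = 1" if "inj_on H {..<2^n}" "k < 2^n" for H :: "nat \<Rightarrow> nat" and k
  proof -
    have "(\<Sum>k'<2^n. unit_seq (H k) (H k') :: 'k) = (\<Sum>k'<2^n. if k' = k then 1 else 0)"
      using that by (intro sum.cong) (auto simp: unit_seq_def inj_on_def)
    then show ?thesis using that by simp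
  qed
  have entries: "unit_tensor (I k) (J l) (\<lambda>x y. f x * g y) = 1" if "k < 2^n" "l < 2^n" for k l
    unfolding unit_tensor_apply[OF prod] using unit[OF I that(1)] unit[OF J that(2)] by (simp add: f_def g_def)
  define X where "X = (\<Sum>k<2^n. \<Sum>l<2^n. vscale ?T (of_real (tri n k l)) (unit_tensor (I k) (J l)))"
  have X: "X \<in> carrier ?T"
    unfolding X_def by (rule T.sum_closed, rule T.sum_closed, rule T.scale_closed, rule unit_tensor_closed)
  have "inj_norm ?E ?F X \<le> \<epsilon> * real n * 2^n / (A * C)"
  proof (rule inj_norm_le)
    fix \<phi> \<psi> assume \<phi>: "\<phi> \<in> bounded_forms ?E 1" and \<psi>: "\<psi> \<in> bounded_forms ?F 1"
    have "bilinear_form ?E ?F (\<lambda>x y. \<phi> x * \<psi> y)"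
      using \<phi> \<psi> by (intro bilinear_form_product) (auto simp: bounded_forms_def)
    then have "X (\<lambda>x y. \<phi> x * \<psi> y) = tri_form n (\<lambda>k. \<phi> (unit_seq (I k))) (\<lambda>l. \<psi> (unit_seq (J l)))"
      unfolding X_def by (simp add: unit_tensor_sum_apply tri_form_def)
    moreover have "(\<Sum>k<2^n. norm (\<omega> (unit_seq (H k))) powr conj_exp u) \<le> 1 powr conj_exp u"
      if "inj_on H {..<2^n}" "u > 1" "\<omega> \<in> bounded_forms (lp u) 1"
      for H :: "nat \<Rightarrow> nat" and u and \<omega> :: "(nat \<Rightarrow> 'k) \<Rightarrow> 'k"
      using lp_form_sum_le[OF that(2) _ that(3), of "H ` {..<2^n}"] that(1) by (simp add: sum.reindex)
    ultimately show "norm (X (\<lambda>x y. \<phi> x * \<psi> y)) \<le> \<epsilon> * real n * 2^n / (A * C)"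
      using small[of 1 1 "\<lambda>k. \<phi> (unit_seq (I k))" "\<lambda>l. \<psi> (unit_seq (J l))"] I J st \<phi> \<psi> AC
      by (simp add: A_def C_def field_simps)
  qed
  then have "vnorm ?T X * (A * C) \<le> \<epsilon> * real n * 2^n"
    using AC by (simp add: tensor_space_def field_simps)
  moreover have "real n * 2^n / 2 \<le> B * vnorm ?T X * (A * C) + real n * 2^n / 8"
  proof -
    have "(\<Sum>k<2^n. \<Sum>l<2^n. if k \<le> l then of_real (tri n k l) * unit_tensor (I k) (J l) (\<lambda>x y. f x * g y) else 0) =
        (\<Sum>k<2^n. \<Sum>l<2^n. if k \<le> l then of_real (tri n k l) else (0 :: 'k))"
      by (intro sum.cong refl) (auto simp: entries)
    then show ?thesis
      using bspec[OF large inj_bounded_form[OF f AC(1) g AC(2)]] unfolding X_def by (simp only: upper_triangle_norm)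
  qed
  ultimately show False
    using frame_constant_contradiction[of n B "vnorm ?T X" "A * C"] n T.vnorm_nonneg[OF X] D
    unfolding \<epsilon>_def by blast
qed

text \<open>The matrix now acts on the coordinates of vectors, so s and t themselves enter instead
  of their conjugates.\<close>

lemma no_proj_frame_system:
  assumes exponents: "1 / s + 1 / t < 1"
    and frame: "frame_system (tensor_space (lp s :: ('k, _) nspace) (lp t) (proj_norm (lp s) (lp t))) b \<gamma> B"
  shows False
proof -
  let ?E = "lp s :: ('k, _) nspace"
  let ?F = "lp t :: ('k, _) nspace"
  let ?T = "tensor_space ?E ?F (proj_norm ?E ?F)"
  interpret T: seminormed_nspace ?T by (rule seminormed_proj)
  note null = unit_tensor_weakly_null[OF seminormed_proj proj_cross_norm]
  have pos: "s > 0" "t > 0" using st by simp_all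
  define \<epsilon> where "\<epsilon> = 1 / (4 * (\<bar>B\<bar> + 1))"
  have \<epsilon>: "\<epsilon> > 0" by (simp add: \<epsilon>_def)
  obtain n where n: "n > 0" and small:
    "\<And>x y :: nat \<Rightarrow> 'k. \<And>A B. A \<ge> 0 \<Longrightarrow> B \<ge> 0 \<Longrightarrow>
       (\<Sum>k<2^n. norm (x k) powr s) \<le> A powr s \<Longrightarrow> (\<Sum>k<2^n. norm (y k) powr t) \<le> B powr t \<Longrightarrow>
       norm (tri_form n x y) * ((2^n) powr (1 / s) * (2^n) powr (1 / t)) \<le> \<epsilon> * real n * 2^n * A * B"
    using tri_form_small_scaled[OF pos exponents \<epsilon>, where 'k = 'k] by metis
  define A C :: real where "A = (2^n) powr (1 / s)" and "C = (2^n) powr (1 / t)"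
  have AC: "A > 0" "C > 0" by (simp_all add: A_def C_def)
  \<comment> \<open>The norm bound that \<open>small\<close> gives for the matrix as a bilinear
    form, wherever \<open>I\<close> and \<open>J\<close> place it. As the tensor will have norm at
    most A * C, the product of the two norms is at most \<epsilon> * n * 2^n.\<close>
  define D where "D = \<epsilon> * real n * 2^n / (A * C)"
  have D: "D \<ge> 0" and \<eta>: "real n * 2^n / 8 > 0" using AC n \<epsilon> by (simp_all add: D_def)
  obtain I J :: "nat \<Rightarrow> nat" where I: "inj_on I {..<2^n}" and J: "inj_on J {..<2^n}" and large:
    "\<forall>y\<in>bounded_forms ?T D.
       norm (\<Sum>k<2^n. \<Sum>l<2^n. if k \<le> l then 1 * y (unit_tensor (I k) (J l)) else 0)
         \<le> B * vnorm ?T (\<Sum>k<2^n. \<Sum>l<2^n. vscale ?T 1 (unit_tensor (I k) (J l))) * D + real n * 2^n / 8"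
    by (rule T.frame_system_triangle[where K = "2^n" and c = "\<lambda>k l. 1" and e = unit_tensor,
          OF frame _ null D \<eta>]) (blast intro: unit_tensor_closed, rule that)
  define \<beta> where "\<beta> = (\<lambda>x y :: nat \<Rightarrow> 'k. tri_form n (\<lambda>k. x (I k)) (\<lambda>l. y (J l)))"
  have \<beta>: "bilinear_form ?E ?F \<beta>"
    by (simp add: bilinear_form_def linear_form_def \<beta>_def tri_form_def lp_def sum.distrib
        sum_distrib_left algebra_simps)
  have \<beta>_bound: "norm (\<beta> x y) \<le> D * vnorm ?E x * vnorm ?F y" if x: "x \<in> carrier ?E" and y: "y \<in> carrier ?F" for x y
  proof -
    have "(\<Sum>k<2^n. norm (z (H k)) powr u) \<le> vnorm (lp u) z powr u"
      if "inj_on H {..<2^n}" "u > 0" "z \<in> carrier (lp u)" for H :: "nat \<Rightarrow> nat" and u and z :: "nat \<Rightarrow> 'k"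
      using lp_partial_sum_le[OF that(2,3), of "H ` {..<2^n}"] that(1) by (simp add: sum.reindex)
    from small[OF _ _ this[OF I pos(1) x] this[OF J pos(2) y]]
    have "norm (\<beta> x y) * (A * C) \<le> \<epsilon> * real n * 2^n * vnorm ?E x * vnorm ?F y"
      unfolding \<beta>_def A_def C_def by simp
    then show ?thesis using AC by (simp add: D_def field_simps)
  qed
  define X where "X = (\<Sum>k<2^n. \<Sum>l<2^n. vscale ?T 1 (unit_tensor (I k) (J l)))"
  have X: "X \<in> carrier ?T"
    unfolding X_def by (rule T.sum_closed, rule T.sum_closed, rule T.scale_closed, rule unit_tensor_closed)
  define ones where "ones = (\<lambda>H :: nat \<Rightarrow> nat. \<lambda>i. if i \<in> H ` {..<2^n} then 1 else 0 :: 'k)"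
  have ones_closed: "ones H \<in> carrier (lp u)" for H u
    by (rule lp_finite_support(1)[of "H ` {..<2^n}"]) (auto simp: ones_def)
  have ones_norm: "vnorm (lp u) (ones H) = (2^n) powr (1 / u)" if "inj_on H {..<2^n}" for H u
    using that by (subst lp_finite_support(2)[of "H ` {..<2^n}"]) (auto simp: ones_def card_image)
  have ones_sum: "ones H = (\<Sum>k<2^n. unit_seq (H k))" if "inj_on H {..<2^n}" for H
  proof -
    have "ones H = (\<Sum>i\<in>H ` {..<2^n}. vscale (lp s) 1 (unit_seq i))"
      unfolding ones_def by (rule sum_unit_seq[symmetric]) simp
    then show ?thesis using that by (simp add: sum.reindex)
  qed
  \<comment> \<open>All coefficients being 1, the double sum is the elementary tensor of two
    indicator vectors, and the cross inequality bounds its norm.\<close>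
  have "X = tensor ?E ?F [(ones I, ones J)]"
  proof
    fix \<alpha>
    show "X \<alpha> = tensor ?E ?F [(ones I, ones J)] \<alpha>"
    proof (cases "bilinear_form ?E ?F \<alpha>")
      case True
      have "\<alpha> (ones I) (ones J) = (\<Sum>k<2^n. \<alpha> (unit_seq (I k)) (ones J))"
        unfolding ones_sum[OF I]
        by (rule E.linear_form_sum[OF bilinear_left[OF True ones_closed] unit_seq_closed])
      also have "\<dots> = (\<Sum>k<2^n. \<Sum>l<2^n. \<alpha> (unit_seq (I k)) (unit_seq (J l)))"
        unfolding ones_sum[OF J]
        by (intro sum.cong refl F.linear_form_sum[OF bilinear_right[OF True unit_seq_closed] unit_seq_closed])
      finally show ?thesis
        unfolding X_def unit_tensor_sum_apply[OF True] using True by (simp add: tensor_def)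
    next
      case False
      then show ?thesis
        by (simp add: X_def sum_fun_apply tensor_space_def tensor_def)
    qed
  qed
  then have "vnorm ?T X \<le> vnorm ?E (ones I) * vnorm ?F (ones J)"
    using proj_cross_norm[rule_format, OF ones_closed ones_closed, of I J] by (simp add: tensor_space_def)
  then have "vnorm ?T X \<le> A * C"
    by (simp only: ones_norm[OF I] ones_norm[OF J] A_def C_def)
  then have "vnorm ?T X * D \<le> (A * C) * D"
    using D by (intro mult_right_mono)
  then have "vnorm ?T X * D \<le> \<epsilon> * real n * 2^n"
    using AC by (simp add: D_def)
  moreover have "real n * 2^n / 2 \<le> B * vnorm ?T X * D + real n * 2^n / 8"
  proof -
    have "unit_tensor (I k) (J l) \<beta> = of_real (tri n k l)" if "k < 2^n" "l < 2^n" for k l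
    proof -
      have "unit_tensor (I k) (J l) \<beta> =
          (\<Sum>k'<2^n. \<Sum>l'<2^n. if l' = l then (if k' = k then of_real (tri n k' l') else 0) else 0)"
        unfolding unit_tensor_apply[OF \<beta>] unfolding \<beta>_def tri_form_def using I J that
        by (intro sum.cong refl) (auto simp: unit_seq_def inj_on_def)
      then show ?thesis using that by simp
    qed
    then have "(\<Sum>k<2^n. \<Sum>l<2^n. if k \<le> l then 1 * unit_tensor (I k) (J l) \<beta> else 0) =
        (\<Sum>k<2^n. \<Sum>l<2^n. if k \<le> l then of_real (tri n k l) else (0 :: 'k))"
      by (intro sum.cong refl) auto
    then show ?thesis
      using bspec[OF large proj_bounded_form[OF \<beta> D \<beta>_bound]] unfolding X_def by (simp only: upper_triangle_norm)
  qed
  ultimately show False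
    using frame_constant_contradiction[of n B "vnorm ?T X" D] n T.vnorm_nonneg[OF X] D
    unfolding \<epsilon>_def by blast
qed

end

lemma no_frame_of_no_frame_system:
  assumes E: "seminormed_nspace E" and none: "\<And>b \<gamma> B. \<not> frame_system E b \<gamma> B"
  shows "\<not> besselian_schauder_frame (completion E) a b" "\<not> unconditional_schauder_frame (completion E) a b"
proof -
  interpret completed_nspace E
    unfolding completed_nspace_def by (rule E)
  show "\<not> besselian_schauder_frame (completion E) a b"
    using besselian_frame_system none by blast
  show "\<not> unconditional_schauder_frame (completion E) a b"
    using unconditional_frame_system none by blast
qed

theorem proposition2:
  fixes p q :: real
    and X :: "('k::{real_normed_field, euclidean_space}, _) nspace"
    and Y :: "('k, _) nspace"
  assumes "p > q" and "q > 1"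
  defines "X \<equiv> lp (conj_exp p) \<otimes>\<^sub>\<epsilon> lp q"
    and "Y \<equiv> lp p \<otimes>\<^sub>\<pi> lp (conj_exp q)"
  shows "(\<nexists>a b. besselian_schauder_frame X a b) \<and>
         (\<nexists>a b. besselian_schauder_frame Y a b) \<and>
         (\<nexists>a b. unconditional_schauder_frame X a b) \<and>
         (\<nexists>a b. unconditional_schauder_frame Y a b)"
proof -
  have p: "p > 1" using assms by simp
  have conj: "conj_exp p > 1" "conj_exp q > 1" and conj_conj: "conj_exp (conj_exp p) = p"
    and inverse: "1 / conj_exp q = 1 - 1 / q"
    using p assms by (simp_all add: conj_exp_def field_simps)
  \<comment> \<open>As conjugation is an involution, both products lead to the same condition 1 / p
    + 1 / conj_exp q < 1, which says that 1 / p < 1 / q.\<close>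
  have "1 / p < 1 / q" using p assms by (simp add: field_simps)
  then have exponents: "1 / conj_exp (conj_exp p) + 1 / conj_exp q < 1" "1 / p + 1 / conj_exp q < 1"
    by (simp_all add: conj_conj inverse)
  have lp: "seminormed_nspace (lp r :: ('k, nat \<Rightarrow> 'k) nspace)" if "r > 1" for r
    using that by (intro seminormed_lp) simp
  interpret X: lp_pair "conj_exp p" q "TYPE('k)"
    by (intro lp_pair.intro seminormed_pair.intro lp_pair_axioms.intro lp conj assms)
  interpret Y: lp_pair p "conj_exp q" "TYPE('k)"
    by (intro lp_pair.intro seminormed_pair.intro lp_pair_axioms.intro lp conj p)
  have "\<not> frame_system (tensor_space (lp (conj_exp p)) (lp q) (inj_norm (lp (conj_exp p)) (lp q))) b \<gamma> B"
    for b :: "nat \<Rightarrow> _ \<Rightarrow> 'k" and \<gamma> B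
    using X.no_inj_frame_system[OF exponents(1)] by blast
  note X = no_frame_of_no_frame_system[OF X.seminormed_inj this]
  have "\<not> frame_system (tensor_space (lp p) (lp (conj_exp q)) (proj_norm (lp p) (lp (conj_exp q)))) b \<gamma> B"
    for b :: "nat \<Rightarrow> _ \<Rightarrow> 'k" and \<gamma> B
    using Y.no_proj_frame_system[OF exponents(2)] by blast
  note Y = no_frame_of_no_frame_system[OF Y.seminormed_proj this]
  show ?thesis
    unfolding X_def Y_def inj_tensor_def proj_tensor_def using X Y by blast
qed

end
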